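(* Let $n\ge 2$, $0<\alpha<n$, $0<\gamma<\infty$, $M\ge 1$ and $q_1,\dots,q_M\in(0,1)$. Let $\sigma_1,\dots,\sigma_M,\omega$ be nonnegative functions on $\mathbb R^n$ (identified with the measures $\sigma_i\,dx$, $\omega\,dx$), with $(\sigma_1,\dots,\sigma_M,\omega)\neq(0,\dots,0,0)$, such that $$\sigma_i\in L^{s_i,t_i}(\mathbb R^n),\quad s_i=\frac{n(\gamma+1)}{n(1-q_i)+\alpha(\gamma+q_i)},\quad t_i=\frac{\gamma+1}{1-q_i},\qquad i=1,\dots,M,$$ $$\omega\in L^{\tilde s,\tilde t}(\mathbb R^n),\quad \tilde s=\frac{n(\gamma+1)}{n+\alpha\gamma},\quad \tilde t=\gamma+1.$$ Then there exists a positive minimal solution $u\in L^{r,\rho}(\mathbb R^n)$, with $r=\frac{n(\gamma+1)}{n-\alpha}$ and $\rho=\gamma+1$, to the problem $$(P)\qquad (-\Delta)^{\frac{\alpha}{2}}u=\sum_{i=1}^M\sigma_i u^{q_i}+\omega,\quad u\ge0\ \text{ in }\mathbb R^n,\qquad \liminf_{x\to\infty}u(x)=0,$$ with solutions understood in the sense of the integral equation given in the context.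
   Context: Riesz potential: for a nonnegative locally finite Borel measure $\mu$ on $\mathbb R^n$ and $0<\alpha<n$, $\mathcal I_\alpha\mu(x)=(-\Delta)^{-\frac{\alpha}{2}}\mu(x)=(n-\alpha)c(n,\alpha)\int_0^\infty\frac{\mu(B(x,r))}{r^{n-\alpha}}\frac{dr}{r}$, $x\in\mathbb R^n$, where $B(x,r)$ is the open ball of center $x$ and radius $r$ and $c(n,\alpha)>0$ is a normalization constant (omitted from the notation in the source). Solution: a solution to $(P)$ is a nonnegative measurable function $u$ on $\mathbb R^n$ with $u\in L^{q_i}_{loc}(\mathbb R^n,d\sigma_i)$ for all $i=1,\dots,M$ such that $u=\sum_{i=1}^M\mathcal I_\alpha(u^{q_i}d\sigma_i)+\mathcal I_\alpha\omega$ in $\mathbb R^n$. If "$=$" is replaced by "$\ge$", $u$ is called a supersolution. A nontrivial solution $u$ is minimal if $u\le v$ in $\mathbb R^n$ for any nontrivial supersolution $v$ to $(P)$. Lorentz space: for $0<r,\rho<\infty$, $L^{r,\rho}(\mathbb R^n)$ is the set of measurable $f$ with $\|f\|_{L^{r,\rho}}=\big(\int_0^\infty (t^{1/r}f^*(t))^\rho\frac{dt}{t}\big)^{1/\rho}<\infty$, $f^*$ being the decreasing rearrangement of $f$ with respect to Lebesgue measure.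
   Formalization: In the definition of minimal, a supersolution v counts as nontrivial only if its right-hand side (the sum of potentials) is not identically zero; with merely v ≠ 0 the claim fails, e.g. for ω = 0 and v the indicator of a ball off the supports of the σ_i. *)

theory Defs
  imports "HOL-Analysis.Analysis"
begin

text \<open>Real powers on \<open>[0,\<infinity>]\<close>; only used for exponents \<open>p > 0\<close>, where \<open>0\<close> and \<open>\<infinity>\<close> are fixed.\<close>

definition enn_powr :: "ennreal \<Rightarrow> real \<Rightarrow> ennreal" where
  "enn_powr x p = (if x = \<infinity> then \<infinity> else ennreal (enn2real x powr p))"

text \<open>The normalization for which the Riesz potential below is \<open>(-\<Delta>)\<close> to the power \<open>-\<alpha>/2\<close>,
  i.e. convolution with the kernel \<open>c(n,\<alpha>) |x|\<close> to the power \<open>\<alpha> - n\<close>.\<close>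

definition riesz_const :: "nat \<Rightarrow> real \<Rightarrow> real" where
  "riesz_const n \<alpha> =
     Gamma ((real n - \<alpha>) / 2) / (2 powr \<alpha> * pi powr (real n / 2) * Gamma (\<alpha> / 2))"

definition riesz_potential :: "real \<Rightarrow> 'a::euclidean_space measure \<Rightarrow> 'a \<Rightarrow> ennreal" where
  "riesz_potential \<alpha> \<mu> x =
     ennreal ((real DIM('a) - \<alpha>) * riesz_const DIM('a) \<alpha>) *
     (\<integral>\<^sup>+ r \<in> {0<..}. emeasure \<mu> (ball x r) / ennreal (r powr (real DIM('a) - \<alpha>)) / ennreal r \<partial>lborel)"

text \<open>Functions that enter only through their modulus are taken with values in \<open>[0,\<infinity>]\<close>.\<close>

definition Lq_loc :: "real \<Rightarrow> 'a::euclidean_space measure \<Rightarrow> ('a \<Rightarrow> ennreal) set" where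
  "Lq_loc q \<mu> = {u. u \<in> borel_measurable \<mu> \<and>
     (\<forall>K. compact K \<longrightarrow> (\<integral>\<^sup>+ x \<in> K. enn_powr (u x) q \<partial>\<mu>) < \<infinity>)}"

definition decreasing_rearrangement :: "('a::euclidean_space \<Rightarrow> ennreal) \<Rightarrow> real \<Rightarrow> ennreal" where
  "decreasing_rearrangement f t = Inf {s. emeasure lebesgue {x. s < f x} \<le> ennreal t}"

definition lorentz_norm :: "real \<Rightarrow> real \<Rightarrow> ('a::euclidean_space \<Rightarrow> ennreal) \<Rightarrow> ennreal" where
  "lorentz_norm r \<rho> f =
     enn_powr
       (\<integral>\<^sup>+ t \<in> {0<..}. enn_powr (ennreal (t powr (1 / r)) * decreasing_rearrangement f t) \<rho>
                        / ennreal t \<partial>lborel)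
       (1 / \<rho>)"

definition lorentz_space :: "real \<Rightarrow> real \<Rightarrow> ('a::euclidean_space \<Rightarrow> ennreal) set" where
  "lorentz_space r \<rho> = {f. f \<in> borel_measurable lebesgue \<and> lorentz_norm r \<rho> f < \<infinity>}"

text \<open>The right-hand side of the integral equation, for measures \<open>\<sigma> 1, \<dots>, \<sigma> M\<close> and \<open>\<omega>\<close>.\<close>

definition integral_rhs ::
  "real \<Rightarrow> nat \<Rightarrow> (nat \<Rightarrow> real) \<Rightarrow> (nat \<Rightarrow> 'a::euclidean_space measure) \<Rightarrow> 'a measure
     \<Rightarrow> ('a \<Rightarrow> ennreal) \<Rightarrow> 'a \<Rightarrow> ennreal" where
  "integral_rhs \<alpha> M q \<sigma> \<omega> u x =
     (\<Sum>i = 1..M. riesz_potential \<alpha> (density (\<sigma> i) (\<lambda>y. enn_powr (u y) (q i))) x)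
     + riesz_potential \<alpha> \<omega> x"

text \<open>Potentials are defined at every point but may be infinite at some, so (super)solutions are
  \<open>[0,\<infinity>]\<close>-valued and the (in)equality is required at every point.\<close>

definition is_solution ::
  "real \<Rightarrow> nat \<Rightarrow> (nat \<Rightarrow> real) \<Rightarrow> (nat \<Rightarrow> 'a::euclidean_space measure) \<Rightarrow> 'a measure
     \<Rightarrow> ('a \<Rightarrow> ennreal) \<Rightarrow> bool" where
  "is_solution \<alpha> M q \<sigma> \<omega> u \<longleftrightarrow>
     u \<in> borel_measurable lebesgue \<and>
     (\<forall>i\<in>{1..M}. u \<in> Lq_loc (q i) (\<sigma> i)) \<and>
     (\<forall>x. u x = integral_rhs \<alpha> M q \<sigma> \<omega> u x)"

definition is_supersolution ::
  "real \<Rightarrow> nat \<Rightarrow> (nat \<Rightarrow> real) \<Rightarrow> (nat \<Rightarrow> 'a::euclidean_space measure) \<Rightarrow> 'a measure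
     \<Rightarrow> ('a \<Rightarrow> ennreal) \<Rightarrow> bool" where
  "is_supersolution \<alpha> M q \<sigma> \<omega> u \<longleftrightarrow>
     u \<in> borel_measurable lebesgue \<and>
     (\<forall>i\<in>{1..M}. u \<in> Lq_loc (q i) (\<sigma> i)) \<and>
     (\<forall>x. u x \<ge> integral_rhs \<alpha> M q \<sigma> \<omega> u x)"

text \<open>A (super)solution is nontrivial if the right-hand side it generates is not identically zero.
  For solutions this says exactly that \<open>u\<close> is not identically zero. For supersolutions the
  condition \<open>u \<noteq> 0\<close> alone would be too weak: if \<open>\<omega> = 0\<close>, every bounded \<open>v\<close> that vanishes on the
  supports of all \<open>\<sigma> i\<close> is a supersolution with zero right-hand side, and no positive
  solution lies below it.\<close>

definition nontrivial ::
  "real \<Rightarrow> nat \<Rightarrow> (nat \<Rightarrow> real) \<Rightarrow> (nat \<Rightarrow> 'a::euclidean_space measure) \<Rightarrow> 'a measure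
     \<Rightarrow> ('a \<Rightarrow> ennreal) \<Rightarrow> bool" where
  "nontrivial \<alpha> M q \<sigma> \<omega> u \<longleftrightarrow> (\<exists>x. integral_rhs \<alpha> M q \<sigma> \<omega> u x \<noteq> 0)"

definition is_minimal_solution ::
  "real \<Rightarrow> nat \<Rightarrow> (nat \<Rightarrow> real) \<Rightarrow> (nat \<Rightarrow> 'a::euclidean_space measure) \<Rightarrow> 'a measure
     \<Rightarrow> ('a \<Rightarrow> ennreal) \<Rightarrow> bool" where
  "is_minimal_solution \<alpha> M q \<sigma> \<omega> u \<longleftrightarrow>
     is_solution \<alpha> M q \<sigma> \<omega> u \<and> nontrivial \<alpha> M q \<sigma> \<omega> u \<and>
     (\<forall>v. is_supersolution \<alpha> M q \<sigma> \<omega> v \<and> nontrivial \<alpha> M q \<sigma> \<omega> v \<longrightarrow> (\<forall>x. u x \<le> v x))"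

end

theory Submission
  imports Defs
begin

text \<open>
  Write \<open>I\<close> for the Riesz potential and \<open>F u = \<Sum>\<^sub>i \<sigma>\<^sub>i u\<^bsup>q\<^sub>i\<^esup> + \<omega>\<close>, so that the equation reads \<open>u = I (F u)\<close>.

  Existence and minimality: replace the data by \<open>min \<sigma>\<^sub>i m\<close> and \<open>min \<omega> m\<close> restricted to the ball of
  radius \<open>m\<close>. This problem has a bounded solution \<open>u\<^sub>m\<close>, obtained by iterating \<open>I \<circ> F\<close> upwards from a
  small multiple of the indicator of the ball and staying below a large constant. With \<open>Q = max q\<^sub>i < 1\<close>,
  \<open>v \<ge> t u\<^sub>m\<close> on the ball implies \<open>v \<ge> t\<^sup>Q u\<^sub>m\<close> for every supersolution \<open>v\<close>; since a nontrivial \<open>v\<close> is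
  bounded below on balls by a positive constant, iteration gives \<open>v \<ge> u\<^sub>m\<close>. Hence \<open>u\<^sub>m\<close> increases in \<open>m\<close>,
  and its limit is the minimal solution once it is known to be finite in the required sense.

  A priori estimate: O'Neil's inequality
  \<open>(I f)\<^sup>*(t) \<le> C \<integral>\<^sub>0\<^sup>\<infinity> f\<^sup>*(s) max(t,s)\<^bsup>\<alpha>/n-1\<^esup> ds\<close> and the Schur test bound \<open>I\<close> from \<open>L\<^bsup>s,\<rho>\<^esup>\<close> to \<open>L\<^bsup>r,\<rho>\<^esup>\<close>
  for \<open>1/s = 1/r + \<alpha>/n < 1\<close>. Since \<open>(F u)\<^sup>*((M+2)t) \<le> \<Sum>\<^sub>i \<sigma>\<^sub>i\<^sup>*(t) u\<^sup>*(t)\<^bsup>q\<^sub>i\<^esup> + \<omega>\<^sup>*(t)\<close>, Young's inequality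
  absorbs the dependence of \<open>F u\<close> on \<open>u\<close>, and the norm of \<open>u\<^sub>m\<close> in \<open>L\<^bsup>r,\<rho>\<^esup>\<close> is bounded independently of \<open>m\<close>.
\<close>

section \<open>Powers of extended nonnegative reals\<close>

text \<open>Two obstacles shape the proof. The a priori estimate can only absorb a norm already
  known to be finite, and the comparison needs a bounded solution, so that some positive multiple of
  it lies below \<open>v\<close> on the ball. Truncating the data supplies both. Sublinearity acts
  through the single exponent \<open>Q\<close>: it makes large constants supersolutions and small
  multiples of the indicator subsolutions, and it turns a factor \<open>t\<close> into
  \<open>t powr (Q ^ j)\<close>, which tends to 1. The exponents enter through their reciprocals:
  with \<open>p = 1/r\<close>, \<open>P = 1/s\<close> and \<open>e i\<close> the reciprocal of the
  first exponent of \<sigma>_i, one has \<open>P = p * q i + e i\<close> and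
  \<open>P = p + \<alpha>/n\<close>; the second exponent \<rho>/(1 - q_i) is \<rho> times the power
  that Young's inequality puts on \<sigma>_i. The factor \<open>M + 2\<close> counts exceptional
  sets, one each for u, for \<omega> and for every \<sigma>_i. The equation survives the limit at
  every point, because potentials commute pointwise with increasing limits.\<close>

lemma enn_powr_top [simp]: "enn_powr top p = top"
  by (simp add: enn_powr_def)

lemma enn_powr_0 [simp]: "enn_powr 0 p = 0"
  by (simp add: enn_powr_def)

lemma enn_powr_1 [simp]: "enn_powr 1 p = 1"
  by (simp add: enn_powr_def)

lemma enn_powr_ennreal: "0 \<le> x \<Longrightarrow> enn_powr (ennreal x) p = ennreal (x powr p)"
  by (simp add: enn_powr_def)

lemma enn_powr_exponent_1 [simp]: "enn_powr x 1 = x"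
  by (cases x) (simp_all add: enn_powr_ennreal)

lemma enn_powr_eq_top_iff [simp]: "enn_powr x p = top \<longleftrightarrow> x = top"
  by (simp add: enn_powr_def)

lemma enn_powr_less_top_iff [simp]: "enn_powr x p < top \<longleftrightarrow> x < top"
  by (simp add: less_top[symmetric])

lemma enn_powr_mono: "x \<le> y \<Longrightarrow> 0 \<le> p \<Longrightarrow> enn_powr x p \<le> enn_powr y p"
  by (cases x; cases y) (auto simp: enn_powr_ennreal ennreal_leI powr_mono2 top_unique)

text \<open>No sign condition on \<open>p\<close>: 0 and top are fixed by every power, so a product
  with such a factor only requires that no nonzero value is sent to 0.\<close>

lemma enn_powr_mult: "enn_powr (x * y) p = enn_powr x p * enn_powr y p"
proof (cases "x = 0 \<or> y = 0 \<or> x = top \<or> y = top")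
  case True
  have *: "enn_powr z p = 0 \<longleftrightarrow> z = 0" for z
    by (cases z) (auto simp: enn_powr_ennreal)
  from True show ?thesis
    by (auto simp: ennreal_mult_top ennreal_top_mult *)
next
  case False
  then show ?thesis
    by (cases x; cases y) (auto simp: enn_powr_ennreal powr_mult simp flip: ennreal_mult)
qed

lemma enn_powr_powr: "enn_powr (enn_powr x p) q = enn_powr x (p * q)"
  by (cases x) (simp_all add: enn_powr_ennreal powr_powr)

lemma enn_powr_add: "enn_powr x (p + q) = enn_powr x p * enn_powr x q"
  by (cases x) (auto simp: enn_powr_ennreal powr_add ennreal_mult)

text \<open>The powers \<open>p\<close> and \<open>1 / p\<close> are inverse order isomorphisms.
  This adjunction is what makes powers commute with arbitrary suprema.\<close>

lemma enn_powr_le_iff: "0 < p \<Longrightarrow> enn_powr x p \<le> y \<longleftrightarrow> x \<le> enn_powr y (1 / p)"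
  using enn_powr_mono[of "enn_powr x p" y "1 / p"] enn_powr_mono[of x "enn_powr y (1 / p)" p]
  by (auto simp: enn_powr_powr)

lemma enn_powr_SUP: "0 < p \<Longrightarrow> enn_powr (SUP i\<in>I. f i) p = (SUP i\<in>I. enn_powr (f i) p)"
proof (intro order_antisym)
  assume p: "0 < p"
  have "f i \<le> enn_powr (SUP i\<in>I. enn_powr (f i) p) (1 / p)" if "i \<in> I" for i
    using that p by (subst enn_powr_le_iff[symmetric]) (auto intro: SUP_upper)
  then show "enn_powr (SUP i\<in>I. f i) p \<le> (SUP i\<in>I. enn_powr (f i) p)"
    using p by (simp add: enn_powr_le_iff SUP_le_iff)
  show "(SUP i\<in>I. enn_powr (f i) p) \<le> enn_powr (SUP i\<in>I. f i) p"
    using p by (intro SUP_least enn_powr_mono SUP_upper) auto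
qed

lemma enn_powr_measurable [measurable (raw)]:
  "f \<in> borel_measurable M \<Longrightarrow> (\<lambda>x. enn_powr (f x) p) \<in> borel_measurable M"
proof -
  assume f [measurable]: "f \<in> borel_measurable M"
  have [measurable]: "Measurable.pred M (\<lambda>x. f x = top)"
    by simp
  have "(\<lambda>x. enn2real (f x) powr p) \<in> borel_measurable M"
    by (intro powr_real_measurable) auto
  then show ?thesis
    unfolding enn_powr_def infinity_ennreal_def by measurable
qed

text \<open>The sum is at most \<open>card J\<close> times its largest term; cruder than convexity,
  but valid for every exponent \<open>p > 0\<close>.\<close>

lemma enn_powr_sum_le:
  assumes "finite J" "0 < p"
  shows "enn_powr (\<Sum>j\<in>J. x j) p \<le> ennreal (real (card J) powr p) * (\<Sum>j\<in>J. enn_powr (x j) p)"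
proof (cases "J = {}")
  case False
  define m where "m = Max (x ` J)"
  have "m \<in> x ` J"
    unfolding m_def using assms False by (intro Max_in) auto
  then obtain k where k: "k \<in> J" "m = x k"
    by auto
  have "(\<Sum>j\<in>J. x j) \<le> of_nat (card J) * m"
    using assms by (intro sum_bounded_above) (auto simp: m_def)
  then have "enn_powr (\<Sum>j\<in>J. x j) p \<le> enn_powr (of_nat (card J) * m) p"
    using assms by (intro enn_powr_mono) auto
  also have "\<dots> = ennreal (real (card J) powr p) * enn_powr m p"
    by (simp add: enn_powr_mult enn_powr_ennreal flip: ennreal_of_nat_eq_real_of_nat)
       (simp add: enn_powr_ennreal ennreal_of_nat_eq_real_of_nat)
  also have "\<dots> \<le> ennreal (real (card J) powr p) * (\<Sum>j\<in>J. enn_powr (x j) p)"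
    using k assms member_le_sum[of k J "\<lambda>j. enn_powr (x j) p"] by (intro mult_left_mono) auto
  finally show ?thesis .
qed simp

lemma enn_powr_add_le:
  assumes "0 < p"
  shows "enn_powr (x + y) p \<le> ennreal (2 powr p) * (enn_powr x p + enn_powr y p)"
proof -
  have "enn_powr (x + y) p \<le> enn_powr (2 * max x y) p"
    using assms
    by (intro enn_powr_mono) (auto simp: mult_2 intro!: add_mono)
  also have "\<dots> = ennreal (2 powr p) * enn_powr (max x y) p"
    using enn_powr_ennreal[of 2 p] by (simp add: enn_powr_mult)
  also have "\<dots> \<le> ennreal (2 powr p) * (enn_powr x p + enn_powr y p)"
    by (intro mult_left_mono) (auto simp: max_def)
  finally show ?thesis .
qed

text \<open>The constant comes from the case distinction \<open>y \<le> \<epsilon> x\<^bsup>1-q\<^esup>\<close> or not.\<close>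

lemma enn_powr_Young:
  assumes q: "0 < q" "q < 1" and e: "0 < \<epsilon>"
  shows "enn_powr x q * y \<le> ennreal \<epsilon> * x + ennreal (\<epsilon> powr (- (q / (1 - q)))) * enn_powr y (1 / (1 - q))"
proof (cases "y \<le> ennreal \<epsilon> * enn_powr x (1 - q)")
  case True
  then have "enn_powr x q * y \<le> enn_powr x q * (ennreal \<epsilon> * enn_powr x (1 - q))"
    by (intro mult_left_mono) auto
  also have "\<dots> = ennreal \<epsilon> * x"
    using enn_powr_add[of x q "1 - q"] by (simp add: ac_simps)
  also have "\<dots> \<le> \<dots> + ennreal (\<epsilon> powr (- (q / (1 - q)))) * enn_powr y (1 / (1 - q))"
    by simp
  finally show ?thesis .
next
  case False
  have "enn_powr x (1 - q) = ennreal (1 / \<epsilon>) * (ennreal \<epsilon> * enn_powr x (1 - q))"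
    using e by (simp flip: mult.assoc ennreal_mult)
  also have "\<dots> \<le> ennreal (1 / \<epsilon>) * y"
    using False by (intro mult_left_mono) auto
  finally have "x \<le> enn_powr (ennreal (1 / \<epsilon>) * y) (1 / (1 - q))"
    using q by (simp add: enn_powr_le_iff)
  then have "enn_powr x q * y \<le> enn_powr (enn_powr (ennreal (1 / \<epsilon>) * y) (1 / (1 - q))) q * y"
    using q by (intro mult_right_mono enn_powr_mono) auto
  also have "\<dots> = ennreal ((1 / \<epsilon>) powr (q / (1 - q))) * (enn_powr y (q / (1 - q)) * enn_powr y 1)"
    using e q by (simp add: enn_powr_mult enn_powr_powr enn_powr_ennreal powr_powr ac_simps)
  also have "\<dots> = ennreal (\<epsilon> powr (- (q / (1 - q)))) * enn_powr y (1 / (1 - q))"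
    using e q by (subst enn_powr_add[symmetric]) (auto simp: powr_divide powr_minus field_simps)
  also have "\<dots> \<le> ennreal \<epsilon> * x + \<dots>"
    by simp
  finally show ?thesis .
qed

section \<open>Integrals of powers, sigma-finiteness and lengths of intervals\<close>

lemma nn_integral_powr_from_0:
  assumes "0 < e" "0 \<le> c"
  shows "(\<integral>\<^sup>+ t \<in> {0<..<c}. ennreal (t powr (e - 1)) \<partial>lborel) = ennreal (c powr e / e)"
proof -
  have "((\<lambda>t. t powr (e - 1)) has_integral (c powr e / e)) {0..c}"
    using has_integral_powr_from_0[of "e - 1" c] assms by simp
  from nn_integral_has_integral_lebesgue[OF _ this]
  have "ennreal (c powr e / e) = (\<integral>\<^sup>+ t. ennreal (indicator {0..c} t * t powr (e - 1)) \<partial>lborel)"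
    by simp
  also have "\<dots> = (\<integral>\<^sup>+ t \<in> {0<..<c}. ennreal (t powr (e - 1)) \<partial>lborel)"
    using AE_lborel_singleton[of 0] AE_lborel_singleton[of c]
    by (intro nn_integral_cong_AE) (auto split: split_indicator)
  finally show ?thesis ..
qed

lemma nn_integral_powr_to_inf:
  assumes "0 < e" "0 < c"
  shows "(\<integral>\<^sup>+ t \<in> {c<..}. ennreal (t powr (- e - 1)) \<partial>lborel) = ennreal (c powr (- e) / e)"
proof -
  have "((\<lambda>t. t powr (- e - 1)) has_integral (c powr (- e) / e)) {c..}"
    using has_integral_powr_to_inf[of "- e - 1" c] assms by simp
  from nn_integral_has_integral_lebesgue[OF _ this]
  have "ennreal (c powr (- e) / e) = (\<integral>\<^sup>+ t. ennreal (indicator {c..} t * t powr (- e - 1)) \<partial>lborel)"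
    by simp
  also have "\<dots> = (\<integral>\<^sup>+ t \<in> {c<..}. ennreal (t powr (- e - 1)) \<partial>lborel)"
    using AE_lborel_singleton[of c]
    by (intro nn_integral_cong_AE) (auto split: split_indicator)
  finally show ?thesis ..
qed

text \<open>A countable Borel cover by sets of finite measure serves for the completion too, since
  both measures agree on Borel sets. Tonelli's theorem is applied below with \<open>lebesgue\<close>
  as a factor.\<close>

lemma sigma_finite_lebesgue: "sigma_finite_measure (lebesgue :: 'a::euclidean_space measure)"
proof
  obtain A :: "'a set set" where A: "countable A" "A \<subseteq> sets lborel" "\<Union>A = space lborel"
      "\<forall>a\<in>A. emeasure lborel a \<noteq> \<infinity>"
    using lborel.sigma_finite_countable by blast
  then show "\<exists>A. countable A \<and> A \<subseteq> sets (lebesgue :: 'a measure) \<and> \<Union>A = space lebesgue \<and>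
      (\<forall>a\<in>A. emeasure lebesgue a \<noteq> \<infinity>)"
    by (intro exI[of _ A]) (auto simp: subset_eq)
qed

lemma pair_sigma_finite_lebesgue:
  "pair_sigma_finite (lebesgue :: 'a::euclidean_space measure) (lebesgue :: 'b::euclidean_space measure)"
  "pair_sigma_finite (lebesgue :: 'a::euclidean_space measure) (lborel :: 'b measure)"
  by (simp_all add: pair_sigma_finite_def sigma_finite_lebesgue lborel.sigma_finite_measure_axioms)

text \<open>Writes a value in [0,\<infinity>] as the length of an interval; the layer cake formula
  and the comparison with rearrangements rest on this.\<close>

lemma emeasure_Ioo_ennreal_bound: "emeasure lborel {s. 0 < s \<and> ennreal s < c} = c"
proof (cases c)
  case (real r)
  then have "{s. 0 < s \<and> ennreal s < c} = {0<..<r}"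
    by (auto simp: ennreal_less_iff)
  then show ?thesis
    using real by simp
next
  case top
  then have "{s. 0 < s \<and> ennreal s < c} = {0<..}"
    by auto
  moreover have "emeasure lborel {(0::real)<..} \<ge> of_nat n" for n
  proof -
    have "emeasure lborel {0<..<real n} \<le> emeasure lborel {(0::real)<..}"
      by (intro emeasure_mono) auto
    then show ?thesis
      by (simp add: ennreal_of_nat_eq_real_of_nat)
  qed
  then have "emeasure lborel {(0::real)<..} = top"
    by (metis SUP_least ennreal_SUP_of_nat_eq_top top_unique)
  ultimately show ?thesis
    using top by simp
qed

section \<open>Decreasing rearrangements\<close>

lemma superlevel_set_lebesgue [simp]:
  "f \<in> borel_measurable lebesgue \<Longrightarrow> {x. (s::ennreal) < f x} \<in> sets lebesgue"
  using borel_measurable_less[of "\<lambda>_. s" lebesgue f] by simp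

declare emeasure_completion [simp del]

text \<open>The infimum defining the rearrangement is attained, by right continuity of the
  distribution function: {s < f} is the increasing union of the sets {s + 1/(k+1) < f}, so some
  level strictly above \<open>s\<close> still has a superlevel set of measure above
  \<open>t\<close>, which keeps the infimum away from \<open>s\<close>.\<close>

lemma less_rearrangement_iff:
  assumes f [measurable]: "f \<in> borel_measurable lebesgue"
  shows "s < decreasing_rearrangement f t \<longleftrightarrow> ennreal t < emeasure lebesgue {x. s < f x}"
proof
  assume "s < decreasing_rearrangement f t"
  then have "s \<notin> {s. emeasure lebesgue {x. s < f x} \<le> ennreal t}"
    unfolding decreasing_rearrangement_def by (metis Inf_lower leD)
  then show "ennreal t < emeasure lebesgue {x. s < f x}"
    by simp
next
  assume t: "ennreal t < emeasure lebesgue {x. s < f x}"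
  then have "s \<noteq> top"
    by auto
  then obtain s' where s': "s = ennreal s'" "0 \<le> s'"
    by (cases s) auto
  define A where "A k = {x. s + ennreal (1 / real (Suc k)) < f x}" for k
  have A: "A k \<in> sets lebesgue" for k
    unfolding A_def by simp
  have "A k \<subseteq> A (Suc k)" for k
  proof -
    have "s + ennreal (1 / real (Suc (Suc k))) \<le> s + ennreal (1 / real (Suc k))"
      by (intro add_left_mono ennreal_leI) (simp add: field_simps)
    then show ?thesis
      unfolding A_def using order.strict_trans1 by blast
  qed
  then have inc: "incseq A"
    by (rule incseq_SucI)
  have "{x. s < f x} = (\<Union>k. A k)"
  proof (intro equalityI subsetI)
    fix x assume "x \<in> {x. s < f x}"
    then have x: "s < f x" by simp
    show "x \<in> (\<Union>k. A k)"
    proof (cases "f x")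
      case (real b)
      with x s' have "0 < b - s'"
        by (simp add: ennreal_less_iff)
      then obtain k where "1 / real (Suc k) < b - s'"
        using nat_approx_posE by blast
      then have "s' + 1 / real (Suc k) < b"
        by linarith
      then have "x \<in> A k"
        using real s' unfolding A_def
        by (simp add: ennreal_less_iff flip: ennreal_plus)
      then show ?thesis by blast
    next
      case top
      then have "x \<in> A 0"
        using s' by (simp add: A_def)
      then show ?thesis by blast
    qed
  next
    fix x assume "x \<in> (\<Union>k. A k)"
    then obtain k where "s + ennreal (1 / real (Suc k)) < f x"
      unfolding A_def by auto
    moreover have "s \<le> s + ennreal (1 / real (Suc k))"
      by simp
    ultimately show "x \<in> {x. s < f x}"
      using order.strict_trans1 by blast
  qed
  moreover have "range A \<subseteq> sets lebesgue"
    using A by auto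
  ultimately have "ennreal t < (SUP k. emeasure lebesgue (A k))"
    using t inc by (simp only: SUP_emeasure_incseq)
  then obtain k where k: "ennreal t < emeasure lebesgue (A k)"
    by (auto simp: less_SUP_iff)
  have "s < s + ennreal (1 / real (Suc k))"
    using s' by (simp add: ennreal_less_iff flip: ennreal_plus)
  also have "\<dots> \<le> decreasing_rearrangement f t"
    unfolding decreasing_rearrangement_def
  proof (intro Inf_greatest, rule ccontr)
    fix r assume r: "r \<in> {s. emeasure lebesgue {x. s < f x} \<le> ennreal t}"
      and "\<not> s + ennreal (1 / real (Suc k)) \<le> r"
    then have "A k \<subseteq> {x. r < f x}"
      unfolding A_def by auto
    then have "emeasure lebesgue (A k) \<le> emeasure lebesgue {x. r < f x}"
      by (intro emeasure_mono) simp_all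
    then show False
      using r k by (auto dest: order.strict_trans2)
  qed
  finally show "s < decreasing_rearrangement f t" .
qed

lemma rearrangement_le_iff:
  assumes "f \<in> borel_measurable lebesgue"
  shows "decreasing_rearrangement f t \<le> s \<longleftrightarrow> emeasure lebesgue {x. s < f x} \<le> ennreal t"
  using less_rearrangement_iff[OF assms] by (meson not_le)

lemma emeasure_superlevel_rearrangement_le:
  "f \<in> borel_measurable lebesgue \<Longrightarrow>
    emeasure lebesgue {x. decreasing_rearrangement f t < f x} \<le> ennreal t"
  using rearrangement_le_iff by blast

lemma rearrangement_measurable [measurable]:
  "f \<in> borel_measurable lebesgue \<Longrightarrow> decreasing_rearrangement f \<in> borel_measurable borel"
  by (rule borel_measurableI_greater) (simp add: less_rearrangement_iff)

lemma rearrangement_antimono: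
  assumes "f \<in> borel_measurable lebesgue" "s \<le> t"
  shows "decreasing_rearrangement f t \<le> decreasing_rearrangement f s"
  using order_trans[OF emeasure_superlevel_rearrangement_le[of f s] ennreal_leI[of s t]] assms
  by (subst rearrangement_le_iff) simp_all

lemma rearrangement_mono:
  assumes [measurable]: "f \<in> borel_measurable lebesgue" "g \<in> borel_measurable lebesgue"
    and "\<And>x. f x \<le> g x"
  shows "decreasing_rearrangement f t \<le> decreasing_rearrangement g t"
proof (subst rearrangement_le_iff)
  have "emeasure lebesgue {x. decreasing_rearrangement g t < f x} \<le>
      emeasure lebesgue {x. decreasing_rearrangement g t < g x}"
    using assms(3) by (intro emeasure_mono) (auto elim: order.strict_trans2)
  also have "\<dots> \<le> ennreal t"
    by (rule emeasure_superlevel_rearrangement_le) measurable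
  finally show "emeasure lebesgue {x. decreasing_rearrangement g t < f x} \<le> ennreal t" .
qed measurable

text \<open>Beyond \<open>m\<close> the rearrangement vanishes because {f > 0} lies in
  \<open>E\<close>, whose measure is then at most \<open>t\<close>.\<close>

lemma rearrangement_bounded_support:
  assumes [measurable]: "f \<in> borel_measurable lebesgue" "E \<in> sets lebesgue"
    and "emeasure lebesgue E \<le> ennreal m" and f: "\<And>x. f x \<le> L * indicator E x" and "0 < t"
  shows "decreasing_rearrangement f t \<le> L * indicator {0<..<m} t"
proof (cases "t < m")
  case True
  have "{x. L < f x} = {}"
  proof -
    have "f x \<le> L" for x
      using f[of x] by (cases "x \<in> E") auto
    then show ?thesis
      by (auto simp: not_less)
  qed
  then show ?thesis
    using True \<open>0 < t\<close> by (simp add: rearrangement_le_iff)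
next
  case False
  have "{x. 0 < f x} \<subseteq> E"
  proof
    fix x assume "x \<in> {x. 0 < f x}"
    then show "x \<in> E"
      using f[of x] by (cases "x \<in> E") auto
  qed
  then have "emeasure lebesgue {x. 0 < f x} \<le> emeasure lebesgue E"
    by (intro emeasure_mono) auto
  also have "\<dots> \<le> ennreal t"
    using order_trans[OF assms(3) ennreal_leI[of m t]] False by simp
  finally have "decreasing_rearrangement f t \<le> 0"
    by (subst rearrangement_le_iff) auto
  then show ?thesis by simp
qed

text \<open>Strict superlevel sets of an increasing limit are increasing unions, so the distribution
  functions converge.\<close>

lemma rearrangement_SUP:
  fixes f :: "nat \<Rightarrow> 'a::euclidean_space \<Rightarrow> ennreal"
  assumes f [measurable]: "\<And>k. f k \<in> borel_measurable lebesgue" and "incseq f"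
  shows "decreasing_rearrangement (\<lambda>x. SUP k. f k x) t = (SUP k. decreasing_rearrangement (f k) t)"
proof (rule order_antisym)
  have "{x. s < (SUP k. f k x)} = (\<Union>k. {x. s < f k x})" for s
    by (auto simp: less_SUP_iff)
  moreover have "incseq (\<lambda>k. {x. s < f k x})" for s
    using \<open>incseq f\<close> by (auto simp: incseq_def le_fun_def elim: order.strict_trans2)
  moreover have "range (\<lambda>k. {x. s < f k x}) \<subseteq> sets lebesgue" for s
    by (auto simp: image_subset_iff)
  ultimately have *: "emeasure lebesgue {x. s < (SUP k. f k x)} = (SUP k. emeasure lebesgue {x. s < f k x})" for s
    by (simp only: SUP_emeasure_incseq)
  show "decreasing_rearrangement (\<lambda>x. SUP k. f k x) t \<le> (SUP k. decreasing_rearrangement (f k) t)"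
  proof (subst rearrangement_le_iff)
    show "emeasure lebesgue {x. (SUP k. decreasing_rearrangement (f k) t) < (SUP k. f k x)} \<le> ennreal t"
      unfolding * by (intro SUP_least) (simp add: rearrangement_le_iff[symmetric], rule SUP_upper, simp)
  qed measurable
  show "(SUP k. decreasing_rearrangement (f k) t) \<le> decreasing_rearrangement (\<lambda>x. SUP k. f k x) t"
    by (intro SUP_least rearrangement_mono) (auto intro: SUP_upper)
qed

text \<open>Stated for any sigma-finite measure because it serves on both sides of the next
  comparison: for a function on space and for its rearrangement on the half-line.\<close>

lemma nn_integral_layer_cake:
  assumes "sigma_finite_measure M" and f [measurable]: "f \<in> borel_measurable M"
  shows "(\<integral>\<^sup>+ x. f x \<partial>M) = (\<integral>\<^sup>+ s \<in> {0<..}. emeasure M {x \<in> space M. ennreal s < f x} \<partial>lborel)"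
proof -
  interpret sigma_finite_measure M by fact
  interpret pair_sigma_finite lborel M ..
  have "(\<integral>\<^sup>+ x. f x \<partial>M) = (\<integral>\<^sup>+ x. emeasure lborel {s. 0 < s \<and> ennreal s < f x} \<partial>M)"
    by (simp add: emeasure_Ioo_ennreal_bound)
  also have "\<dots> = (\<integral>\<^sup>+ x. (\<integral>\<^sup>+ s. indicator {s. 0 < s \<and> ennreal s < f x} s \<partial>lborel) \<partial>M)"
    by (intro nn_integral_cong) (simp add: nn_integral_indicator)
  also have "\<dots> = (\<integral>\<^sup>+ s. (\<integral>\<^sup>+ x. indicator {s. 0 < s \<and> ennreal s < f x} s \<partial>M) \<partial>lborel)"
    by (rule Fubini') (simp add: indicator_def)
  also have "\<dots> = (\<integral>\<^sup>+ s. (\<integral>\<^sup>+ x. indicator {0<..} s * indicator {x \<in> space M. ennreal s < f x} x \<partial>M) \<partial>lborel)"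
    by (intro nn_integral_cong) (auto split: split_indicator)
  also have "\<dots> = (\<integral>\<^sup>+ s \<in> {0<..}. emeasure M {x \<in> space M. ennreal s < f x} \<partial>lborel)"
    by (intro nn_integral_cong) (simp add: nn_integral_cmult mult.commute)
  finally show ?thesis .
qed

text \<open>The Hardy-Littlewood inequality for an indicator. At height \<open>s\<close> the layer
  has measure at most the minimum of \<open>T\<close> and the measure of {f > s}, which is exactly
  the length of the layer of the rearrangement cut off at \<open>T\<close>.\<close>

lemma nn_integral_le_rearrangement:
  assumes f [measurable]: "f \<in> borel_measurable lebesgue" and E [measurable]: "E \<in> sets lebesgue"
    and "emeasure lebesgue E \<le> ennreal T"
  shows "(\<integral>\<^sup>+ x \<in> E. f x \<partial>lebesgue) \<le> (\<integral>\<^sup>+ t \<in> {0<..<T}. decreasing_rearrangement f t \<partial>lborel)"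
proof -
  have "(\<integral>\<^sup>+ x \<in> E. f x \<partial>lebesgue) =
      (\<integral>\<^sup>+ s \<in> {0<..}. emeasure lebesgue {x. ennreal s < f x * indicator E x} \<partial>lborel)"
    using nn_integral_layer_cake[OF sigma_finite_lebesgue, of "\<lambda>x. f x * indicator E x"] by simp
  also have "\<dots> \<le> (\<integral>\<^sup>+ s \<in> {0<..}. emeasure lborel
      {t. ennreal s < decreasing_rearrangement f t * indicator {0<..<T} t} \<partial>lborel)"
  proof (intro nn_integral_mono mult_right_mono)
    fix s :: real
    have "{x. ennreal s < f x * indicator E x} \<subseteq> E"
      by (auto simp: indicator_def)
    then have 1: "emeasure lebesgue {x. ennreal s < f x * indicator E x} \<le> ennreal T"
      using assms(3) by (meson E emeasure_mono order_trans)
    have "emeasure lebesgue {x. ennreal s < f x * indicator E x} \<le> emeasure lebesgue {x. ennreal s < f x}"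
      by (intro emeasure_mono) (auto simp: indicator_def split: if_splits)
    then have "emeasure lebesgue {x. ennreal s < f x * indicator E x} \<le>
        min (ennreal T) (emeasure lebesgue {x. ennreal s < f x})"
      using 1 by simp
    also have "\<dots> = emeasure lborel
        {t. 0 < t \<and> ennreal t < min (ennreal T) (emeasure lebesgue {x. ennreal s < f x})}"
      by (rule emeasure_Ioo_ennreal_bound[symmetric])
    also have "{t. 0 < t \<and> ennreal t < min (ennreal T) (emeasure lebesgue {x. ennreal s < f x})} =
        {t. ennreal s < decreasing_rearrangement f t * indicator {0<..<T} t}"
      by (auto simp: less_rearrangement_iff[OF f, symmetric] ennreal_less_iff indicator_def split: if_splits)
    finally show "emeasure lebesgue {x. ennreal s < f x * indicator E x} \<le>
      emeasure lborel {t. ennreal s < decreasing_rearrangement f t * indicator {0<..<T} t}" .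
  qed simp
  also have "\<dots> = (\<integral>\<^sup>+ t \<in> {0<..<T}. decreasing_rearrangement f t \<partial>lborel)"
    using nn_integral_layer_cake[OF lborel.sigma_finite_measure_axioms,
        of "\<lambda>t. decreasing_rearrangement f t * indicator {0<..<T} t"] by simp
  finally show ?thesis .
qed

section \<open>Riesz potentials of densities\<close>

definition potential :: "real \<Rightarrow> ('a::euclidean_space \<Rightarrow> ennreal) \<Rightarrow> 'a \<Rightarrow> ennreal" where
  "potential \<alpha> f = riesz_potential \<alpha> (density lebesgue f)"

text \<open>The radial kernel c(n,\<alpha>) d^(\<alpha>-n), kept as the integral that Tonelli's
  theorem produces. For \<alpha> < n it is top at \<open>d = 0\<close>, where
  \<open>d powr (\<alpha> - real n)\<close> would be 0, so that monotonicity in \<open>d\<close> has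
  no exception.\<close>

definition riesz_kernel :: "nat \<Rightarrow> real \<Rightarrow> real \<Rightarrow> ennreal" where
  "riesz_kernel n \<alpha> d =
     ennreal ((real n - \<alpha>) * riesz_const n \<alpha>) * (\<integral>\<^sup>+ r \<in> {d<..}. ennreal (r powr (\<alpha> - real n - 1)) \<partial>lborel)"

lemma riesz_const_pos: "0 < \<alpha> \<Longrightarrow> \<alpha> < real n \<Longrightarrow> 0 < riesz_const n \<alpha>"
  by (auto simp: riesz_const_def intro!: divide_pos_pos mult_pos_pos Gamma_real_pos)

lemma riesz_kernel_antimono: "d \<le> d' \<Longrightarrow> riesz_kernel n \<alpha> d' \<le> riesz_kernel n \<alpha> d"
  unfolding riesz_kernel_def
  by (intro mult_left_mono nn_integral_mono) (auto split: split_indicator)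

lemma riesz_kernel_eq:
  assumes "0 < \<alpha>" "\<alpha> < real n" "0 < d"
  shows "riesz_kernel n \<alpha> d = ennreal (riesz_const n \<alpha> * d powr (\<alpha> - real n))"
  using nn_integral_powr_to_inf[of "real n - \<alpha>" d] riesz_const_pos[of \<alpha> n] assms
  by (simp add: riesz_kernel_def flip: ennreal_mult)

lemma riesz_kernel_measurable [measurable]: "riesz_kernel n \<alpha> \<in> borel_measurable borel"
proof -
  have "(\<lambda>d. \<integral>\<^sup>+ r \<in> {d<..}. ennreal (r powr (\<alpha> - real n - 1)) \<partial>lborel) \<in> borel_measurable borel"
    by (rule lborel.borel_measurable_nn_integral) (simp add: indicator_def)
  then show ?thesis
    unfolding riesz_kernel_def by (rule borel_measurable_times_ennreal[OF borel_measurable_const])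
qed

lemma borel_measurable_fst_snd_lebesgue [measurable]:
  "fst \<in> borel_measurable ((lebesgue :: 'a::euclidean_space measure) \<Otimes>\<^sub>M M)"
  "snd \<in> borel_measurable (M \<Otimes>\<^sub>M (lebesgue :: 'a::euclidean_space measure))"
proof -
  have *: "(\<lambda>x. x) \<in> borel_measurable (lebesgue :: 'a measure)"
    by (simp add: measurable_completion)
  show "fst \<in> borel_measurable ((lebesgue :: 'a measure) \<Otimes>\<^sub>M M)"
    using measurable_compose[OF measurable_fst[of lebesgue M] *] by simp
  show "snd \<in> borel_measurable (M \<Otimes>\<^sub>M (lebesgue :: 'a measure))"
    using measurable_compose[OF measurable_snd[of M lebesgue] *] by simp
qed

lemma potential_eq_balls:
  fixes f :: "'a::euclidean_space \<Rightarrow> ennreal"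
  assumes f [measurable]: "f \<in> borel_measurable lebesgue"
  shows "potential \<alpha> f x = ennreal ((real DIM('a) - \<alpha>) * riesz_const DIM('a) \<alpha>) *
    (\<integral>\<^sup>+ r \<in> {0<..}. (\<integral>\<^sup>+ y \<in> ball x r. f y \<partial>lebesgue) * ennreal (r powr (\<alpha> - real DIM('a) - 1)) \<partial>lborel)"
proof -
  have "e / ennreal (r powr (real DIM('a) - \<alpha>)) / ennreal r = e * ennreal (r powr (\<alpha> - real DIM('a) - 1))"
    if "0 < r" for e r
  proof -
    have "r powr (\<alpha> - real DIM('a) - 1) = inverse (r powr (real DIM('a) - \<alpha>)) * inverse r"
      using that by (simp add: powr_diff divide_simps)
    then show ?thesis
      using that by (simp add: divide_ennreal_def inverse_ennreal ennreal_mult mult.assoc)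
  qed
  then have "emeasure (density lebesgue f) (ball x r) / ennreal (r powr (real DIM('a) - \<alpha>)) / ennreal r * indicator {0<..} r
      = (\<integral>\<^sup>+ y \<in> ball x r. f y \<partial>lebesgue) * ennreal (r powr (\<alpha> - real DIM('a) - 1)) * indicator {0<..} r" for r
    by (auto simp: emeasure_density split: split_indicator)
  then show ?thesis
    unfolding potential_def riesz_potential_def by simp
qed

text \<open>Tonelli in (y, r): for fixed \<open>y\<close> the radii whose ball contains
  \<open>y\<close> are those above \<open>dist x y\<close>. Linearity, monotone convergence and
  symmetry of the potential are read off from this form.\<close>

lemma potential_eq_kernel:
  fixes f :: "'a::euclidean_space \<Rightarrow> ennreal"
  assumes f [measurable]: "f \<in> borel_measurable lebesgue"
  shows "potential \<alpha> f x = (\<integral>\<^sup>+ y. f y * riesz_kernel DIM('a) \<alpha> (dist x y) \<partial>lebesgue)"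
proof -
  interpret pair_sigma_finite "lebesgue :: 'a measure" "lborel :: real measure"
    by (rule pair_sigma_finite_lebesgue)
  let ?w = "\<lambda>r. ennreal (r powr (\<alpha> - real DIM('a) - 1))"
  let ?C = "ennreal ((real DIM('a) - \<alpha>) * riesz_const DIM('a) \<alpha>)"
  have [measurable]: "ball x r \<in> sets lebesgue" for r
    by simp
  have [measurable]: "(\<lambda>y. dist x y) \<in> borel_measurable lebesgue"
    by (intro measurable_completion) simp
  have [measurable]: "(\<lambda>p. dist x (fst p)) \<in> borel_measurable ((lebesgue :: 'a measure) \<Otimes>\<^sub>M (lborel :: real measure))"
    by measurable
  have "(\<integral>\<^sup>+ r \<in> {0<..}. (\<integral>\<^sup>+ y \<in> ball x r. f y \<partial>lebesgue) * ?w r \<partial>lborel) =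
      (\<integral>\<^sup>+ r. (\<integral>\<^sup>+ y. f y * (?w r * indicator {dist x y<..} r) \<partial>lebesgue) \<partial>lborel)"
  proof (intro nn_integral_cong)
    fix r :: real
    have "(\<integral>\<^sup>+ y \<in> ball x r. f y \<partial>lebesgue) * ?w r * indicator {0<..} r =
        (\<integral>\<^sup>+ y. (f y * indicator (ball x r) y) * (?w r * indicator {0<..} r) \<partial>lebesgue)"
      by (subst nn_integral_multc) (simp_all add: mult.assoc)
    also have "\<dots> = (\<integral>\<^sup>+ y. f y * (?w r * indicator {dist x y<..} r) \<partial>lebesgue)"
    proof (intro nn_integral_cong)
      fix y
      show "f y * indicator (ball x r) y * (?w r * indicator {0<..} r) = f y * (?w r * indicator {dist x y<..} r)"
        using zero_le_dist[of x y] by (cases "dist x y < r"; cases "0 < r") (auto simp del: zero_le_dist)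
    qed
    finally show "(\<integral>\<^sup>+ y \<in> ball x r. f y \<partial>lebesgue) * ?w r * indicator {0<..} r =
        (\<integral>\<^sup>+ y. f y * (?w r * indicator {dist x y<..} r) \<partial>lebesgue)" .
  qed
  also have "\<dots> = (\<integral>\<^sup>+ y. (\<integral>\<^sup>+ r. f y * (?w r * indicator {dist x y<..} r) \<partial>lborel) \<partial>lebesgue)"
    by (rule Fubini') (simp add: indicator_def case_prod_beta')
  also have "\<dots> = (\<integral>\<^sup>+ y. f y * (\<integral>\<^sup>+ r \<in> {dist x y<..}. ?w r \<partial>lborel) \<partial>lebesgue)"
    by (simp add: nn_integral_cmult)
  finally have "potential \<alpha> f x = ?C * (\<integral>\<^sup>+ y. f y * (\<integral>\<^sup>+ r \<in> {dist x y<..}. ?w r \<partial>lborel) \<partial>lebesgue)"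
    by (simp add: potential_eq_balls)
  also have "\<dots> = (\<integral>\<^sup>+ y. ?C * (f y * (\<integral>\<^sup>+ r \<in> {dist x y<..}. ?w r \<partial>lborel)) \<partial>lebesgue)"
  proof (rule nn_integral_cmult[symmetric])
    have "(\<lambda>d. \<integral>\<^sup>+ r \<in> {d<..}. ?w r \<partial>lborel) \<in> borel_measurable borel"
      by (rule lborel.borel_measurable_nn_integral) (simp add: indicator_def)
    then have "(\<lambda>y. \<integral>\<^sup>+ r \<in> {dist x y<..}. ?w r \<partial>lborel) \<in> borel_measurable lebesgue"
      by (rule measurable_compose[rotated]) measurable
    then show "(\<lambda>y. f y * (\<integral>\<^sup>+ r \<in> {dist x y<..}. ?w r \<partial>lborel)) \<in> borel_measurable lebesgue"
      by (rule borel_measurable_times_ennreal[OF f])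
  qed
  finally show ?thesis
    by (simp add: riesz_kernel_def ac_simps)
qed

lemma kernel_measurable_pair [measurable]:
  "(\<lambda>(x, y). riesz_kernel n \<alpha> (dist x y)) \<in>
    borel_measurable ((lebesgue :: 'a::euclidean_space measure) \<Otimes>\<^sub>M lebesgue)"
proof -
  have "(\<lambda>p::'a \<times> 'a. dist (fst p) (snd p)) \<in> borel_measurable (lebesgue \<Otimes>\<^sub>M lebesgue)"
    by measurable
  from measurable_compose[OF this riesz_kernel_measurable] show ?thesis
    by (simp add: case_prod_beta')
qed

lemma kernel_measurable_lebesgue [measurable]:
  "(\<lambda>y. riesz_kernel n \<alpha> (dist x y)) \<in> borel_measurable (lebesgue :: 'a::euclidean_space measure)"
  by (intro measurable_completion) simp

lemma potential_measurable [measurable]: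
  fixes f :: "'a::euclidean_space \<Rightarrow> ennreal"
  assumes f [measurable]: "f \<in> borel_measurable lebesgue"
  shows "potential \<alpha> f \<in> borel_measurable lebesgue"
proof -
  interpret sigma_finite_measure "lebesgue :: 'a measure"
    by (rule sigma_finite_lebesgue)
  have "(\<lambda>x. \<integral>\<^sup>+ y. f y * riesz_kernel DIM('a) \<alpha> (dist x y) \<partial>lebesgue) \<in> borel_measurable lebesgue"
    by (rule borel_measurable_nn_integral) (measurable)
  moreover have "potential \<alpha> f = (\<lambda>x. \<integral>\<^sup>+ y. f y * riesz_kernel DIM('a) \<alpha> (dist x y) \<partial>lebesgue)"
    using potential_eq_kernel[OF f] by (rule ext)
  ultimately show ?thesis
    by simp
qed

lemma potential_mono:
  assumes "f \<in> borel_measurable lebesgue" "g \<in> borel_measurable lebesgue" "\<And>y. f y \<le> g y"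
  shows "potential \<alpha> f x \<le> potential \<alpha> g x"
  using assms by (simp add: potential_eq_kernel nn_integral_mono mult_right_mono)

lemma potential_add:
  assumes [measurable]: "f \<in> borel_measurable lebesgue" "g \<in> borel_measurable lebesgue"
  shows "potential \<alpha> (\<lambda>y. f y + g y) x = potential \<alpha> f x + potential \<alpha> g x"
  by (simp add: potential_eq_kernel distrib_right nn_integral_add)

lemma potential_sum:
  assumes [measurable]: "\<And>i. i \<in> I \<Longrightarrow> f i \<in> borel_measurable lebesgue"
  shows "potential \<alpha> (\<lambda>y. \<Sum>i\<in>I. f i y) x = (\<Sum>i\<in>I. potential \<alpha> (f i) x)"
  by (simp add: potential_eq_kernel sum_distrib_right nn_integral_sum)

lemma potential_cmult:
  assumes [measurable]: "f \<in> borel_measurable lebesgue"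
  shows "potential \<alpha> (\<lambda>y. c * f y) x = c * potential \<alpha> f x"
  by (simp add: potential_eq_kernel mult.assoc nn_integral_cmult)

lemma potential_SUP:
  fixes f :: "nat \<Rightarrow> 'a::euclidean_space \<Rightarrow> ennreal"
  assumes [measurable]: "\<And>k. f k \<in> borel_measurable lebesgue" and "incseq f"
  shows "potential \<alpha> (\<lambda>y. SUP k. f k y) x = (SUP k. potential \<alpha> (f k) x)"
proof -
  have "incseq (\<lambda>k y. f k y * riesz_kernel DIM('a) \<alpha> (dist x y))"
    using \<open>incseq f\<close> by (auto simp: incseq_def le_fun_def intro: mult_right_mono)
  then have "(\<integral>\<^sup>+ y. (SUP k. f k y * riesz_kernel DIM('a) \<alpha> (dist x y)) \<partial>lebesgue) =
      (SUP k. (\<integral>\<^sup>+ y. f k y * riesz_kernel DIM('a) \<alpha> (dist x y) \<partial>lebesgue))"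
    by (rule nn_integral_monotone_convergence_SUP) measurable
  then show ?thesis
    by (simp add: potential_eq_kernel SUP_mult_right_ennreal)
qed

text \<open>The kernel depends on the distance only. In O'Neil's inequality this moves the potential
  onto an indicator function, where it is bounded.\<close>

lemma nn_integral_potential_symmetric:
  fixes f g :: "'a::euclidean_space \<Rightarrow> ennreal"
  assumes [measurable]: "f \<in> borel_measurable lebesgue" "g \<in> borel_measurable lebesgue"
  shows "(\<integral>\<^sup>+ x. potential \<alpha> f x * g x \<partial>lebesgue) = (\<integral>\<^sup>+ x. f x * potential \<alpha> g x \<partial>lebesgue)"
proof -
  interpret pair_sigma_finite "lebesgue :: 'a measure" "lebesgue :: 'a measure"
    by (rule pair_sigma_finite_lebesgue)
  let ?k = "\<lambda>x y::'a. riesz_kernel DIM('a) \<alpha> (dist x y)"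
  have "(\<integral>\<^sup>+ x. potential \<alpha> f x * g x \<partial>lebesgue) = (\<integral>\<^sup>+ x. (\<integral>\<^sup>+ y. f y * ?k x y * g x \<partial>lebesgue) \<partial>lebesgue)"
    by (simp add: potential_eq_kernel nn_integral_multc)
  also have "\<dots> = (\<integral>\<^sup>+ y. (\<integral>\<^sup>+ x. f y * ?k x y * g x \<partial>lebesgue) \<partial>lebesgue)"
    by (rule Fubini'[symmetric]) measurable
  also have "\<dots> = (\<integral>\<^sup>+ y. (\<integral>\<^sup>+ x. f y * (g x * ?k y x) \<partial>lebesgue) \<partial>lebesgue)"
    by (simp add: dist_commute ac_simps)
  also have "\<dots> = (\<integral>\<^sup>+ x. f x * potential \<alpha> g x \<partial>lebesgue)"
    by (simp add: potential_eq_kernel nn_integral_cmult)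
  finally show ?thesis .
qed

text \<open>Two points of the ball are at distance at most \<open>2 * R\<close>, and the kernel
  decreases in the distance. All positivity of solutions and supersolutions comes from this
  bound.\<close>

lemma potential_ge_on_ball:
  fixes f :: "'a::euclidean_space \<Rightarrow> ennreal"
  assumes f [measurable]: "f \<in> borel_measurable lebesgue" and x: "x \<in> ball 0 R"
  shows "riesz_kernel DIM('a) \<alpha> (2 * R) * (\<integral>\<^sup>+ y \<in> ball 0 R. f y \<partial>lebesgue) \<le> potential \<alpha> f x"
proof -
  have [measurable]: "ball 0 R \<in> sets (lebesgue :: 'a measure)"
    by simp
  have "riesz_kernel DIM('a) \<alpha> (2 * R) * (\<integral>\<^sup>+ y \<in> ball 0 R. f y \<partial>lebesgue) =
      (\<integral>\<^sup>+ y. riesz_kernel DIM('a) \<alpha> (2 * R) * (f y * indicator (ball 0 R) y) \<partial>lebesgue)"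
    by (simp add: nn_integral_cmult)
  also have "\<dots> \<le> (\<integral>\<^sup>+ y. f y * riesz_kernel DIM('a) \<alpha> (dist x y) \<partial>lebesgue)"
  proof (intro nn_integral_mono)
    fix y
    have "dist x y \<le> 2 * R" if "y \<in> ball 0 R"
      using x that dist_triangle[of x y 0] by (simp add: dist_commute)
    then have "riesz_kernel DIM('a) \<alpha> (2 * R) \<le> riesz_kernel DIM('a) \<alpha> (dist x y)" if "y \<in> ball 0 R"
      using that by (intro riesz_kernel_antimono)
    then show "riesz_kernel DIM('a) \<alpha> (2 * R) * (f y * indicator (ball 0 R) y) \<le>
        f y * riesz_kernel DIM('a) \<alpha> (dist x y)"
      by (cases "y \<in> ball 0 R") (auto simp: mult.commute intro: mult_left_mono)
  qed
  finally show ?thesis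
    by (simp add: potential_eq_kernel)
qed

text \<open>If V is the volume of the unit ball and t = V d^n that of a ball of radius d, then
  c(n,\<alpha>) d^(\<alpha>-n) is this constant times t^(\<alpha>/n-1).\<close>

definition sup_const :: "nat \<Rightarrow> real \<Rightarrow> real" where
  "sup_const n \<alpha> = riesz_const n \<alpha> * unit_ball_vol (real n) powr (1 - \<alpha> / real n)"

lemma sup_const_pos: "0 < \<alpha> \<Longrightarrow> \<alpha> < real n \<Longrightarrow> 0 < sup_const n \<alpha>"
  unfolding sup_const_def
  by (intro mult_pos_pos riesz_const_pos) (simp_all add: less_imp_neq[THEN not_sym])

text \<open>The Hardy-Littlewood inequality on each ball around \<open>x\<close>, of volume V r^n,
  followed by Tonelli in (t, r).\<close>

lemma potential_le_rearrangement:
  fixes h :: "'a::euclidean_space \<Rightarrow> ennreal"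
  assumes h [measurable]: "h \<in> borel_measurable lebesgue" and \<alpha>: "0 < \<alpha>" "\<alpha> < real DIM('a)"
  shows "potential \<alpha> h x \<le> ennreal (sup_const DIM('a) \<alpha>) *
    (\<integral>\<^sup>+ t \<in> {0<..}. decreasing_rearrangement h t * ennreal (t powr (\<alpha> / real DIM('a) - 1)) \<partial>lborel)"
proof -
  let ?n = "DIM('a)"
  let ?w = "\<lambda>r. ennreal (r powr (\<alpha> - real ?n - 1))"
  let ?C = "ennreal ((real ?n - \<alpha>) * riesz_const ?n \<alpha>)"
  define V where "V = unit_ball_vol (real ?n)"
  have V: "0 < V"
    unfolding V_def by simp
  have n: "0 < real ?n"
    by simp
  have inner: "?C * (\<integral>\<^sup>+ r \<in> {0<..}. indicator {0<..<V * r ^ ?n} t * ?w r \<partial>lborel) =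
      ennreal (sup_const ?n \<alpha>) * ennreal (t powr (\<alpha> / real ?n - 1))" if t: "0 < t" for t
  proof -
    \<comment> \<open>The radius of the ball of volume \<open>t\<close>.\<close>
    define c where "c = (t / V) powr (1 / real ?n)"
    have c: "0 < c"
      using t V by (simp add: c_def)
    have cn: "t < V * r ^ ?n \<longleftrightarrow> c < r" if "0 < r" for r
    proof -
      have "t < V * r ^ ?n \<longleftrightarrow> t / V < r powr real ?n"
        using V that by (simp add: powr_realpow field_simps)
      also have "t / V = c powr real ?n"
        using t V by (simp add: c_def powr_powr)
      also have "c powr real ?n < r powr real ?n \<longleftrightarrow> c < r"
        using that c powr_less_mono2[of "real ?n" c r] powr_less_cancel2[of "real ?n" c r] by auto
      finally show ?thesis .
    qed
    have "(\<integral>\<^sup>+ r \<in> {0<..}. indicator {0<..<V * r ^ ?n} t * ?w r \<partial>lborel) =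
        (\<integral>\<^sup>+ r \<in> {c<..}. ennreal (r powr (- (real ?n - \<alpha>) - 1)) \<partial>lborel)"
      using c t cn by (intro nn_integral_cong) (auto split: split_indicator)
    also have "\<dots> = ennreal (c powr (- (real ?n - \<alpha>)) / (real ?n - \<alpha>))"
      using c \<alpha> by (intro nn_integral_powr_to_inf) auto
    finally have "?C * (\<integral>\<^sup>+ r \<in> {0<..}. indicator {0<..<V * r ^ ?n} t * ?w r \<partial>lborel) =
        ennreal (riesz_const ?n \<alpha> * c powr (- (real ?n - \<alpha>)))"
      using \<alpha> riesz_const_pos[OF \<alpha>] by (simp flip: ennreal_mult)
    also have "c powr (- (real ?n - \<alpha>)) = (t / V) powr (\<alpha> / real ?n - 1)"
      using n by (simp add: c_def powr_powr diff_divide_distrib)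
    also have "\<dots> = V powr (1 - \<alpha> / real ?n) * t powr (\<alpha> / real ?n - 1)"
    proof -
      have "V powr (1 - \<alpha> / real ?n) = 1 / V powr (\<alpha> / real ?n - 1)"
        using powr_minus_divide[of V "\<alpha> / real ?n - 1"] by (simp only: minus_diff_eq)
      then show ?thesis
        using powr_divide[of t V "\<alpha> / real ?n - 1"] t V by simp
    qed
    finally show ?thesis
      using \<alpha> riesz_const_pos[OF \<alpha>] by (simp add: sup_const_def V_def mult.assoc flip: ennreal_mult)
  qed
  have "potential \<alpha> h x = ?C * (\<integral>\<^sup>+ r \<in> {0<..}. (\<integral>\<^sup>+ y \<in> ball x r. h y \<partial>lebesgue) * ?w r \<partial>lborel)"
    by (rule potential_eq_balls) fact
  also have "\<dots> \<le> ?C * (\<integral>\<^sup>+ r \<in> {0<..}. (\<integral>\<^sup>+ t \<in> {0<..<V * r ^ ?n}. decreasing_rearrangement h t \<partial>lborel) * ?w r \<partial>lborel)"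
  proof (intro mult_left_mono nn_integral_mono)
    fix r :: real
    have "(\<integral>\<^sup>+ y \<in> ball x r. h y \<partial>lebesgue) \<le> (\<integral>\<^sup>+ t \<in> {0<..<V * r ^ ?n}. decreasing_rearrangement h t \<partial>lborel)"
      if "0 < r"
      using that by (intro nn_integral_le_rearrangement) (auto simp: V_def emeasure_completion emeasure_ball)
    then show "(\<integral>\<^sup>+ y \<in> ball x r. h y \<partial>lebesgue) * ?w r * indicator {0<..} r \<le>
        (\<integral>\<^sup>+ t \<in> {0<..<V * r ^ ?n}. decreasing_rearrangement h t \<partial>lborel) * ?w r * indicator {0<..} r"
      by (cases "0 < r") (auto intro: mult_right_mono)
  qed simp
  also have "\<dots> = ?C * (\<integral>\<^sup>+ r. (\<integral>\<^sup>+ t. decreasing_rearrangement h t *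
      (indicator {0<..<V * r ^ ?n} t * ?w r * indicator {0<..} r) \<partial>lborel) \<partial>lborel)"
  proof -
    have "(\<integral>\<^sup>+ t \<in> {0<..<V * r ^ ?n}. decreasing_rearrangement h t \<partial>lborel) * (?w r * indicator {0<..} r) =
        (\<integral>\<^sup>+ t. decreasing_rearrangement h t * indicator {0<..<V * r ^ ?n} t * (?w r * indicator {0<..} r) \<partial>lborel)" for r
      by (rule nn_integral_multc[symmetric]) simp
    then show ?thesis
      by (simp only: mult.assoc)
  qed
  also have "\<dots> = ?C * (\<integral>\<^sup>+ t. (\<integral>\<^sup>+ r. decreasing_rearrangement h t *
      (indicator {0<..<V * r ^ ?n} t * ?w r * indicator {0<..} r) \<partial>lborel) \<partial>lborel)"
    by (subst lborel_pair.Fubini') (simp_all add: indicator_def)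
  also have "\<dots> = (\<integral>\<^sup>+ t. decreasing_rearrangement h t *
      (?C * (\<integral>\<^sup>+ r \<in> {0<..}. indicator {0<..<V * r ^ ?n} t * ?w r \<partial>lborel)) \<partial>lborel)"
  proof -
    have "(\<lambda>t. \<integral>\<^sup>+ r \<in> {0<..}. indicator {0<..<V * r ^ ?n} t * ?w r \<partial>lborel) \<in> borel_measurable borel"
      by (rule lborel.borel_measurable_nn_integral) (simp add: indicator_def)
    then have "?C * (\<integral>\<^sup>+ t. decreasing_rearrangement h t *
        (\<integral>\<^sup>+ r \<in> {0<..}. indicator {0<..<V * r ^ ?n} t * ?w r \<partial>lborel) \<partial>lborel) =
      (\<integral>\<^sup>+ t. ?C * (decreasing_rearrangement h t *
        (\<integral>\<^sup>+ r \<in> {0<..}. indicator {0<..<V * r ^ ?n} t * ?w r \<partial>lborel)) \<partial>lborel)"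
      by (intro nn_integral_cmult[symmetric]) simp
    moreover have "(\<integral>\<^sup>+ r. decreasing_rearrangement h t *
        (indicator {0<..<V * r ^ ?n} t * ?w r * indicator {0<..} r) \<partial>lborel) =
        decreasing_rearrangement h t *
        (\<integral>\<^sup>+ r \<in> {0<..}. indicator {0<..<V * r ^ ?n} t * ?w r \<partial>lborel)" for t
      by (rule nn_integral_cmult) (simp add: indicator_def)
    ultimately show ?thesis
      by (simp only: mult.left_commute[of ?C])
  qed
  also have "\<dots> = (\<integral>\<^sup>+ t. ennreal (sup_const ?n \<alpha>) *
      (decreasing_rearrangement h t * ennreal (t powr (\<alpha> / real ?n - 1)) * indicator {0<..} t) \<partial>lborel)"
  proof (intro nn_integral_cong)
    fix t :: real
    show "decreasing_rearrangement h t *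
      (?C * (\<integral>\<^sup>+ r \<in> {0<..}. indicator {0<..<V * r ^ ?n} t * ?w r \<partial>lborel)) =
      ennreal (sup_const ?n \<alpha>) *
      (decreasing_rearrangement h t * ennreal (t powr (\<alpha> / real ?n - 1)) * indicator {0<..} t)"
    proof (cases "0 < t")
      case True
      then show ?thesis
        by (simp only: inner) (simp add: ac_simps)
    qed simp
  qed
  finally show ?thesis
    by (simp add: nn_integral_cmult)
qed

text \<open>The factor (n/\<alpha>) m^(\<alpha>/n) is the integral of t^(\<alpha>/n-1) over (0, m).
  The bound does not depend on \<open>x\<close>; it serves the test functions of O'Neil's inequality
  and the upper barrier of the truncated problem.\<close>

lemma potential_bounded_support:
  fixes f :: "'a::euclidean_space \<Rightarrow> ennreal"
  assumes f [measurable]: "f \<in> borel_measurable lebesgue" and E [measurable]: "E \<in> sets lebesgue"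
    and m: "emeasure lebesgue E \<le> ennreal m" "0 \<le> m" and le: "\<And>x. f x \<le> L * indicator E x"
    and \<alpha>: "0 < \<alpha>" "\<alpha> < real DIM('a)"
  shows "potential \<alpha> f x \<le>
    L * ennreal (sup_const DIM('a) \<alpha> * (real DIM('a) / \<alpha>) * m powr (\<alpha> / real DIM('a)))"
proof -
  let ?a = "\<alpha> / real DIM('a)"
  have a: "0 < ?a"
    using \<alpha> by simp
  have "potential \<alpha> f x \<le> ennreal (sup_const DIM('a) \<alpha>) *
      (\<integral>\<^sup>+ t \<in> {0<..}. decreasing_rearrangement f t * ennreal (t powr (?a - 1)) \<partial>lborel)"
    by (rule potential_le_rearrangement) fact+
  also have "\<dots> \<le> ennreal (sup_const DIM('a) \<alpha>) *
      (\<integral>\<^sup>+ t. L * (ennreal (t powr (?a - 1)) * indicator {0<..<m} t) \<partial>lborel)"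
  proof (intro mult_left_mono nn_integral_mono)
    fix t :: real
    show "decreasing_rearrangement f t * ennreal (t powr (?a - 1)) * indicator {0<..} t
        \<le> L * (ennreal (t powr (?a - 1)) * indicator {0<..<m} t)"
    proof (cases "0 < t")
      case True
      from rearrangement_bounded_support[OF f E m(1) le True]
      have "decreasing_rearrangement f t * ennreal (t powr (?a - 1)) \<le>
          L * indicator {0<..<m} t * ennreal (t powr (?a - 1))"
        by (rule mult_right_mono) simp
      then show ?thesis
        using True by (simp add: ac_simps)
    qed simp
  qed simp
  also have "\<dots> = ennreal (sup_const DIM('a) \<alpha>) * (L * ennreal (m powr ?a / ?a))"
    using a m by (simp add: nn_integral_cmult nn_integral_powr_from_0)
  also have "\<dots> = L * ennreal (sup_const DIM('a) \<alpha> * (real DIM('a) / \<alpha>) * m powr ?a)"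
  proof -
    have "ennreal (sup_const DIM('a) \<alpha> * (real DIM('a) / \<alpha>) * m powr ?a) =
        ennreal (sup_const DIM('a) \<alpha>) * ennreal (m powr ?a / ?a)"
      using sup_const_pos[OF \<alpha>] \<alpha> by (subst ennreal_mult[symmetric]) auto
    then show ?thesis
      by (simp add: ac_simps)
  qed
  finally show ?thesis .
qed

section \<open>O'Neil's inequality and the Schur test\<close>

lemma nn_integral_split_pos:
  assumes [measurable]: "F \<in> borel_measurable borel" and "0 < (t::real)"
  shows "(\<integral>\<^sup>+ s \<in> {0<..}. F s \<partial>lborel) = (\<integral>\<^sup>+ s \<in> {0<..<t}. F s \<partial>lborel) + (\<integral>\<^sup>+ s \<in> {t<..}. F s \<partial>lborel)"
proof -
  have "(\<integral>\<^sup>+ s \<in> {0<..}. F s \<partial>lborel) = (\<integral>\<^sup>+ s. F s * indicator {0<..<t} s + F s * indicator {t<..} s \<partial>lborel)"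
    using AE_lborel_singleton[of t] \<open>0 < t\<close>
    by (intro nn_integral_cong_AE) (auto split: split_indicator elim!: eventually_mono)
  then show ?thesis
    by (simp add: nn_integral_add)
qed

text \<open>The superlevel sets tested below may have infinite measure, whereas the test divides by
  the measure. Sigma-finiteness yields a piece of finite measure that still exceeds
  \<open>t\<close>.\<close>

lemma finite_measure_subset_lebesgue:
  fixes A :: "'a::euclidean_space set"
  assumes "A \<in> sets lebesgue" "ennreal t < emeasure lebesgue A"
  obtains E m where "E \<in> sets lebesgue" "E \<subseteq> A" "emeasure lebesgue E = ennreal m" "t < m" "0 \<le> m"
proof -
  interpret sigma_finite_measure "lebesgue :: 'a measure"
    by (rule sigma_finite_lebesgue)
  obtain E where E: "E \<in> sets lebesgue" "E \<subseteq> A" "emeasure lebesgue E < \<infinity>" "ennreal t < emeasure lebesgue E"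
  proof (cases "emeasure lebesgue A = \<infinity>")
    case True
    then show ?thesis
      using that assms(1) by (metis approx_PInf_emeasure_with_finite)
  next
    case False
    then show ?thesis
      using that[of A] assms by (auto simp: less_top)
  qed
  then obtain m where "emeasure lebesgue E = ennreal m" "0 \<le> m"
    by (cases "emeasure lebesgue E") auto
  then show ?thesis
    using that[of E m] E by (cases "0 \<le> t") (auto simp: ennreal_less_iff)
qed

text \<open>O'Neil's inequality. Split \<open>f = (f - s) + min f s\<close> at height \<open>s = f\<^sup>*(t)\<close>; the potential of
  the second part is bounded, that of the first is tested against indicator functions.\<close>

lemma rearrangement_potential_le:
  fixes f :: "'a::euclidean_space \<Rightarrow> ennreal"
  assumes f [measurable]: "f \<in> borel_measurable lebesgue"
    and \<alpha>: "0 < \<alpha>" "\<alpha> < real DIM('a)" and t: "0 < t"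
  shows "decreasing_rearrangement (potential \<alpha> f) t \<le>
    ennreal (2 * (sup_const DIM('a) \<alpha> * (real DIM('a) / \<alpha>))) *
    (\<integral>\<^sup>+ s \<in> {0<..}. decreasing_rearrangement f s * ennreal (max t s powr (\<alpha> / real DIM('a) - 1)) \<partial>lborel)"
proof -
  define a where "a = \<alpha> / real DIM('a)"
  have a: "0 < a" "a < 1"
    using \<alpha> by (auto simp: a_def)
  define c where "c = sup_const DIM('a) \<alpha>"
  have c: "0 < c"
    unfolding c_def by (rule sup_const_pos) fact+
  have inv_a: "real DIM('a) / \<alpha> = 1 / a"
    by (simp add: a_def)
  define A where "A = (\<integral>\<^sup>+ s \<in> {0<..<t}. decreasing_rearrangement f s \<partial>lborel)"
  define B where "B = (\<integral>\<^sup>+ s \<in> {t<..}. decreasing_rearrangement f s * ennreal (s powr (a - 1)) \<partial>lborel)"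
  define J where "J = ennreal (t powr (a - 1)) * A + B"
  define s0 where "s0 = decreasing_rearrangement f t"
  have J_eq: "(\<integral>\<^sup>+ s \<in> {0<..}. decreasing_rearrangement f s * ennreal (max t s powr (a - 1)) \<partial>lborel) = J"
  proof -
    have "(\<integral>\<^sup>+ s \<in> {0<..<t}. decreasing_rearrangement f s * ennreal (max t s powr (a - 1)) \<partial>lborel) =
        (\<integral>\<^sup>+ s. ennreal (t powr (a - 1)) * (decreasing_rearrangement f s * indicator {0<..<t} s) \<partial>lborel)"
      by (intro nn_integral_cong) (auto split: split_indicator simp: mult.commute)
    then have 1: "(\<integral>\<^sup>+ s \<in> {0<..<t}. decreasing_rearrangement f s * ennreal (max t s powr (a - 1)) \<partial>lborel) =
        ennreal (t powr (a - 1)) * A"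
      by (simp add: nn_integral_cmult A_def)
    have 2: "(\<integral>\<^sup>+ s \<in> {t<..}. decreasing_rearrangement f s * ennreal (max t s powr (a - 1)) \<partial>lborel) = B"
      unfolding B_def by (intro nn_integral_cong) (auto split: split_indicator)
    show ?thesis
      using t by (subst nn_integral_split_pos[of _ t]) (simp_all add: 1 2 J_def)
  qed
  \<comment> \<open>The rearrangement is at least \<open>s0\<close> on (0, t). This disposes of the
    case \<open>s0 = top\<close>, and it later bounds the contribution of the truncated part near
    0.\<close>
  have sA: "s0 * ennreal t \<le> A"
  proof -
    have "s0 * ennreal t = (\<integral>\<^sup>+ s. s0 * indicator {0<..<t} s \<partial>lborel)"
      using t by (simp add: nn_integral_cmult_indicator)
    also have "\<dots> \<le> A"
      unfolding A_def s0_def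
      by (intro nn_integral_mono) (auto split: split_indicator intro: rearrangement_antimono)
    finally show ?thesis .
  qed
  have "decreasing_rearrangement (potential \<alpha> f) t \<le> ennreal (2 * (c * (1 / a))) * J"
  proof (cases "s0 = top")
    case True
    then have "A = top"
      using sA t by (simp add: ennreal_top_mult top_unique)
    then have "J = top"
      using t by (simp add: J_def ennreal_mult_top)
    then show ?thesis
      using a c by (simp add: ennreal_mult_top)
  next
    case False
    define g where "g x = f x - s0" for x
    define h where "h x = min (f x) s0" for x
    have [measurable]: "g \<in> borel_measurable lebesgue" "h \<in> borel_measurable lebesgue"
      unfolding g_def h_def by measurable
    have zero: "f x - s0 = 0" if "f x \<le> s0" for x
      using that False by (intro diff_eq_0_ennreal) (auto simp: top.not_eq_extremum intro: le_less_trans)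
    have fgh: "f x = g x + h x" for x
      unfolding g_def h_def
      by (cases "f x \<le> s0") (auto simp: min_def diff_add_cancel_ennreal zero)
    have g_int: "(\<integral>\<^sup>+ x. g x \<partial>lebesgue) \<le> A"
    proof -
      have "g x \<le> f x * indicator {x. s0 < f x} x" for x
        unfolding g_def by (auto split: split_indicator simp: diff_le_self_ennreal zero not_less)
      then have "(\<integral>\<^sup>+ x. g x \<partial>lebesgue) \<le> (\<integral>\<^sup>+ x \<in> {x. s0 < f x}. f x \<partial>lebesgue)"
        by (intro nn_integral_mono) simp
      also have "\<dots> \<le> A"
        unfolding A_def s0_def
        by (intro nn_integral_le_rearrangement emeasure_superlevel_rearrangement_le) simp_all
      finally show ?thesis .
    qed
    define b where "b = ennreal (c * (1 / a)) * J"
    have ca: "ennreal (c * (1 / a)) = ennreal c * ennreal (1 / a)"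
      using a c by (intro ennreal_mult) auto
    \<comment> \<open>The rearrangement of \<open>h\<close> is at most \<open>s0\<close> on (0, t)
      and at most that of \<open>f\<close> beyond. The first piece contributes s0 t^a / a, which
      \<open>sA\<close> turns into (1/a) t^(a-1) A.\<close>
    have h_bound: "potential \<alpha> h x \<le> b" for x
    proof -
      have le: "decreasing_rearrangement h s * ennreal (s powr (a - 1)) * indicator {0<..<t} s \<le>
          s0 * (ennreal (s powr (a - 1)) * indicator {0<..<t} s)" for s
      proof -
        have "decreasing_rearrangement h s \<le> s0"
          by (subst rearrangement_le_iff) (simp_all add: h_def)
        then show ?thesis
          by (simp add: mult.assoc mult_right_mono)
      qed
      have "potential \<alpha> h x \<le> ennreal c *
          (\<integral>\<^sup>+ s \<in> {0<..}. decreasing_rearrangement h s * ennreal (s powr (a - 1)) \<partial>lborel)"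
        unfolding c_def a_def using \<alpha> by (intro potential_le_rearrangement) simp_all
      also have "(\<integral>\<^sup>+ s \<in> {0<..}. decreasing_rearrangement h s * ennreal (s powr (a - 1)) \<partial>lborel) =
          (\<integral>\<^sup>+ s \<in> {0<..<t}. decreasing_rearrangement h s * ennreal (s powr (a - 1)) \<partial>lborel) +
          (\<integral>\<^sup>+ s \<in> {t<..}. decreasing_rearrangement h s * ennreal (s powr (a - 1)) \<partial>lborel)"
        using t by (intro nn_integral_split_pos) simp_all
      also have "\<dots> \<le> (\<integral>\<^sup>+ s. s0 * (ennreal (s powr (a - 1)) * indicator {0<..<t} s) \<partial>lborel) + B"
      proof (intro add_mono)
        show "(\<integral>\<^sup>+ s \<in> {0<..<t}. decreasing_rearrangement h s * ennreal (s powr (a - 1)) \<partial>lborel) \<le>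
            (\<integral>\<^sup>+ s. s0 * (ennreal (s powr (a - 1)) * indicator {0<..<t} s) \<partial>lborel)"
          by (intro nn_integral_mono le)
        show "(\<integral>\<^sup>+ s \<in> {t<..}. decreasing_rearrangement h s * ennreal (s powr (a - 1)) \<partial>lborel) \<le> B"
          unfolding B_def by (intro nn_integral_mono mult_right_mono rearrangement_mono) (simp_all add: h_def)
      qed
      also have "(\<integral>\<^sup>+ s. s0 * (ennreal (s powr (a - 1)) * indicator {0<..<t} s) \<partial>lborel) =
          s0 * ennreal (t powr a / a)"
        using a t by (simp add: nn_integral_cmult nn_integral_powr_from_0)
      also have "s0 * ennreal (t powr a / a) = ennreal (1 / a) * (ennreal (t powr (a - 1)) * (s0 * ennreal t))"
      proof -
        have "ennreal (t powr a / a) = ennreal (1 / a) * (ennreal (t powr (a - 1)) * ennreal t)"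
          using a t by (simp add: powr_diff flip: ennreal_mult)
        then show ?thesis
          by (simp only: ac_simps)
      qed
      also have "\<dots> + B \<le> ennreal (1 / a) * (ennreal (t powr (a - 1)) * A) + ennreal (1 / a) * B"
      proof (intro add_mono mult_left_mono sA)
        show "B \<le> ennreal (1 / a) * B"
          using a mult_right_mono[of 1 "ennreal (1 / a)" B] by simp
      qed simp_all
      finally show ?thesis
        by (simp add: b_def J_def ca distrib_left mult.assoc mult_left_mono del: mult_1_right times_divide_eq_right)
    qed
    show ?thesis
    \<comment> \<open>For \<open>s\<close> below the left side, the superlevel set of the potential
      at height \<open>s\<close> contains a set \<open>E\<close> of finite measure
      \<open>m > t\<close>, so m s is at most the integral of the potential over \<open>E\<close>.
      By symmetry the part from \<open>g\<close> is tested against the potential of the indicator of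
      \<open>E\<close>, which is of order m^a; dividing by \<open>m\<close> leaves m^(a-1).\<close>
    proof (rule dense_le)
      fix s assume "s < decreasing_rearrangement (potential \<alpha> f) t"
      then have "ennreal t < emeasure lebesgue {x. s < potential \<alpha> f x}"
        by (simp add: less_rearrangement_iff)
      then obtain E m where E [measurable]: "E \<in> sets lebesgue" and E': "E \<subseteq> {x. s < potential \<alpha> f x}"
          and m: "emeasure lebesgue E = ennreal m" "t < m" "0 \<le> m"
        by (rule finite_measure_subset_lebesgue[rotated]) simp_all
      have ind: "potential \<alpha> (indicator E) x \<le> ennreal (c * (1 / a) * m powr a)" for x :: 'a
        using potential_bounded_support[OF _ E, of "indicator E" m 1 \<alpha> x] m \<alpha>
        by (simp add: c_def a_def)
      have "ennreal m * s = (\<integral>\<^sup>+ x. s * indicator E x \<partial>lebesgue)"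
        by (simp add: nn_integral_cmult_indicator m mult.commute)
      also have "\<dots> \<le> (\<integral>\<^sup>+ x. potential \<alpha> f x * indicator E x \<partial>lebesgue)"
        using E' by (intro nn_integral_mono) (auto split: split_indicator)
      also have "\<dots> = (\<integral>\<^sup>+ x. potential \<alpha> g x * indicator E x + potential \<alpha> h x * indicator E x \<partial>lebesgue)"
        using potential_add[of g h \<alpha>] by (simp add: fgh[abs_def] distrib_right)
      also have "\<dots> = (\<integral>\<^sup>+ x. g x * potential \<alpha> (indicator E) x \<partial>lebesgue) +
          (\<integral>\<^sup>+ x. potential \<alpha> h x * indicator E x \<partial>lebesgue)"
        by (simp add: nn_integral_add nn_integral_potential_symmetric)
      also have "\<dots> \<le> (\<integral>\<^sup>+ x. g x * ennreal (c * (1 / a) * m powr a) \<partial>lebesgue) +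
          (\<integral>\<^sup>+ x. b * indicator E x \<partial>lebesgue)"
        by (intro add_mono nn_integral_mono mult_left_mono mult_right_mono ind h_bound) simp_all
      also have "\<dots> \<le> A * ennreal (c * (1 / a) * m powr a) + b * ennreal m"
        using g_int by (simp add: nn_integral_multc nn_integral_cmult_indicator m add_right_mono mult_right_mono)
      also have "\<dots> = ennreal m * (A * ennreal (c * (1 / a) * m powr (a - 1)) + b)"
      proof -
        have "c * (1 / a) * m powr a = m * (c * (1 / a) * m powr (a - 1))"
          using m t by (simp add: powr_diff)
        then have "ennreal (c * (1 / a) * m powr a) = ennreal m * ennreal (c * (1 / a) * m powr (a - 1))"
          using m a c by (simp only:) (rule ennreal_mult, auto)
        then show ?thesis
          by (simp add: distrib_left ac_simps)
      qed
      finally have "s \<le> A * ennreal (c * (1 / a) * m powr (a - 1)) + b"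
        using m t by (subst (asm) ennreal_mult_le_mult_iff) (auto simp: ennreal_eq_0_iff)
      \<comment> \<open>Since \<open>a < 1\<close>, the power \<open>m powr (a - 1)\<close>
        decreases in \<open>m\<close>, and \<open>m > t\<close>.\<close>
      also have "\<dots> \<le> A * ennreal (c * (1 / a) * t powr (a - 1)) + b"
        using m t a c by (intro add_right_mono mult_left_mono ennreal_leI) (auto intro: powr_mono2')
      also have "A * ennreal (c * (1 / a) * t powr (a - 1)) \<le> b"
      proof -
        have "ennreal (c * (1 / a) * t powr (a - 1)) = ennreal (c * (1 / a)) * ennreal (t powr (a - 1))"
          using a c by (intro ennreal_mult) auto
        then show ?thesis
          unfolding b_def J_def distrib_left by (simp only: ac_simps) simp
      qed
      finally have "s \<le> b + b"
        by simp
      show "s \<le> ennreal (2 * (c * (1 / a))) * J"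
      proof -
        have "ennreal (2 * (c * (1 / a))) = 2 * ennreal (c * (1 / a))"
          using a c by (subst ennreal_mult) auto
        with \<open>s \<le> b + b\<close> show ?thesis
          by (simp only: b_def mult_2 distrib_right)
      qed
    qed
  qed
  then show ?thesis
    using J_eq by (simp add: inv_a c_def flip: a_def)
qed

text \<open>A crude substitute for Hoelder's inequality wherever only finiteness of an integral is
  at stake.\<close>

lemma le_1_plus_enn_powr:
  assumes \<rho>: "1 \<le> \<rho>"
  shows "x \<le> 1 + enn_powr x \<rho>"
proof (cases "x \<le> 1")
  case True
  then show ?thesis by (rule order_trans) simp
next
  case False
  then show ?thesis
  proof (cases x)
    case (real r)
    with False have "r powr 1 \<le> r powr \<rho>"
      using \<rho> by (intro powr_mono) (auto simp flip: ennreal_1)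
    then have "x \<le> enn_powr x \<rho>"
      using real by (simp add: enn_powr_ennreal)
    then show ?thesis
      by (rule order_trans) simp
  qed simp
qed

text \<open>Jensen's inequality for a weight of total mass at most \<open>W\<close>, by integrating
  the tangent to x^\<rho> at A = I / W, where I is the integral on the left. The final subtraction
  needs finite quantities; I is finite as soon as the right side is.\<close>

lemma nn_integral_Jensen_powr:
  assumes [measurable]: "\<kappa> \<in> borel_measurable N" "g \<in> borel_measurable N"
    and \<kappa>: "(\<integral>\<^sup>+ y. \<kappa> y \<partial>N) \<le> ennreal W" and W: "0 < W" and \<rho>: "1 < \<rho>"
  shows "enn_powr (\<integral>\<^sup>+ y. \<kappa> y * g y \<partial>N) \<rho> \<le>
    ennreal (W powr (\<rho> - 1)) * (\<integral>\<^sup>+ y. \<kappa> y * enn_powr (g y) \<rho> \<partial>N)"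
proof (cases "\<integral>\<^sup>+ y. \<kappa> y * enn_powr (g y) \<rho> \<partial>N")
  case top
  then show ?thesis
    using W by (simp add: ennreal_mult_top)
next
  case (real R)
  have "(\<integral>\<^sup>+ y. \<kappa> y * g y \<partial>N) \<le> (\<integral>\<^sup>+ y. \<kappa> y + \<kappa> y * enn_powr (g y) \<rho> \<partial>N)"
    using le_1_plus_enn_powr[of \<rho>] \<rho>
    by (intro nn_integral_mono) (metis distrib_left less_imp_le mult.right_neutral mult_left_mono zero_le)
  also have "\<dots> \<le> ennreal W + ennreal R"
    using \<kappa> real by (simp add: nn_integral_add add_right_mono)
  finally have "(\<integral>\<^sup>+ y. \<kappa> y * g y \<partial>N) < top"
    by (rule le_less_trans) simp
  then obtain I where I: "(\<integral>\<^sup>+ y. \<kappa> y * g y \<partial>N) = ennreal I" "0 \<le> I"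
    by (cases "\<integral>\<^sup>+ y. \<kappa> y * g y \<partial>N") auto
  define A where "A = I / W"
  have A: "0 \<le> A" "I = A * W"
    using I W by (auto simp: A_def)
  \<comment> \<open>The tangent line of x^\<rho> at \<open>A\<close>, obtained from Young's
    inequality with exponents \<rho> and \<rho>/(\<rho>-1).\<close>
  have young: "ennreal (\<rho> * A powr (\<rho> - 1)) * x \<le> enn_powr x \<rho> + ennreal ((\<rho> - 1) * A powr \<rho>)" for x
  proof (cases x)
    case (real r)
    have "r * A powr (\<rho> - 1) \<le> r powr \<rho> / \<rho> + (A powr (\<rho> - 1)) powr (\<rho> / (\<rho> - 1)) / (\<rho> / (\<rho> - 1))"
      using real \<rho> by (intro Youngs_inequality) (auto simp: field_simps)
    also have "(A powr (\<rho> - 1)) powr (\<rho> / (\<rho> - 1)) = A powr \<rho>"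
      using \<rho> by (simp add: powr_powr)
    finally have "\<rho> * A powr (\<rho> - 1) * r \<le> r powr \<rho> + (\<rho> - 1) * A powr \<rho>"
      using \<rho> by (simp add: field_simps)
    then show ?thesis
      using real \<rho> by (simp add: enn_powr_ennreal ennreal_leI flip: ennreal_mult ennreal_plus)
  qed simp
  have "ennreal (\<rho> * A powr (\<rho> - 1)) * ennreal I = (\<integral>\<^sup>+ y. \<kappa> y * (ennreal (\<rho> * A powr (\<rho> - 1)) * g y) \<partial>N)"
    by (simp add: I(1)[symmetric] nn_integral_cmult[symmetric] ac_simps)
  also have "\<dots> \<le> (\<integral>\<^sup>+ y. \<kappa> y * (enn_powr (g y) \<rho> + ennreal ((\<rho> - 1) * A powr \<rho>)) \<partial>N)"
    by (intro nn_integral_mono mult_left_mono young) simp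
  also have "\<dots> = ennreal R + (\<integral>\<^sup>+ y. \<kappa> y \<partial>N) * ennreal ((\<rho> - 1) * A powr \<rho>)"
    by (simp add: distrib_left nn_integral_add nn_integral_multc real)
  also have "\<dots> \<le> ennreal R + ennreal W * ennreal ((\<rho> - 1) * A powr \<rho>)"
    by (intro add_left_mono mult_right_mono \<kappa>) simp
  finally have le: "\<rho> * A powr (\<rho> - 1) * I \<le> R + W * ((\<rho> - 1) * A powr \<rho>)"
    using I W \<rho> real by (simp flip: ennreal_mult ennreal_plus add: ennreal_le_iff)
  have "A powr (\<rho> - 1) * A = A powr \<rho>"
    using A by (cases "A = 0") (auto simp: powr_diff)
  then have "\<rho> * A powr (\<rho> - 1) * I = \<rho> * (A powr \<rho> * W)"
    by (simp add: A(2))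
  with le have "\<rho> * (A powr \<rho> * W) \<le> R + W * ((\<rho> - 1) * A powr \<rho>)"
    by (simp only:)
  then have AW: "A powr \<rho> * W \<le> R"
    by (simp add: algebra_simps)
  have "I powr \<rho> = W powr (\<rho> - 1) * (A powr \<rho> * W)"
    using A W by (simp add: powr_mult powr_diff)
  also have "\<dots> \<le> W powr (\<rho> - 1) * R"
    using AW by (intro mult_left_mono) auto
  finally show ?thesis
    using I real by (simp add: enn_powr_ennreal ennreal_leI flip: ennreal_mult)
qed

text \<open>Jensen's inequality against each row costs W^(\<rho>-1); after Tonelli the column bound
  costs one more factor \<open>W\<close>.\<close>

lemma Schur_test_powr:
  fixes k :: "real \<Rightarrow> real \<Rightarrow> ennreal"
  assumes k [measurable]: "case_prod k \<in> borel_measurable (borel \<Otimes>\<^sub>M borel)"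
    and [measurable]: "g \<in> borel_measurable borel" "w \<in> borel_measurable borel" "v \<in> borel_measurable borel"
    and row: "\<And>x. 0 < x \<Longrightarrow> (\<integral>\<^sup>+ y. k x y \<partial>lborel) \<le> ennreal W"
    and col: "\<And>y. (\<integral>\<^sup>+ x \<in> {0<..}. w x * k x y \<partial>lborel) \<le> ennreal W * v y"
    and W: "0 < W" and \<rho>: "1 < \<rho>"
  shows "(\<integral>\<^sup>+ x \<in> {0<..}. w x * enn_powr (\<integral>\<^sup>+ y. k x y * g y \<partial>lborel) \<rho> \<partial>lborel) \<le>
    ennreal (W powr \<rho>) * (\<integral>\<^sup>+ y. v y * enn_powr (g y) \<rho> \<partial>lborel)"
proof -
  have "(\<integral>\<^sup>+ x \<in> {0<..}. w x * enn_powr (\<integral>\<^sup>+ y. k x y * g y \<partial>lborel) \<rho> \<partial>lborel) \<le>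
      (\<integral>\<^sup>+ x. (\<integral>\<^sup>+ y. ennreal (W powr (\<rho> - 1)) * (enn_powr (g y) \<rho> * (w x * k x y * indicator {0<..} x)) \<partial>lborel) \<partial>lborel)"
  proof (intro nn_integral_mono)
    fix x :: real
    show "w x * enn_powr (\<integral>\<^sup>+ y. k x y * g y \<partial>lborel) \<rho> * indicator {0<..} x \<le>
        (\<integral>\<^sup>+ y. ennreal (W powr (\<rho> - 1)) * (enn_powr (g y) \<rho> * (w x * k x y * indicator {0<..} x)) \<partial>lborel)"
    proof (cases "0 < x")
      case True
      have "w x * enn_powr (\<integral>\<^sup>+ y. k x y * g y \<partial>lborel) \<rho> \<le>
          w x * (ennreal (W powr (\<rho> - 1)) * (\<integral>\<^sup>+ y. k x y * enn_powr (g y) \<rho> \<partial>lborel))"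
        by (intro mult_left_mono nn_integral_Jensen_powr row True W \<rho>) simp_all
      also have "\<dots> = (\<integral>\<^sup>+ y. ennreal (W powr (\<rho> - 1)) * (enn_powr (g y) \<rho> * (w x * k x y)) \<partial>lborel)"
        by (simp add: nn_integral_cmult[symmetric] ac_simps)
      finally show ?thesis
        using True by simp
    qed simp
  qed
  also have "\<dots> = (\<integral>\<^sup>+ y. (\<integral>\<^sup>+ x. ennreal (W powr (\<rho> - 1)) * (enn_powr (g y) \<rho> * (w x * k x y * indicator {0<..} x)) \<partial>lborel) \<partial>lborel)"
    by (rule lborel_pair.Fubini') measurable
  also have "\<dots> = (\<integral>\<^sup>+ y. ennreal (W powr (\<rho> - 1)) * (enn_powr (g y) \<rho> * (\<integral>\<^sup>+ x \<in> {0<..}. w x * k x y \<partial>lborel)) \<partial>lborel)"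
    by (simp add: nn_integral_cmult)
  also have "\<dots> \<le> (\<integral>\<^sup>+ y. ennreal (W powr (\<rho> - 1)) * (enn_powr (g y) \<rho> * (ennreal W * v y)) \<partial>lborel)"
    by (intro nn_integral_mono mult_left_mono col) simp_all
  also have "\<dots> = (\<integral>\<^sup>+ y. ennreal (W powr \<rho>) * (v y * enn_powr (g y) \<rho>) \<partial>lborel)"
  proof -
    have "W powr \<rho> = W powr (\<rho> - 1) * W"
      using W by (simp add: powr_diff)
    then have "ennreal (W powr \<rho>) = ennreal (W powr (\<rho> - 1)) * ennreal W"
      using W by (simp add: ennreal_mult)
    then show ?thesis
      by (simp add: ac_simps)
  qed
  finally show ?thesis
    by (simp add: nn_integral_cmult)
qed

section \<open>Lorentz integrals\<close>

text \<open>With \<open>p = 1/r\<close>, this is the \<open>\<rho>\<close>-th power of the norm of \<open>L\<^bsup>r,\<rho>\<^esup>\<close>.\<close>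

definition lorentz_integral :: "real \<Rightarrow> real \<Rightarrow> ('a::euclidean_space \<Rightarrow> ennreal) \<Rightarrow> ennreal" where
  "lorentz_integral p \<rho> f =
     (\<integral>\<^sup>+ t \<in> {0<..}. ennreal (1 / t) * enn_powr (ennreal (t powr p) * decreasing_rearrangement f t) \<rho> \<partial>lborel)"

lemma lorentz_space_iff:
  "f \<in> lorentz_space r \<rho> \<longleftrightarrow> f \<in> borel_measurable lebesgue \<and> lorentz_integral (1 / r) \<rho> f < top"
proof -
  have *: "x / ennreal t * indicator {0<..} t = ennreal (1 / t) * x * indicator {0<..} t" for x t
    by (cases "0 < t") (auto simp: divide_ennreal_def inverse_ennreal inverse_eq_divide mult.commute)
  show ?thesis
    unfolding lorentz_space_def lorentz_norm_def lorentz_integral_def by (simp add: *)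
qed

lemma lorentz_integral_mono:
  assumes "f \<in> borel_measurable lebesgue" "g \<in> borel_measurable lebesgue" "\<And>x. f x \<le> g x" "0 \<le> \<rho>"
  shows "lorentz_integral p \<rho> f \<le> lorentz_integral p \<rho> g"
  unfolding lorentz_integral_def using assms
  by (intro nn_integral_mono mult_right_mono mult_left_mono enn_powr_mono rearrangement_mono) auto

text \<open>Carries a bound that is uniform along an increasing sequence over to its limit.\<close>

lemma lorentz_integral_SUP:
  fixes f :: "nat \<Rightarrow> 'a::euclidean_space \<Rightarrow> ennreal"
  assumes [measurable]: "\<And>k. f k \<in> borel_measurable lebesgue" and f: "incseq f" and \<rho>: "0 < \<rho>"
  shows "lorentz_integral p \<rho> (\<lambda>x. SUP k. f k x) = (SUP k. lorentz_integral p \<rho> (f k))"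
proof -
  have "decreasing_rearrangement (f k) t \<le> decreasing_rearrangement (f l) t" if "k \<le> l" for k l t
    using f that by (intro rearrangement_mono) (auto simp: incseq_def le_fun_def)
  then have inc: "incseq (\<lambda>k t. ennreal (1 / t) * enn_powr (ennreal (t powr p) *
      decreasing_rearrangement (f k) t) \<rho> * indicator {0<..} t)"
    using \<rho> by (auto simp: incseq_def le_fun_def intro!: mult_right_mono mult_left_mono enn_powr_mono)
  have "lorentz_integral p \<rho> (\<lambda>x. SUP k. f k x) =
      (\<integral>\<^sup>+ t. (SUP k. ennreal (1 / t) * enn_powr (ennreal (t powr p) * decreasing_rearrangement (f k) t) \<rho> *
        indicator {0<..} t) \<partial>lborel)"
    unfolding lorentz_integral_def
    using \<rho> f by (simp add: rearrangement_SUP SUP_mult_left_ennreal enn_powr_SUP SUP_mult_right_ennreal)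
  also have "\<dots> = (SUP k. lorentz_integral p \<rho> (f k))"
    unfolding lorentz_integral_def by (rule nn_integral_monotone_convergence_SUP[OF inc]) measurable
  finally show ?thesis .
qed

text \<open>The integrand is at most a multiple of t^(p \<rho> - 1) on (0, m) and vanishes beyond.
  Applied to the source of a truncated problem, it provides the finiteness without which nothing
  could be absorbed.\<close>

lemma lorentz_integral_bounded_support:
  fixes f :: "'a::euclidean_space \<Rightarrow> ennreal"
  assumes f [measurable]: "f \<in> borel_measurable lebesgue" and E: "E \<in> sets lebesgue"
    and m: "emeasure lebesgue E \<le> ennreal m" "0 \<le> m" and le: "\<And>x. f x \<le> L * indicator E x" and L: "L < top"
    and p: "0 < p" "0 < \<rho>"
  shows "lorentz_integral p \<rho> f < top"
proof -
  have "lorentz_integral p \<rho> f \<le> (\<integral>\<^sup>+ t. enn_powr L \<rho> * (ennreal (t powr (p * \<rho> - 1)) * indicator {0<..<m} t) \<partial>lborel)"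
    unfolding lorentz_integral_def
  proof (intro nn_integral_mono)
    fix t :: real
    show "ennreal (1 / t) * enn_powr (ennreal (t powr p) * decreasing_rearrangement f t) \<rho> * indicator {0<..} t
        \<le> enn_powr L \<rho> * (ennreal (t powr (p * \<rho> - 1)) * indicator {0<..<m} t)"
    proof (cases "0 < t")
      case True
      have "ennreal (1 / t) * enn_powr (ennreal (t powr p) * decreasing_rearrangement f t) \<rho> \<le>
          ennreal (1 / t) * enn_powr (ennreal (t powr p) * (L * indicator {0<..<m} t)) \<rho>"
        using p rearrangement_bounded_support[OF f E m(1) le True]
        by (intro mult_left_mono enn_powr_mono) auto
      also have "\<dots> = enn_powr L \<rho> * ((ennreal (1 / t) * ennreal (t powr (p * \<rho>))) * indicator {0<..<m} t)"
        by (auto simp: enn_powr_mult enn_powr_ennreal powr_powr ac_simps split: split_indicator)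
      also have "ennreal (1 / t) * ennreal (t powr (p * \<rho>)) = ennreal (t powr (p * \<rho> - 1))"
        using True by (simp add: powr_diff flip: ennreal_mult)
      finally show ?thesis
        using True by simp
    qed simp
  qed
  also have "\<dots> = enn_powr L \<rho> * ennreal (m powr (p * \<rho>) / (p * \<rho>))"
    using p m by (simp add: nn_integral_cmult nn_integral_powr_from_0)
  also have "\<dots> < top"
    using L by (simp add: ennreal_mult_less_top)
  finally show ?thesis .
qed

text \<open>If the superlevel set had infinite measure, the rearrangement would be at least
  \<open>c\<close> on the whole half-line, where t^(p \<rho> - 1) is not integrable at
  infinity.\<close>

lemma superlevel_finite_if_lorentz:
  fixes f :: "'a::euclidean_space \<Rightarrow> ennreal"
  assumes f [measurable]: "f \<in> borel_measurable lebesgue" and fin: "lorentz_integral p \<rho> f < top"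
    and p: "0 < p" "0 < \<rho>" and c: "0 < c"
  shows "emeasure lebesgue {x. c < f x} < top"
proof (rule ccontr)
  assume "\<not> ?thesis"
  then have inf: "emeasure lebesgue {x. c < f x} = top"
    by (simp add: less_top[symmetric])
  then have "c \<noteq> top"
    by auto
  then obtain r where r: "c = ennreal r" "0 < r"
    using c by (cases c) auto
  obtain L where L: "lorentz_integral p \<rho> f = ennreal L" "0 \<le> L"
    using fin by (cases "lorentz_integral p \<rho> f") auto
  \<comment> \<open>Chosen so that the lower bound for the integrand has integral exactly
    \<open>L + 1\<close> over (0, T).\<close>
  define T where "T = ((L + 1) * (p * \<rho>) / r powr \<rho>) powr (1 / (p * \<rho>))"
  have c_le: "c \<le> decreasing_rearrangement f t" for t
    using less_rearrangement_iff[OF f, of c t] inf by (simp add: less_imp_le)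
  have "ennreal (L + 1) = ennreal (r powr \<rho>) * ennreal (T powr (p * \<rho>) / (p * \<rho>))"
    using r L p by (simp add: T_def powr_powr flip: ennreal_mult)
  also have "\<dots> = (\<integral>\<^sup>+ t. ennreal (r powr \<rho>) * (ennreal (t powr (p * \<rho> - 1)) * indicator {0<..<T} t) \<partial>lborel)"
    using p by (simp add: nn_integral_cmult nn_integral_powr_from_0 T_def)
  also have "\<dots> \<le> lorentz_integral p \<rho> f"
    unfolding lorentz_integral_def
  proof (intro nn_integral_mono)
    fix t :: real
    show "ennreal (r powr \<rho>) * (ennreal (t powr (p * \<rho> - 1)) * indicator {0<..<T} t) \<le>
        ennreal (1 / t) * enn_powr (ennreal (t powr p) * decreasing_rearrangement f t) \<rho> * indicator {0<..} t"
    proof (cases "0 < t \<and> t < T")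
      case True
      then have "ennreal (t powr (p * \<rho> - 1)) = ennreal (1 / t) * ennreal (t powr (p * \<rho>))"
        by (simp add: powr_diff flip: ennreal_mult)
      then have "ennreal (r powr \<rho>) * ennreal (t powr (p * \<rho> - 1)) =
          ennreal (1 / t) * enn_powr (ennreal (t powr p) * c) \<rho>"
        using r by (simp add: enn_powr_mult enn_powr_ennreal powr_powr ac_simps)
      also have "\<dots> \<le> ennreal (1 / t) * enn_powr (ennreal (t powr p) * decreasing_rearrangement f t) \<rho>"
        using p c_le by (intro mult_left_mono enn_powr_mono) auto
      finally show ?thesis
        using True by simp
    qed (auto simp: indicator_def)
  qed
  finally show False
    using L by (simp add: ennreal_le_iff)
qed

text \<open>The rearrangement is t^(-p) times the weighted one, and x \<le> 1 + x^\<rho> splits it: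
  t^(-p) is integrable at 0 because \<open>p < 1\<close>, and t^(-p) is at most T^(1-p) / t on (0,
  T), which leaves the Lorentz integral.\<close>

lemma nn_integral_finite_if_lorentz:
  fixes f :: "'a::euclidean_space \<Rightarrow> ennreal"
  assumes f [measurable]: "f \<in> borel_measurable lebesgue" and fin: "lorentz_integral p \<rho> f < top"
    and p: "p < 1" "1 \<le> \<rho>" and E [measurable]: "E \<in> sets lebesgue" and T: "emeasure lebesgue E < top"
  shows "(\<integral>\<^sup>+ x \<in> E. f x \<partial>lebesgue) < top"
proof -
  obtain T where T: "emeasure lebesgue E = ennreal T" "0 \<le> T"
    using T by (cases "emeasure lebesgue E") auto
  have "(\<integral>\<^sup>+ x \<in> E. f x \<partial>lebesgue) \<le> (\<integral>\<^sup>+ t \<in> {0<..<T}. decreasing_rearrangement f t \<partial>lborel)"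
    by (rule nn_integral_le_rearrangement) (simp_all add: T)
  also have "\<dots> \<le> (\<integral>\<^sup>+ t. ennreal (t powr ((1 - p) - 1)) * indicator {0<..<T} t +
      ennreal (T powr (1 - p)) * (ennreal (1 / t) *
      enn_powr (ennreal (t powr p) * decreasing_rearrangement f t) \<rho> * indicator {0<..} t) \<partial>lborel)"
  proof (intro nn_integral_mono)
    fix t :: real
    let ?r = "decreasing_rearrangement f t"
    show "?r * indicator {0<..<T} t \<le> ennreal (t powr ((1 - p) - 1)) * indicator {0<..<T} t +
      ennreal (T powr (1 - p)) * (ennreal (1 / t) * enn_powr (ennreal (t powr p) * ?r) \<rho> * indicator {0<..} t)"
    proof (cases "0 < t \<and> t < T")
      case True
      have "?r = ennreal (t powr (- p)) * (ennreal (t powr p) * ?r)"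
        using True by (simp flip: mult.assoc ennreal_mult powr_add)
      also have "\<dots> \<le> ennreal (t powr (- p)) * (1 + enn_powr (ennreal (t powr p) * ?r) \<rho>)"
        using p by (intro mult_left_mono le_1_plus_enn_powr) auto
      also have "\<dots> = ennreal (t powr (- p)) + ennreal (t powr (1 - p) * (1 / t)) * enn_powr (ennreal (t powr p) * ?r) \<rho>"
        using True by (simp add: distrib_left powr_diff powr_minus_divide)
      also have "\<dots> \<le> ennreal (t powr (- p)) + ennreal (T powr (1 - p) * (1 / t)) * enn_powr (ennreal (t powr p) * ?r) \<rho>"
        using True p by (intro add_left_mono mult_right_mono ennreal_leI powr_mono2) auto
      also have "ennreal (T powr (1 - p) * (1 / t)) = ennreal (T powr (1 - p)) * ennreal (1 / t)"
        using True by (intro ennreal_mult) auto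
      finally show ?thesis
        using True by (simp add: mult.assoc)
    qed (auto simp: indicator_def)
  qed
  also have "\<dots> = ennreal (T powr (1 - p) / (1 - p)) + ennreal (T powr (1 - p)) * lorentz_integral p \<rho> f"
    unfolding lorentz_integral_def using p T nn_integral_powr_from_0[of "1 - p" T]
    by (simp add: nn_integral_add nn_integral_cmult)
  also have "\<dots> < top"
    using fin by (simp add: ennreal_mult_less_top)
  finally show ?thesis .
qed

text \<open>After weighting, O'Neil's bound is an integral operator on the half-line whose kernel is
  homogeneous of degree -1. With respect to dt/t its row and column integrals therefore reduce to a
  single constant, and the Schur test applies without auxiliary weights.\<close>

lemma lorentz_integral_potential_le:
  assumes \<alpha>: "0 < \<alpha>" "\<alpha> < real DIM('a::euclidean_space)"
    and p: "0 < p" "p + \<alpha> / real DIM('a) < 1" and \<rho>: "1 < \<rho>"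
  shows "\<exists>C\<ge>0. \<forall>f\<in>borel_measurable (lebesgue :: 'a measure).
    lorentz_integral p \<rho> (potential \<alpha> f) \<le> ennreal C * lorentz_integral (p + \<alpha> / real DIM('a)) \<rho> f"
proof -
  define a where "a = \<alpha> / real DIM('a)"
  have a: "0 < a" "a < 1" "p + a < 1"
    using \<alpha> p by (auto simp: a_def)
  define c where "c = 2 * (sup_const DIM('a) \<alpha> * (real DIM('a) / \<alpha>))"
  have c: "0 < c"
    unfolding c_def using sup_const_pos[OF \<alpha>] \<alpha> by simp
  \<comment> \<open>The first summand is the integral over s < t and needs p + a < 1; the second is
    that over s > t and needs p > 0.\<close>
  define W where "W = 1 / (1 - p - a) + 1 / p"
  have W: "0 < W"
    unfolding W_def using a p by (intro add_pos_pos) auto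
  define k :: "real \<Rightarrow> real \<Rightarrow> ennreal" where
    "k t s = ennreal (t powr p * max t s powr (a - 1) * s powr (- p - a)) * indicator {0<..} s" for t s
  have [measurable]: "case_prod k \<in> borel_measurable (borel \<Otimes>\<^sub>M borel)"
    unfolding k_def by measurable
  have row: "(\<integral>\<^sup>+ s. k t s \<partial>lborel) \<le> ennreal W" if t: "0 < t" for t
  proof -
    have 1: "ennreal (t powr p * max t s powr (a - 1) * s powr (- p - a)) * indicator {0<..<t} s =
        ennreal (t powr (p + a - 1)) * (ennreal (s powr ((1 - p - a) - 1)) * indicator {0<..<t} s)" for s
      using t by (auto split: split_indicator simp: add_diff_eq simp flip: ennreal_mult powr_add)
    have 2: "ennreal (t powr p * max t s powr (a - 1) * s powr (- p - a)) * indicator {t<..} s =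
        ennreal (t powr p) * (ennreal (s powr (- p - 1)) * indicator {t<..} s)" for s
    proof (cases "t < s")
      case True
      have "s powr (a - 1) * s powr (- p - a) = s powr (- p - 1)"
        by (subst powr_add[symmetric]) (rule arg_cong[where f = "\<lambda>e. s powr e"], simp)
      then show ?thesis
        using True t by (simp add: mult.assoc flip: ennreal_mult)
    qed simp
    have "(\<integral>\<^sup>+ s. k t s \<partial>lborel) =
        (\<integral>\<^sup>+ s \<in> {0<..}. ennreal (t powr p * max t s powr (a - 1) * s powr (- p - a)) \<partial>lborel)"
      by (simp add: k_def)
    also have "\<dots> = ennreal (t powr (p + a - 1)) * ennreal (t powr (1 - p - a) / (1 - p - a)) +
        ennreal (t powr p) * ennreal (t powr (- p) / p)"
      using t a p nn_integral_powr_from_0[of "1 - p - a" t]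
      by (subst nn_integral_split_pos[of _ t]) (simp_all add: 1 2 nn_integral_cmult nn_integral_powr_to_inf)
    also have "\<dots> = ennreal W"
      unfolding W_def using t a p by (simp flip: ennreal_mult ennreal_plus powr_add)
    finally show ?thesis by simp
  qed
  have col: "(\<integral>\<^sup>+ t \<in> {0<..}. ennreal (1 / t) * k t s \<partial>lborel) \<le> ennreal W * (ennreal (1 / s) * indicator {0<..} s)" for s
  proof (cases "0 < s")
    case s: True
    have 1: "ennreal (1 / t) * k t s * indicator {0<..<s} t =
        ennreal (s powr (- p - 1)) * (ennreal (t powr (p - 1)) * indicator {0<..<s} t)" for t
    proof (cases "0 < t \<and> t < s")
      case True
      have "1 / t * (t powr p * s powr (a - 1) * s powr (- p - a)) = (s powr (a - 1) * s powr (- p - a)) * t powr (p - 1)"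
        using True powr_diff[of t p 1] by (simp add: ac_simps)
      also have "s powr (a - 1) * s powr (- p - a) = s powr (- p - 1)"
        by (subst powr_add[symmetric]) (rule arg_cong[where f = "\<lambda>e. s powr e"], simp)
      finally show ?thesis
        using True by (simp add: k_def max_def flip: ennreal_mult)
    qed (auto simp: indicator_def)
    have 2: "ennreal (1 / t) * k t s * indicator {s<..} t =
        ennreal (s powr (- p - a)) * (ennreal (t powr (- (1 - p - a) - 1)) * indicator {s<..} t)" for t
    proof (cases "s < t")
      case True
      have "1 / t * (t powr p * t powr (a - 1) * s powr (- p - a)) =
          s powr (- p - a) * (t powr p * t powr (a - 1) * t powr (- 1))"
        using True s by (simp add: powr_minus_divide)
      also have "t powr p * t powr (a - 1) * t powr (- 1) = t powr (- (1 - p - a) - 1)"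
        by (subst powr_add[symmetric])+ (rule arg_cong[where f = "\<lambda>e. t powr e"], simp)
      finally show ?thesis
        using True s by (simp add: k_def max_def flip: ennreal_mult)
    qed (auto simp: indicator_def)
    have "(\<integral>\<^sup>+ t \<in> {0<..}. ennreal (1 / t) * k t s \<partial>lborel) =
        ennreal (s powr (- p - 1)) * ennreal (s powr p / p) +
        ennreal (s powr (- p - a)) * ennreal (s powr (- (1 - p - a)) / (1 - p - a))"
    proof (subst nn_integral_split_pos[of _ s])
      have "(\<integral>\<^sup>+ t. ennreal (t powr (- (1 - p - a) - 1)) * indicator {s<..} t \<partial>lborel) =
          ennreal (s powr (- (1 - p - a)) / (1 - p - a))"
        using s a by (intro nn_integral_powr_to_inf) auto
      then show "(\<integral>\<^sup>+ t \<in> {0<..<s}. ennreal (1 / t) * k t s \<partial>lborel) + (\<integral>\<^sup>+ t \<in> {s<..}. ennreal (1 / t) * k t s \<partial>lborel) =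
          ennreal (s powr (- p - 1)) * ennreal (s powr p / p) +
          ennreal (s powr (- p - a)) * ennreal (s powr (- (1 - p - a)) / (1 - p - a))"
        unfolding 1 2 using s p by (simp add: nn_integral_cmult nn_integral_powr_from_0)
    qed (use s in \<open>simp_all add: k_def\<close>)
    also have "\<dots> = ennreal (s powr (- 1) / p + s powr (- 1) / (1 - p - a))"
      using a p by (simp flip: ennreal_mult ennreal_plus powr_add)
    also have "s powr (- 1) / p + s powr (- 1) / (1 - p - a) = W * (1 / s)"
      unfolding W_def using s by (simp add: powr_minus_divide algebra_simps)
    finally show ?thesis
      using s W by (simp flip: ennreal_mult)
  next
    case False
    then show ?thesis by (simp add: k_def)
  qed
  have "lorentz_integral p \<rho> (potential \<alpha> f) \<le>
      ennreal (W powr \<rho> * c powr \<rho>) * lorentz_integral (p + a) \<rho> f"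
    if f [measurable]: "f \<in> borel_measurable lebesgue" for f :: "'a \<Rightarrow> ennreal"
  proof -
    define g where "g s = ennreal c * (ennreal (s powr (p + a)) * decreasing_rearrangement f s)" for s
    have [measurable]: "g \<in> borel_measurable borel"
      unfolding g_def by measurable
    have le: "ennreal (t powr p) * decreasing_rearrangement (potential \<alpha> f) t \<le> (\<integral>\<^sup>+ s. k t s * g s \<partial>lborel)"
      if t: "0 < t" for t
    proof -
      have eq: "ennreal (t powr p) * (ennreal c * (decreasing_rearrangement f s *
          ennreal (max t s powr (a - 1)) * indicator {0<..} s)) = k t s * g s" for s
      proof (cases "0 < s")
        case s: True
        have "t powr p * (c * max t s powr (a - 1)) =
            (t powr p * max t s powr (a - 1) * s powr (- p - a)) * (c * s powr (p + a))"
          using s by (simp add: powr_diff powr_minus_divide powr_add)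
        then have "ennreal (t powr p) * (ennreal c * ennreal (max t s powr (a - 1))) =
            ennreal (t powr p * max t s powr (a - 1) * s powr (- p - a)) * (ennreal c * ennreal (s powr (p + a)))"
          using c by (simp flip: ennreal_mult)
        then have "(ennreal (t powr p) * (ennreal c * ennreal (max t s powr (a - 1)))) * decreasing_rearrangement f s =
            ennreal (t powr p * max t s powr (a - 1) * s powr (- p - a)) *
            (ennreal c * ennreal (s powr (p + a))) * decreasing_rearrangement f s"
          by (simp only:)
        then show ?thesis
          using s by (simp add: k_def g_def ac_simps)
      qed (simp add: k_def)
      have "ennreal (t powr p) * decreasing_rearrangement (potential \<alpha> f) t \<le> ennreal (t powr p) *
        (ennreal c * (\<integral>\<^sup>+ s \<in> {0<..}. decreasing_rearrangement f s * ennreal (max t s powr (a - 1)) \<partial>lborel))"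
        unfolding c_def a_def using \<alpha> t by (intro mult_left_mono rearrangement_potential_le) simp_all
      also have "\<dots> = (\<integral>\<^sup>+ s. k t s * g s \<partial>lborel)"
        by (simp add: nn_integral_cmult flip: eq)
      finally show ?thesis .
    qed
    have "lorentz_integral p \<rho> (potential \<alpha> f) \<le>
        (\<integral>\<^sup>+ t \<in> {0<..}. ennreal (1 / t) * enn_powr (\<integral>\<^sup>+ s. k t s * g s \<partial>lborel) \<rho> \<partial>lborel)"
      unfolding lorentz_integral_def
    proof (intro nn_integral_mono)
      fix t :: real
      show "ennreal (1 / t) * enn_powr (ennreal (t powr p) * decreasing_rearrangement (potential \<alpha> f) t) \<rho> * indicator {0<..} t
          \<le> ennreal (1 / t) * enn_powr (\<integral>\<^sup>+ s. k t s * g s \<partial>lborel) \<rho> * indicator {0<..} t"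
        using le[of t] \<rho> by (cases "0 < t") (auto intro!: mult_left_mono enn_powr_mono)
    qed
    also have "\<dots> \<le> ennreal (W powr \<rho>) * (\<integral>\<^sup>+ s. (ennreal (1 / s) * indicator {0<..} s) * enn_powr (g s) \<rho> \<partial>lborel)"
      using row col W \<rho> by (intro Schur_test_powr) simp_all
    also have "(\<integral>\<^sup>+ s. (ennreal (1 / s) * indicator {0<..} s) * enn_powr (g s) \<rho> \<partial>lborel) =
        (\<integral>\<^sup>+ s. ennreal (c powr \<rho>) * (ennreal (1 / s) * enn_powr (ennreal (s powr (p + a)) * decreasing_rearrangement f s) \<rho>
          * indicator {0<..} s) \<partial>lborel)"
      unfolding g_def enn_powr_mult[of "ennreal c"] using c by (simp add: enn_powr_ennreal ac_simps)
    also have "\<dots> = ennreal (c powr \<rho>) * lorentz_integral (p + a) \<rho> f"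
      unfolding lorentz_integral_def by (rule nn_integral_cmult) measurable
    finally show ?thesis
      by (simp add: ennreal_mult mult.assoc)
  qed
  then show ?thesis
    by (intro exI[of _ "W powr \<rho> * c powr \<rho>"]) (auto simp: a_def)
qed

section \<open>The a priori estimate\<close>

definition source ::
  "nat \<Rightarrow> (nat \<Rightarrow> real) \<Rightarrow> (nat \<Rightarrow> 'a \<Rightarrow> ennreal) \<Rightarrow> ('a \<Rightarrow> ennreal) \<Rightarrow> ('a \<Rightarrow> ennreal) \<Rightarrow> 'a \<Rightarrow> ennreal" where
  "source M q S W u y = (\<Sum>i = 1..M. S i y * enn_powr (u y) (q i)) + W y"

lemma source_measurable [measurable]:
  assumes [measurable]: "\<And>i. i \<in> {1..M} \<Longrightarrow> S i \<in> borel_measurable N" "W \<in> borel_measurable N" "u \<in> borel_measurable N"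
  shows "source M q S W u \<in> borel_measurable N"
  unfolding source_def by measurable

lemma source_mono:
  assumes "\<And>i. i \<in> {1..M} \<Longrightarrow> 0 \<le> q i" "\<And>i. i \<in> {1..M} \<Longrightarrow> S i y \<le> S' i y" "W y \<le> W' y" "u y \<le> v y"
  shows "source M q S W u y \<le> source M q S' W' v y"
  unfolding source_def using assms by (intro add_mono sum_mono mult_mono enn_powr_mono) auto

text \<open>Outside the \<open>M + 2\<close> sets where \<open>u\<close>, \<open>W\<close> or some
  \<open>S i\<close> exceeds its rearrangement at \<open>t\<close>, the bound holds pointwise; each
  of these sets has measure at most \<open>t\<close>.\<close>

lemma rearrangement_source_le:
  fixes u W :: "'a::euclidean_space \<Rightarrow> ennreal"
  assumes S: "\<And>i. i \<in> {1..M} \<Longrightarrow> S i \<in> borel_measurable lebesgue"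
    and [measurable]: "W \<in> borel_measurable lebesgue" "u \<in> borel_measurable lebesgue"
    and q: "\<And>i. i \<in> {1..M} \<Longrightarrow> 0 < q i" and t: "0 < t"
  shows "decreasing_rearrangement (source M q S W u) (real (M + 2) * t) \<le>
    (\<Sum>i = 1..M. decreasing_rearrangement (S i) t * enn_powr (decreasing_rearrangement u t) (q i)) +
    decreasing_rearrangement W t" (is "_ \<le> ?X")
proof (subst rearrangement_le_iff)
  show "source M q S W u \<in> borel_measurable lebesgue"
    using S by measurable
  let ?E = "\<lambda>f. {x. decreasing_rearrangement f t < f x}"
  have "{x. ?X < source M q S W u x} \<subseteq> (?E u \<union> ?E W) \<union> (\<Union>i\<in>{1..M}. ?E (S i))"
  proof (rule ccontr)
    assume "\<not> ?thesis"
    then obtain x where x: "?X < source M q S W u x" "x \<notin> ?E u" "x \<notin> ?E W" "\<And>i. i \<in> {1..M} \<Longrightarrow> x \<notin> ?E (S i)"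
      by blast
    have "source M q S W u x \<le> ?X"
      unfolding source_def using x q
      by (intro add_mono sum_mono mult_mono enn_powr_mono) (auto simp: not_less less_imp_le)
    then show False
      using x(1) by simp
  qed
  then have "emeasure lebesgue {x. ?X < source M q S W u x} \<le>
      emeasure lebesgue ((?E u \<union> ?E W) \<union> (\<Union>i\<in>{1..M}. ?E (S i)))"
    using S by (intro emeasure_mono) (auto intro!: sets.Un sets.finite_UN)
  also have "\<dots> \<le> emeasure lebesgue (?E u \<union> ?E W) + emeasure lebesgue (\<Union>i\<in>{1..M}. ?E (S i))"
    using S by (intro emeasure_subadditive) (auto intro!: sets.Un sets.finite_UN)
  also have "\<dots> \<le> (emeasure lebesgue (?E u) + emeasure lebesgue (?E W)) + (\<Sum>i = 1..M. emeasure lebesgue (?E (S i)))"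
    using S by (intro add_mono emeasure_subadditive emeasure_subadditive_finite) auto
  also have "\<dots> \<le> (ennreal t + ennreal t) + (\<Sum>i = 1..M. ennreal t)"
    using S by (intro add_mono sum_mono emeasure_superlevel_rearrangement_le) auto
  also have "\<dots> = ennreal (real (M + 2) * t)"
    using t by (simp add: ennreal_of_nat_eq_real_of_nat algebra_simps flip: ennreal_plus ennreal_mult)
  finally show "emeasure lebesgue {x. ?X < source M q S W u x} \<le> ennreal (real (M + 2) * t)" .
qed

text \<open>Undoes the dilated argument of the rearrangement of a sum: dt/t is invariant under
  scaling, and the weight t^p, raised to \<rho>, contributes the constant.\<close>

lemma lorentz_integral_dilate:
  assumes [measurable]: "f \<in> borel_measurable lebesgue" and N: "0 < N"
  shows "lorentz_integral p \<rho> f = ennreal (N powr (p * \<rho>)) *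
    (\<integral>\<^sup>+ t \<in> {0<..}. ennreal (1 / t) * enn_powr (ennreal (t powr p) * decreasing_rearrangement f (N * t)) \<rho> \<partial>lborel)"
proof -
  let ?F = "\<lambda>t. ennreal (1 / t) * enn_powr (ennreal (t powr p) * decreasing_rearrangement f t) \<rho> * indicator {0<..} t"
  have "lorentz_integral p \<rho> f = ennreal \<bar>N\<bar> * (\<integral>\<^sup>+ t. ?F (0 + N * t) \<partial>lborel)"
    unfolding lorentz_integral_def using N by (intro nn_integral_real_affine) auto
  also have "\<dots> = (\<integral>\<^sup>+ t. ennreal N * ?F (N * t) \<partial>lborel)"
    using N by (simp add: nn_integral_cmult)
  also have "\<dots> = (\<integral>\<^sup>+ t. ennreal (N powr (p * \<rho>)) * (ennreal (1 / t) *
      enn_powr (ennreal (t powr p) * decreasing_rearrangement f (N * t)) \<rho> * indicator {0<..} t) \<partial>lborel)"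
  proof (intro nn_integral_cong)
    fix t :: real
    show "ennreal N * ?F (N * t) = ennreal (N powr (p * \<rho>)) * (ennreal (1 / t) *
      enn_powr (ennreal (t powr p) * decreasing_rearrangement f (N * t)) \<rho> * indicator {0<..} t)"
    proof (cases "0 < t")
      case True
      have "ennreal N * ennreal (1 / (N * t)) = ennreal (1 / t)"
        using True N by (simp flip: ennreal_mult)
      moreover have "ennreal ((N * t) powr p) = ennreal (N powr p) * ennreal (t powr p)"
        using True N by (simp add: powr_mult ennreal_mult)
      moreover have "enn_powr (ennreal (N powr p)) \<rho> = ennreal (N powr (p * \<rho>))"
        by (simp add: enn_powr_ennreal powr_powr)
      ultimately have "ennreal N * (ennreal (1 / (N * t)) *
          enn_powr (ennreal ((N * t) powr p) * decreasing_rearrangement f (N * t)) \<rho>) =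
          ennreal (N powr (p * \<rho>)) * (ennreal (1 / t) * enn_powr (ennreal (t powr p) * decreasing_rearrangement f (N * t)) \<rho>)"
        by (simp add: enn_powr_mult flip: mult.assoc) (simp add: ac_simps)
      then show ?thesis
        using True N by simp
    next
      case False
      then have "\<not> 0 < N * t"
        using N by (simp add: zero_less_mult_iff)
      then show ?thesis
        using False by simp
    qed
  qed
  finally show ?thesis
    by (simp add: nn_integral_cmult)
qed

lemma nn_integral_linear_combination:
  assumes y: "y \<in> borel_measurable N" and v: "v \<in> borel_measurable N"
    and z: "\<And>i. i \<in> I \<Longrightarrow> z i \<in> borel_measurable N"
  shows "(\<integral>\<^sup>+ t. c2 * (c1 * y t + ((\<Sum>i\<in>I. b i * z i t) + c3 * v t)) \<partial>N) =
    c2 * (c1 * (\<integral>\<^sup>+ t. y t \<partial>N) + ((\<Sum>i\<in>I. b i * (\<integral>\<^sup>+ t. z i t \<partial>N)) + c3 * (\<integral>\<^sup>+ t. v t \<partial>N)))"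
proof -
  have s: "(\<lambda>t. \<Sum>i\<in>I. b i * z i t) \<in> borel_measurable N"
    using z by (intro borel_measurable_sum) simp
  have "(\<integral>\<^sup>+ t. (\<Sum>i\<in>I. b i * z i t) \<partial>N) = (\<Sum>i\<in>I. b i * (\<integral>\<^sup>+ t. z i t \<partial>N))"
    using z by (simp add: nn_integral_sum nn_integral_cmult)
  then show ?thesis
    using y v s by (simp add: nn_integral_cmult nn_integral_add)
qed

text \<open>The order of quantifiers matters: \<open>Y\<close> depends on \<epsilon> and the data,
  not on \<open>u\<close>. The splitting t^P = t^(p q_i) t^(e_i) gives the i-th term the form
  U^(q_i) Z_i of weighted rearrangements, to which Young's inequality applies at each
  \<open>t\<close>.\<close>

lemma lorentz_integral_source_le:
  fixes S :: "nat \<Rightarrow> 'a::euclidean_space \<Rightarrow> ennreal" and W :: "'a \<Rightarrow> ennreal"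
  assumes S [measurable]: "\<And>i. i \<in> {1..M} \<Longrightarrow> S i \<in> borel_measurable lebesgue"
    and W [measurable]: "W \<in> borel_measurable lebesgue"
    and q: "\<And>i. i \<in> {1..M} \<Longrightarrow> 0 < q i \<and> q i < 1"
    and e: "\<And>i. i \<in> {1..M} \<Longrightarrow> P = p * q i + e i" and \<rho>: "1 < \<rho>"
    and fin: "\<And>i. i \<in> {1..M} \<Longrightarrow> lorentz_integral (e i) (\<rho> / (1 - q i)) (S i) < top"
      "lorentz_integral P \<rho> W < top"
    and \<epsilon>: "0 < \<epsilon>"
  shows "\<exists>Y<top. \<forall>u\<in>borel_measurable lebesgue.
    lorentz_integral P \<rho> (source M q S W u) \<le> ennreal \<epsilon> * lorentz_integral p \<rho> u + Y"
proof -
  define N where "N = real (M + 2)"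
  have N: "0 < N"
    by (simp add: N_def)
  \<comment> \<open>The total price of the linear term: N^(P \<rho>) from the dilation, 2^\<rho>
    from splitting the \<rho>-th power of a sum, and N^\<rho> because \<delta> occurs at most N
    times. The choice of \<delta> makes K \<delta>^\<rho> equal to \<epsilon>.\<close>
  define K where "K = N powr (P * \<rho>) * 2 powr \<rho> * N powr \<rho>"
  have K: "0 < K"
    using N by (simp add: K_def)
  define \<delta> where "\<delta> = (\<epsilon> / K) powr (1 / \<rho>)"
  have \<delta>: "0 < \<delta>" "\<delta> powr \<rho> = \<epsilon> / K"
    using K \<epsilon> \<rho> by (auto simp: \<delta>_def powr_powr)
  define D where "D i = \<delta> powr (- (q i / (1 - q i)))" for i
  define B where "B = (\<Sum>i = 1..M. ennreal (2 powr \<rho> * real M powr \<rho> * D i powr \<rho>) *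
      lorentz_integral (e i) (\<rho> / (1 - q i)) (S i)) + ennreal (2 powr \<rho>) * lorentz_integral P \<rho> W"
  define Y where "Y = ennreal (N powr (P * \<rho>) * 2 powr \<rho>) * B"
  have "Y < top"
    unfolding Y_def B_def using fin by (simp add: ennreal_mult_less_top ennreal_sum_less_top)
  moreover have "lorentz_integral P \<rho> (source M q S W u) \<le> ennreal \<epsilon> * lorentz_integral p \<rho> u + Y"
    if u [measurable]: "u \<in> borel_measurable lebesgue" for u
  proof -
    let ?F = "source M q S W u"
    let ?w = "\<lambda>t. ennreal (1 / t) * indicator {0<..} t"
    define U where "U t = ennreal (t powr p) * decreasing_rearrangement u t" for t
    define Z where "Z i t = ennreal (t powr e i) * decreasing_rearrangement (S i) t" for i t
    define V where "V t = ennreal (t powr P) * decreasing_rearrangement W t" for t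
    have [measurable]: "U \<in> borel_measurable borel" "V \<in> borel_measurable borel"
      unfolding U_def V_def by measurable
    have Zm [measurable]: "Z i \<in> borel_measurable borel" if "i \<in> {1..M}" for i
      using that unfolding Z_def by measurable
    have pt: "ennreal (t powr P) * decreasing_rearrangement ?F (N * t) \<le>
        ennreal (N * \<delta>) * U t + ((\<Sum>i = 1..M. ennreal (D i) * enn_powr (Z i t) (1 / (1 - q i))) + V t)" if t: "0 < t" for t
    proof -
      have "ennreal (t powr P) * decreasing_rearrangement ?F (N * t) \<le> ennreal (t powr P) *
        ((\<Sum>i = 1..M. decreasing_rearrangement (S i) t * enn_powr (decreasing_rearrangement u t) (q i)) +
        decreasing_rearrangement W t)"
        unfolding N_def using q t S by (intro mult_left_mono rearrangement_source_le) auto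
      also have "\<dots> = (\<Sum>i = 1..M. enn_powr (U t) (q i) * Z i t) + V t"
      proof -
        have "ennreal (t powr P) * (decreasing_rearrangement (S i) t * enn_powr (decreasing_rearrangement u t) (q i)) =
            enn_powr (U t) (q i) * Z i t" if i: "i \<in> {1..M}" for i
        proof -
          have "ennreal (t powr P) = ennreal (t powr (p * q i)) * ennreal (t powr e i)"
            using e[OF i] by (simp add: powr_add ennreal_mult)
          then show ?thesis
            unfolding U_def Z_def by (simp add: enn_powr_mult enn_powr_ennreal powr_powr ac_simps)
        qed
        then show ?thesis
          by (simp add: distrib_left sum_distrib_left V_def)
      qed
      also have "\<dots> \<le> (\<Sum>i = 1..M. ennreal \<delta> * U t + ennreal (D i) * enn_powr (Z i t) (1 / (1 - q i))) + V t"
        unfolding D_def using q \<delta> by (intro add_right_mono sum_mono enn_powr_Young) auto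
      also have "\<dots> = ennreal (real M * \<delta>) * U t + (\<Sum>i = 1..M. ennreal (D i) * enn_powr (Z i t) (1 / (1 - q i))) + V t"
        using \<delta> by (simp add: sum.distrib ennreal_mult ennreal_of_nat_eq_real_of_nat mult.assoc)
      \<comment> \<open>\<open>M\<close> is enlarged to \<open>N\<close>, so that the constant
        \<open>K\<close> is positive for \<open>M = 0\<close> as well.\<close>
      also have "\<dots> \<le> ennreal (N * \<delta>) * U t + (\<Sum>i = 1..M. ennreal (D i) * enn_powr (Z i t) (1 / (1 - q i))) + V t"
        using \<delta> by (intro add_right_mono mult_right_mono ennreal_leI) (auto simp: N_def)
      finally show ?thesis
        by (simp add: add.assoc)
    qed
    have pt': "enn_powr (ennreal (t powr P) * decreasing_rearrangement ?F (N * t)) \<rho> \<le>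
        ennreal (2 powr \<rho>) * (ennreal (N powr \<rho> * \<delta> powr \<rho>) * enn_powr (U t) \<rho> +
          ((\<Sum>i = 1..M. ennreal (2 powr \<rho> * real M powr \<rho> * D i powr \<rho>) * enn_powr (Z i t) (\<rho> / (1 - q i))) +
            ennreal (2 powr \<rho>) * enn_powr (V t) \<rho>))" if t: "0 < t" for t
    proof -
      have "enn_powr (\<Sum>i = 1..M. ennreal (D i) * enn_powr (Z i t) (1 / (1 - q i))) \<rho> \<le>
          ennreal (real M powr \<rho>) * (\<Sum>i = 1..M. enn_powr (ennreal (D i) * enn_powr (Z i t) (1 / (1 - q i))) \<rho>)"
        using enn_powr_sum_le[of "{1..M}" \<rho> "\<lambda>i. ennreal (D i) * enn_powr (Z i t) (1 / (1 - q i))"] \<rho> by simp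
      also have "\<dots> = (\<Sum>i = 1..M. ennreal (real M powr \<rho> * D i powr \<rho>) * enn_powr (Z i t) (\<rho> / (1 - q i)))"
        by (simp add: enn_powr_mult enn_powr_powr enn_powr_ennreal D_def sum_distrib_left ennreal_mult mult.assoc)
      finally have 1: "enn_powr (\<Sum>i = 1..M. ennreal (D i) * enn_powr (Z i t) (1 / (1 - q i))) \<rho> \<le>
          (\<Sum>i = 1..M. ennreal (real M powr \<rho> * D i powr \<rho>) * enn_powr (Z i t) (\<rho> / (1 - q i)))" .
      have "enn_powr ((\<Sum>i = 1..M. ennreal (D i) * enn_powr (Z i t) (1 / (1 - q i))) + V t) \<rho> \<le>
          ennreal (2 powr \<rho>) * (enn_powr (\<Sum>i = 1..M. ennreal (D i) * enn_powr (Z i t) (1 / (1 - q i))) \<rho> + enn_powr (V t) \<rho>)"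
        using \<rho> by (intro enn_powr_add_le) simp
      also have "\<dots> \<le> ennreal (2 powr \<rho>) *
          ((\<Sum>i = 1..M. ennreal (real M powr \<rho> * D i powr \<rho>) * enn_powr (Z i t) (\<rho> / (1 - q i))) + enn_powr (V t) \<rho>)"
        using 1 by (intro mult_left_mono add_right_mono) auto
      also have "\<dots> = (\<Sum>i = 1..M. ennreal (2 powr \<rho> * real M powr \<rho> * D i powr \<rho>) * enn_powr (Z i t) (\<rho> / (1 - q i))) +
            ennreal (2 powr \<rho>) * enn_powr (V t) \<rho>"
        by (simp add: distrib_left sum_distrib_left ennreal_mult mult.assoc)
      finally have 2: "enn_powr ((\<Sum>i = 1..M. ennreal (D i) * enn_powr (Z i t) (1 / (1 - q i))) + V t) \<rho> \<le> \<dots>" .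
      have "enn_powr (ennreal (t powr P) * decreasing_rearrangement ?F (N * t)) \<rho> \<le>
          enn_powr (ennreal (N * \<delta>) * U t + ((\<Sum>i = 1..M. ennreal (D i) * enn_powr (Z i t) (1 / (1 - q i))) + V t)) \<rho>"
        using \<rho> by (intro enn_powr_mono pt t) simp
      also have "\<dots> \<le> ennreal (2 powr \<rho>) * (enn_powr (ennreal (N * \<delta>) * U t) \<rho> +
          enn_powr ((\<Sum>i = 1..M. ennreal (D i) * enn_powr (Z i t) (1 / (1 - q i))) + V t) \<rho>)"
        using \<rho> by (intro enn_powr_add_le) simp
      also have "enn_powr (ennreal (N * \<delta>) * U t) \<rho> = ennreal (N powr \<rho> * \<delta> powr \<rho>) * enn_powr (U t) \<rho>"
        using N \<delta> by (simp add: enn_powr_mult enn_powr_ennreal powr_mult)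
      also have "ennreal (2 powr \<rho>) * (\<dots> + enn_powr ((\<Sum>i = 1..M. ennreal (D i) * enn_powr (Z i t) (1 / (1 - q i))) + V t) \<rho>)
          \<le> ennreal (2 powr \<rho>) * (\<dots> + ((\<Sum>i = 1..M. ennreal (2 powr \<rho> * real M powr \<rho> * D i powr \<rho>) *
            enn_powr (Z i t) (\<rho> / (1 - q i))) + ennreal (2 powr \<rho>) * enn_powr (V t) \<rho>))"
        by (intro mult_left_mono add_left_mono 2) simp
      finally show ?thesis .
    qed
    have pull: "x * (c2 * (c1 * y + ((\<Sum>i = 1..M. b i * z i) + c3 * v))) =
        c2 * (c1 * (x * y) + ((\<Sum>i = 1..M. b i * (x * z i)) + c3 * (x * v)))" for x y c1 c2 c3 v :: ennreal and b z
      by (simp only: distrib_left sum_distrib_left mult.left_commute[of x])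
    have LI: "lorentz_integral p \<rho> u = (\<integral>\<^sup>+ t. ?w t * enn_powr (U t) \<rho> \<partial>lborel)"
        "lorentz_integral P \<rho> W = (\<integral>\<^sup>+ t. ?w t * enn_powr (V t) \<rho> \<partial>lborel)"
        "\<And>i. lorentz_integral (e i) (\<rho> / (1 - q i)) (S i) = (\<integral>\<^sup>+ t. ?w t * enn_powr (Z i t) (\<rho> / (1 - q i)) \<partial>lborel)"
      by (simp_all add: lorentz_integral_def U_def V_def Z_def ac_simps)
    have "lorentz_integral P \<rho> ?F = ennreal (N powr (P * \<rho>)) *
        (\<integral>\<^sup>+ t \<in> {0<..}. ennreal (1 / t) * enn_powr (ennreal (t powr P) * decreasing_rearrangement ?F (N * t)) \<rho> \<partial>lborel)"
      using N by (intro lorentz_integral_dilate) measurable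
    also have "\<dots> \<le> ennreal (N powr (P * \<rho>)) * (\<integral>\<^sup>+ t. ennreal (2 powr \<rho>) *
        (ennreal (N powr \<rho> * \<delta> powr \<rho>) * (?w t * enn_powr (U t) \<rho>) +
          ((\<Sum>i = 1..M. ennreal (2 powr \<rho> * real M powr \<rho> * D i powr \<rho>) * (?w t * enn_powr (Z i t) (\<rho> / (1 - q i)))) +
            ennreal (2 powr \<rho>) * (?w t * enn_powr (V t) \<rho>))) \<partial>lborel)"
    proof (intro mult_left_mono nn_integral_mono)
      fix t :: real
      show "ennreal (1 / t) * enn_powr (ennreal (t powr P) * decreasing_rearrangement ?F (N * t)) \<rho> * indicator {0<..} t \<le>
        ennreal (2 powr \<rho>) * (ennreal (N powr \<rho> * \<delta> powr \<rho>) * (?w t * enn_powr (U t) \<rho>) +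
          ((\<Sum>i = 1..M. ennreal (2 powr \<rho> * real M powr \<rho> * D i powr \<rho>) * (?w t * enn_powr (Z i t) (\<rho> / (1 - q i)))) +
            ennreal (2 powr \<rho>) * (?w t * enn_powr (V t) \<rho>)))"
      proof (cases "0 < t")
        case True
        then show ?thesis
          using mult_left_mono[OF pt'[OF True], of "ennreal (1 / t)"]
          unfolding pull by simp
      qed simp
    qed simp
    also have "\<dots> = ennreal (N powr (P * \<rho>)) * (ennreal (2 powr \<rho>) *
        (ennreal (N powr \<rho> * \<delta> powr \<rho>) * lorentz_integral p \<rho> u + B))"
      unfolding B_def LI
      by (rule arg_cong[where f = "\<lambda>x. ennreal (N powr (P * \<rho>)) * x"],
          rule nn_integral_linear_combination[where y = "\<lambda>t. ?w t * enn_powr (U t) \<rho>" and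
            v = "\<lambda>t. ?w t * enn_powr (V t) \<rho>" and z = "\<lambda>i t. ?w t * enn_powr (Z i t) (\<rho> / (1 - q i))" and I = "{1..M}"])
         simp_all
    also have "\<dots> = ennreal (K * \<delta> powr \<rho>) * lorentz_integral p \<rho> u + Y"
      by (simp add: K_def Y_def distrib_left ennreal_mult mult.assoc)
    also have "K * \<delta> powr \<rho> = \<epsilon>"
      using K \<delta> by simp
    finally show ?thesis .
  qed
  ultimately show ?thesis
    by blast
qed

text \<open>Absorption: C \<epsilon> \<le> 1/2 leaves half of the finite quantity on the left. Since
  \<open>F\<close> is only required to lie below the source of the full data, a single
  \<open>B\<close> serves all truncated problems.\<close>

lemma lorentz_a_priori_bound:
  fixes S :: "nat \<Rightarrow> 'a::euclidean_space \<Rightarrow> ennreal" and W :: "'a \<Rightarrow> ennreal"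
  assumes \<alpha>: "0 < \<alpha>" "\<alpha> < real DIM('a)"
    and p: "0 < p" "P = p + \<alpha> / real DIM('a)" "P < 1" and \<rho>: "1 < \<rho>"
    and S [measurable]: "\<And>i. i \<in> {1..M} \<Longrightarrow> S i \<in> borel_measurable lebesgue"
    and W [measurable]: "W \<in> borel_measurable lebesgue"
    and q: "\<And>i. i \<in> {1..M} \<Longrightarrow> 0 < q i \<and> q i < 1"
    and e: "\<And>i. i \<in> {1..M} \<Longrightarrow> P = p * q i + e i"
    and fin: "\<And>i. i \<in> {1..M} \<Longrightarrow> lorentz_integral (e i) (\<rho> / (1 - q i)) (S i) < top"
      "lorentz_integral P \<rho> W < top"
  shows "\<exists>B<top. \<forall>u\<in>borel_measurable lebesgue. \<forall>F\<in>borel_measurable lebesgue.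
    (\<forall>y. F y \<le> source M q S W u y) \<longrightarrow> lorentz_integral p \<rho> u < top \<longrightarrow> u = potential \<alpha> F \<longrightarrow>
    lorentz_integral p \<rho> u \<le> B"
proof -
  obtain C where C: "0 \<le> C" and pot: "\<And>f. f \<in> borel_measurable (lebesgue :: 'a measure) \<Longrightarrow>
      lorentz_integral p \<rho> (potential \<alpha> f) \<le> ennreal C * lorentz_integral P \<rho> f"
    using lorentz_integral_potential_le[OF \<alpha> p(1) _ \<rho>] p by auto
  define \<epsilon> where "\<epsilon> = 1 / (2 * (C + 1))"
  have \<epsilon>: "0 < \<epsilon>" "C * \<epsilon> \<le> 1 / 2"
    using C by (auto simp: \<epsilon>_def field_simps)
  have "\<exists>Y<top. \<forall>u\<in>borel_measurable lebesgue.
      lorentz_integral P \<rho> (source M q S W u) \<le> ennreal \<epsilon> * lorentz_integral p \<rho> u + Y"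
    by (rule lorentz_integral_source_le[of M S W q P p e]) (use S W q e \<rho> fin \<epsilon> in auto)
  then obtain Y where Y: "Y < top" and src: "\<And>u. u \<in> borel_measurable lebesgue \<Longrightarrow>
      lorentz_integral P \<rho> (source M q S W u) \<le> ennreal \<epsilon> * lorentz_integral p \<rho> u + Y"
    by blast
  have "lorentz_integral p \<rho> u \<le> 2 * (ennreal C * Y)"
    if [measurable]: "u \<in> borel_measurable lebesgue" "F \<in> borel_measurable lebesgue"
      and F: "\<forall>y. F y \<le> source M q S W u y" and u: "lorentz_integral p \<rho> u < top" "u = potential \<alpha> F" for u F
  proof -
    obtain L where L: "lorentz_integral p \<rho> u = ennreal L" "0 \<le> L"
      using u(1) by (cases "lorentz_integral p \<rho> u") auto
    obtain Z where Z: "Y = ennreal Z" "0 \<le> Z"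
      using Y by (cases Y) auto
    have "lorentz_integral p \<rho> u \<le> ennreal C * lorentz_integral P \<rho> F"
      unfolding u(2) by (rule pot) measurable
    also have "\<dots> \<le> ennreal C * lorentz_integral P \<rho> (source M q S W u)"
      using F \<rho> by (intro mult_left_mono lorentz_integral_mono) auto
    also have "\<dots> \<le> ennreal C * (ennreal \<epsilon> * lorentz_integral p \<rho> u + Y)"
      by (intro mult_left_mono src) auto
    finally have "L \<le> C * (\<epsilon> * L + Z)"
      using L Z C \<epsilon> by (simp flip: ennreal_mult ennreal_plus)
    also have "\<dots> = (C * \<epsilon>) * L + C * Z"
      by (simp add: algebra_simps)
    also have "\<dots> \<le> 1 / 2 * L + C * Z"
      using \<epsilon> L by (intro add_right_mono mult_right_mono) auto
    finally have "L \<le> 2 * (C * Z)"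
      by simp
    then have "ennreal L \<le> ennreal (2 * (C * Z))"
      by (rule ennreal_leI)
    then show ?thesis
      using L Z C by (simp add: ennreal_mult)
  qed
  moreover have "2 * (ennreal C * Y) < top"
    using Y by (simp add: ennreal_mult_less_top)
  ultimately show ?thesis
    by blast
qed

section \<open>The truncated problem\<close>

text \<open>Sublinearity in quantitative form: for \<open>t\<close> at most 1, t^Q is a common lower
  bound for all t^(q_i) and for the factor 1 in front of \<open>W\<close>. Both barriers and the
  comparison argument use it.\<close>

lemma source_scale:
  assumes "\<And>i. i \<in> {1..M} \<Longrightarrow> q i \<le> Q" "0 \<le> Q" "0 < t" "t \<le> 1"
  shows "ennreal (t powr Q) * source M q S W u y \<le> source M q S W (\<lambda>y. ennreal t * u y) y"
proof -
  have "ennreal (t powr Q) * (S i y * enn_powr (u y) (q i)) \<le> S i y * enn_powr (ennreal t * u y) (q i)"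
    if "i \<in> {1..M}" for i
  proof -
    have "t powr Q \<le> t powr q i"
      using assms that by (intro powr_mono') auto
    then have "ennreal (t powr Q) * (S i y * enn_powr (u y) (q i)) \<le>
        ennreal (t powr q i) * (S i y * enn_powr (u y) (q i))"
      by (intro mult_right_mono ennreal_leI) auto
    then show ?thesis
      using assms by (simp add: enn_powr_mult enn_powr_ennreal ac_simps)
  qed
  moreover have "ennreal (t powr Q) * W y \<le> W y"
    using assms mult_right_mono[of "ennreal (t powr Q)" 1 "W y"] by (simp add: powr_le1 ennreal_le_1)
  ultimately show ?thesis
    unfolding source_def distrib_left sum_distrib_left by (intro add_mono sum_mono)
qed

lemma SUP_mult_incseq_ennreal:
  fixes f g :: "nat \<Rightarrow> ennreal"
  assumes "incseq f" "incseq g"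
  shows "(SUP k. f k) * (SUP k. g k) = (SUP k. f k * g k)"
proof (rule order_antisym)
  have "f i * g j \<le> (SUP k. f k * g k)" for i j
    using assms by (intro order_trans[OF _ SUP_upper[of "max i j"]] mult_mono) (auto simp: incseq_def)
  then show "(SUP k. f k) * (SUP k. g k) \<le> (SUP k. f k * g k)"
    by (simp add: SUP_mult_left_ennreal SUP_mult_right_ennreal SUP_le_iff)
  show "(SUP k. f k * g k) \<le> (SUP k. f k) * (SUP k. g k)"
    by (intro SUP_least mult_mono SUP_upper) auto
qed

text \<open>Data and unknown may grow together, as they do along the truncated problems; constant
  data give the case needed for the iteration at a fixed truncation.\<close>

lemma source_SUP:
  assumes S: "\<And>i. i \<in> {1..M} \<Longrightarrow> incseq (\<lambda>k. S k i y)" and W: "incseq (\<lambda>k. W k y)" and u: "incseq (\<lambda>k. u k y)"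
    and q: "\<And>i. i \<in> {1..M} \<Longrightarrow> 0 < q i"
  shows "source M q (\<lambda>i y. SUP k. S k i y) (\<lambda>y. SUP k. W k y) (\<lambda>y. SUP k. u k y) y =
    (SUP k. source M q (S k) (W k) (u k) y)"
proof -
  have inc: "incseq (\<lambda>k. enn_powr (u k y) (q i))" if "i \<in> {1..M}" for i
    using u q[OF that] by (auto simp: incseq_def intro!: enn_powr_mono)
  have inc': "incseq (\<lambda>k. S k i y * enn_powr (u k y) (q i))" if "i \<in> {1..M}" for i
    using S[OF that] inc[OF that] by (auto simp: incseq_def intro!: mult_mono)
  have "(\<Sum>i = 1..M. (SUP k. S k i y) * enn_powr (SUP k. u k y) (q i)) =
      (\<Sum>i = 1..M. (SUP k. S k i y * enn_powr (u k y) (q i)))"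
    using S inc q by (intro sum.cong refl) (simp add: enn_powr_SUP SUP_mult_incseq_ennreal)
  also have "\<dots> = (SUP k. \<Sum>i = 1..M. S k i y * enn_powr (u k y) (q i))"
    using inc' by (intro ennreal_SUP_sum[symmetric]) auto
  finally have "source M q (\<lambda>i y. SUP k. S k i y) (\<lambda>y. SUP k. W k y) (\<lambda>y. SUP k. u k y) y =
      (SUP k. \<Sum>i = 1..M. S k i y * enn_powr (u k y) (q i)) + (SUP k. W k y)"
    by (simp add: source_def)
  also have "\<dots> = (SUP k. source M q (S k) (W k) (u k) y)"
    unfolding source_def using W inc'
    by (intro ennreal_SUP_add[symmetric]) (auto simp: incseq_def intro!: sum_mono)
  finally show ?thesis .
qed

lemma source_bounded_support:
  assumes S: "\<And>i. i \<in> {1..M} \<Longrightarrow> S i y \<le> B * indicator E y" and W: "W y \<le> B * indicator E y"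
    and u: "u y \<le> K" and q: "\<And>i. i \<in> {1..M} \<Longrightarrow> 0 < q i"
  shows "source M q S W u y \<le> ((\<Sum>i = 1..M. B * enn_powr K (q i)) + B) * indicator E y"
proof -
  have "source M q S W u y \<le> (\<Sum>i = 1..M. (B * indicator E y) * enn_powr K (q i)) + B * indicator E y"
    unfolding source_def using S W u q by (intro add_mono sum_mono mult_mono enn_powr_mono) (auto simp: less_imp_le)
  also have "\<dots> = ((\<Sum>i = 1..M. B * enn_powr K (q i)) + B) * indicator E y"
    by (cases "y \<in> E") simp_all
  finally show ?thesis .
qed

definition truncate_fun :: "nat \<Rightarrow> ('a::euclidean_space \<Rightarrow> ennreal) \<Rightarrow> 'a \<Rightarrow> ennreal" where
  "truncate_fun m f x = min (f x) (of_nat m) * indicator (ball 0 (real m)) x"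

lemma truncate_fun_measurable [measurable]:
  assumes [measurable]: "f \<in> borel_measurable lebesgue"
  shows "truncate_fun m f \<in> borel_measurable lebesgue"
proof -
  have [measurable]: "ball 0 (real m) \<in> sets (lebesgue :: 'a measure)"
    by simp
  show ?thesis
    unfolding truncate_fun_def by measurable
qed

lemma truncate_fun_le: "truncate_fun m f x \<le> f x"
  by (cases "x \<in> ball 0 (real m)") (auto simp: truncate_fun_def)

lemma truncate_fun_le_indicator: "truncate_fun m f x \<le> of_nat m * indicator (ball 0 (real m)) x"
  by (cases "x \<in> ball 0 (real m)") (auto simp: truncate_fun_def)

lemma truncate_fun_mono: "m \<le> k \<Longrightarrow> truncate_fun m f x \<le> truncate_fun k f x"
  unfolding truncate_fun_def
  by (intro mult_mono min.mono) (auto simp: indicator_def)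

text \<open>The shift \<open>m0\<close> lets the sequence start at a truncation whose data are not
  zero almost everywhere.\<close>

lemma incseq_truncate_fun: "incseq (\<lambda>m. truncate_fun (m0 + m) f x)"
  by (auto simp: incseq_def intro: truncate_fun_mono)

lemma SUP_truncate_fun: "(SUP m. truncate_fun (m0 + m) f x) = f x"
proof (rule order_antisym)
  show "(SUP m. truncate_fun (m0 + m) f x) \<le> f x"
    by (intro SUP_least truncate_fun_le)
  show "f x \<le> (SUP m. truncate_fun (m0 + m) f x)"
  proof (rule dense_le)
    fix y assume y: "y < f x"
    then have "y < top"
      by (rule less_le_trans) simp
    then obtain k where k: "y < of_nat k"
      using ennreal_Ex_less_of_nat by blast
    obtain l where l: "norm x < real l"
      using reals_Archimedean2 by blast
    have "y \<le> truncate_fun (m0 + (k + l)) f x"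
    proof -
      have "of_nat k \<le> (of_nat (m0 + (k + l)) :: ennreal)"
        by (intro of_nat_mono) simp
      then have "y \<le> min (f x) (of_nat (m0 + (k + l)))"
        using y order.strict_trans2[OF k] by (simp only: min.bounded_iff less_imp_le)
      moreover have "x \<in> ball 0 (real (m0 + (k + l)))"
        using l by simp
      ultimately show ?thesis
        unfolding truncate_fun_def by simp
    qed
    also have "\<dots> \<le> (SUP m. truncate_fun (m0 + m) f x)"
      by (rule SUP_upper) simp
    finally show "y \<le> (SUP m. truncate_fun (m0 + m) f x)" .
  qed
qed

text \<open>Takes the place of a strong maximum principle: mass located anywhere makes the potential
  bounded below on every ball.\<close>

lemma potential_pos_on_ball:
  fixes F :: "'a::euclidean_space \<Rightarrow> ennreal"
  assumes F [measurable]: "F \<in> borel_measurable lebesgue" and pos: "(\<integral>\<^sup>+ x. F x \<partial>lebesgue) \<noteq> 0"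
    and \<alpha>: "0 < \<alpha>" "\<alpha> < real DIM('a)"
  shows "\<exists>c>0. \<forall>x\<in>ball 0 R. c \<le> potential \<alpha> F x"
proof -
  have [measurable]: "ball 0 (real m) \<in> sets (lebesgue :: 'a measure)" for m
    by simp
  have SUP: "(SUP m. F x * indicator (ball 0 (real m)) x) = F x" for x
  proof -
    obtain l where "norm x < real l"
      using reals_Archimedean2 by blast
    then have "F x \<le> F x * indicator (ball 0 (real l)) x"
      by simp
    also have "\<dots> \<le> (SUP m. F x * indicator (ball 0 (real m)) x)"
      by (rule SUP_upper) simp
    finally show ?thesis
      by (intro order_antisym SUP_least) (auto simp: indicator_def)
  qed
  have inc: "incseq (\<lambda>m x. F x * indicator (ball 0 (real m)) x)"
    by (auto simp: incseq_def le_fun_def indicator_def)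
  have "(\<integral>\<^sup>+ x. F x \<partial>lebesgue) = (SUP m. (\<integral>\<^sup>+ x \<in> ball 0 (real m). F x \<partial>lebesgue))"
    using nn_integral_monotone_convergence_SUP[OF inc, of lebesgue] by (simp add: SUP)
  with pos have "0 < (SUP m. (\<integral>\<^sup>+ x \<in> ball 0 (real m). F x \<partial>lebesgue))"
    by (simp add: zero_less_iff_neq_zero)
  then obtain m where m: "0 < (\<integral>\<^sup>+ x \<in> ball 0 (real m). F x \<partial>lebesgue)"
    by (auto simp: less_SUP_iff)
  \<comment> \<open>Large enough to carry mass of \<open>F\<close>, to contain the given ball, and
    to be positive, as the formula for the kernel at \<open>2 * r\<close> requires.\<close>
  define r where "r = max (real m) (max R 1)"
  have "(\<integral>\<^sup>+ x \<in> ball 0 (real m). F x \<partial>lebesgue) \<le> (\<integral>\<^sup>+ x \<in> ball 0 r. F x \<partial>lebesgue)"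
    by (intro nn_integral_mono) (auto simp: indicator_def r_def)
  with m have "0 < (\<integral>\<^sup>+ x \<in> ball 0 r. F x \<partial>lebesgue)"
    by (rule less_le_trans)
  moreover have "0 < riesz_kernel DIM('a) \<alpha> (2 * r)"
    using \<alpha> by (simp add: riesz_kernel_eq riesz_const_pos r_def)
  ultimately have "0 < riesz_kernel DIM('a) \<alpha> (2 * r) * (\<integral>\<^sup>+ x \<in> ball 0 r. F x \<partial>lebesgue)"
    by (simp add: ennreal_zero_less_mult_iff)
  moreover have "ball 0 R \<subseteq> (ball 0 r :: 'a set)"
    by (auto simp: r_def)
  ultimately show ?thesis
    using potential_ge_on_ball[OF F, of _ r \<alpha>] by (meson subsetD)
qed

text \<open>When \<open>W = 0\<close>, iterating from 0 would only return 0, hence the positive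
  subsolution as starting point. Monotone iteration and monotone convergence then need no
  compactness.\<close>

lemma bounded_solution_exists:
  fixes S :: "nat \<Rightarrow> 'a::euclidean_space \<Rightarrow> ennreal" and W :: "'a \<Rightarrow> ennreal"
  assumes \<alpha>: "0 < \<alpha>" "\<alpha> < real DIM('a)"
    and Sm: "\<And>i. i \<in> {1..M} \<Longrightarrow> S i \<in> borel_measurable lebesgue" and Wm: "W \<in> borel_measurable lebesgue"
    and q: "\<And>i. i \<in> {1..M} \<Longrightarrow> 0 < q i \<and> q i \<le> Q" and Q: "0 < Q" "Q < 1"
    and S: "\<And>i y. i \<in> {1..M} \<Longrightarrow> S i y \<le> B * indicator (ball 0 R) y"
    and W: "\<And>y. W y \<le> B * indicator (ball 0 R) y" and B: "B < top"
    and pos: "(\<integral>\<^sup>+ y. source M q S W (\<lambda>_. 1) y \<partial>lebesgue) \<noteq> 0"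
  shows "\<exists>u K c. u \<in> borel_measurable lebesgue \<and> (\<forall>x. u x = potential \<alpha> (source M q S W u) x) \<and>
    K < top \<and> (\<forall>x. u x \<le> K) \<and> 0 < c \<and> (\<forall>x\<in>ball 0 R. c \<le> u x)"
proof -
  define T where "T u = potential \<alpha> (source M q S W u)" for u
  have srcm: "source M q S W u \<in> borel_measurable lebesgue" if "u \<in> borel_measurable lebesgue" for u
    using Sm Wm that by measurable
  have Tm: "T u \<in> borel_measurable lebesgue" if "u \<in> borel_measurable lebesgue" for u
    unfolding T_def using srcm[OF that] by (rule potential_measurable)
  have T_mono: "T u x \<le> T v x" if "u \<in> borel_measurable lebesgue" "v \<in> borel_measurable lebesgue"
      "\<And>y. u y \<le> v y" for u v x
    unfolding T_def using that q by (intro potential_mono srcm source_mono) (auto simp: less_imp_le)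
  let ?g = "source M q S W (\<lambda>_. 1)"
  have gm: "?g \<in> borel_measurable lebesgue"
    by (rule srcm) simp
  have ballm [measurable]: "ball 0 R \<in> sets (lebesgue :: 'a measure)"
    by simp
  obtain m where m: "emeasure lebesgue (ball 0 R :: 'a set) = ennreal m" "0 \<le> m"
    using emeasure_lborel_ball_finite[of "0 :: 'a" R]
    by (cases "emeasure lebesgue (ball 0 R :: 'a set)") (auto simp: emeasure_completion)
  have "\<exists>d\<ge>0. \<forall>x. T (\<lambda>_. 1) x \<le> ennreal d"
  proof -
    define L where "L = (\<Sum>i = 1..M. B * enn_powr 1 (q i)) + B"
    have "L < top"
      unfolding L_def using B by (simp add: ennreal_mult_less_top of_nat_less_top)
    define D where "D = L * ennreal (sup_const DIM('a) \<alpha> * (real DIM('a) / \<alpha>) * m powr (\<alpha> / real DIM('a)))"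
    have "T (\<lambda>_. 1) x \<le> D" for x
      unfolding T_def D_def
    proof (rule potential_bounded_support[OF gm ballm])
      show "?g y \<le> L * indicator (ball 0 R) y" for y
        unfolding L_def by (rule source_bounded_support) (use S W q in auto)
    qed (use m \<alpha> in auto)
    moreover have "D < top"
      unfolding D_def using \<open>L < top\<close> by (simp add: ennreal_mult_less_top)
    then obtain d where "D = ennreal d" "0 \<le> d"
      by (cases D) auto
    ultimately show ?thesis
      by blast
  qed
  then obtain d where d: "0 \<le> d" "\<And>x. T (\<lambda>_. 1) x \<le> ennreal d"
    by blast
  \<comment> \<open>Solves d K^Q \<le> K, that is K^(1-Q) \<ge> d. The maximum with 1 makes
    \<open>1 / K\<close> an admissible factor in \<open>source_scale\<close>.\<close>
  define K where "K = max 1 (d powr (1 / (1 - Q)))"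
  have K: "1 \<le> K"
    by (simp add: K_def)
  have "d = (d powr (1 / (1 - Q))) powr (1 - Q)"
    using d Q by (simp add: powr_powr)
  also have "\<dots> \<le> K powr (1 - Q)"
    using Q by (intro powr_mono2) (auto simp: K_def)
  finally have dK: "d * K powr Q \<le> K"
    using K mult_right_mono[of d "K powr (1 - Q)" "K powr Q"] by (simp flip: powr_add)
  have TK: "T (\<lambda>_. ennreal K) x \<le> ennreal K" for x
  proof -
    have "source M q S W (\<lambda>_. ennreal K) y \<le> ennreal (K powr Q) * ?g y" for y
    proof -
      \<comment> \<open>\<open>source_scale\<close> run backwards: scaling the constant
        \<open>K\<close> down to 1 bounds its source by K^Q times that of the constant 1.\<close>
      have "ennreal ((1 / K) powr Q) * source M q S W (\<lambda>_. ennreal K) y \<le>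
          source M q S W (\<lambda>_. ennreal (1 / K) * ennreal K) y"
        using source_scale[of M q Q "1 / K" S W "\<lambda>_. ennreal K" y] q Q K by auto
      also have "ennreal (1 / K) * ennreal K = 1"
        using K by (simp flip: ennreal_mult)
      finally have "ennreal (K powr Q) * (ennreal ((1 / K) powr Q) * source M q S W (\<lambda>_. ennreal K) y) \<le>
          ennreal (K powr Q) * ?g y"
        by (rule mult_left_mono) simp
      also have "ennreal (K powr Q) * (ennreal ((1 / K) powr Q) * source M q S W (\<lambda>_. ennreal K) y) =
          source M q S W (\<lambda>_. ennreal K) y"
        using K by (simp add: powr_divide flip: mult.assoc ennreal_mult)
      finally show ?thesis .
    qed
    then have "T (\<lambda>_. ennreal K) x \<le> potential \<alpha> (\<lambda>y. ennreal (K powr Q) * ?g y) x"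
      unfolding T_def using gm by (intro potential_mono srcm) auto
    also have "\<dots> = ennreal (K powr Q) * T (\<lambda>_. 1) x"
      unfolding T_def by (rule potential_cmult) (rule gm)
    also have "\<dots> \<le> ennreal (K powr Q) * ennreal d"
      by (intro mult_left_mono d) simp
    also have "\<dots> \<le> ennreal K"
      using dK d by (simp add: mult.commute ennreal_leI flip: ennreal_mult)
    finally show ?thesis .
  qed
  obtain c0 where c0: "0 < c0" "\<And>x. x \<in> ball 0 R \<Longrightarrow> c0 \<le> T (\<lambda>_. 1) x"
    unfolding T_def using potential_pos_on_ball[OF gm pos \<alpha>, of R] by auto
  obtain c where c: "0 < c" "\<And>x. x \<in> ball 0 R \<Longrightarrow> ennreal c \<le> T (\<lambda>_. 1) x"
  proof (cases c0)
    case (real r)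
    then show ?thesis
      using that[of r] c0 by auto
  next
    case top
    then show ?thesis
      using that[of 1] c0 by (auto simp: top_unique)
  qed
  \<comment> \<open>Solves \<epsilon> \<le> \<epsilon>^Q c, that is \<epsilon>^(1-Q) \<le> c; capped
    at 1 for \<open>source_scale\<close>.\<close>
  define \<epsilon> where "\<epsilon> = min 1 (c powr (1 / (1 - Q)))"
  have \<epsilon>: "0 < \<epsilon>" "\<epsilon> \<le> 1"
    using c by (auto simp: \<epsilon>_def)
  have "\<epsilon> powr (1 - Q) \<le> (c powr (1 / (1 - Q))) powr (1 - Q)"
    using Q \<epsilon> by (intro powr_mono2) (auto simp: \<epsilon>_def)
  also have "\<dots> = c"
    using c Q by (simp add: powr_powr)
  finally have \<epsilon>c: "\<epsilon> \<le> \<epsilon> powr Q * c"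
    using \<epsilon> mult_left_mono[of "\<epsilon> powr (1 - Q)" c "\<epsilon> powr Q"] by (simp flip: powr_add)
  define u0 where "u0 y = ennreal \<epsilon> * indicator (ball 0 R) y" for y :: 'a
  have u0m [measurable]: "u0 \<in> borel_measurable lebesgue"
    unfolding u0_def by measurable
  have u0: "u0 x \<le> T u0 x" for x
  proof (cases "x \<in> ball 0 R")
    case True
    \<comment> \<open>Both sources vanish off the ball, so the constant 1 may be replaced there by
      the indicator.\<close>
    have "?g y \<le> source M q S W (indicator (ball 0 R)) y" for y
    proof (cases "y \<in> ball 0 R")
      case True
      then show ?thesis by (simp add: source_def)
    next
      case False
      then have "S i y = 0" if "i \<in> {1..M}" for i
        using S[OF that, of y] by simp
      moreover have "W y = 0"
        using W[of y] False by simp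
      ultimately show ?thesis
        by (simp add: source_def)
    qed
    then have "ennreal (\<epsilon> powr Q) * ?g y \<le> source M q S W u0 y" for y
      using source_scale[of M q Q \<epsilon> S W "indicator (ball 0 R)" y] q Q \<epsilon> unfolding u0_def[abs_def]
      by (meson less_imp_le mult_left_mono order_trans zero_le)
    then have "potential \<alpha> (\<lambda>y. ennreal (\<epsilon> powr Q) * ?g y) x \<le> T u0 x"
      unfolding T_def using gm by (intro potential_mono srcm u0m) auto
    moreover have "potential \<alpha> (\<lambda>y. ennreal (\<epsilon> powr Q) * ?g y) x = ennreal (\<epsilon> powr Q) * T (\<lambda>_. 1) x"
      unfolding T_def by (rule potential_cmult) (rule gm)
    moreover have "ennreal \<epsilon> \<le> ennreal (\<epsilon> powr Q) * T (\<lambda>_. 1) x"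
    proof -
      have "ennreal \<epsilon> \<le> ennreal (\<epsilon> powr Q) * ennreal c"
        using \<epsilon>c c by (simp add: ennreal_leI flip: ennreal_mult)
      also have "\<dots> \<le> ennreal (\<epsilon> powr Q) * T (\<lambda>_. 1) x"
        using c(2) True by (intro mult_left_mono) auto
      finally show ?thesis .
    qed
    ultimately show ?thesis
      using True by (simp add: u0_def)
  qed (simp add: u0_def)
  define U where "U k = (T ^^ k) u0" for k
  have U_simps: "U 0 = u0" "\<And>k. U (Suc k) = T (U k)"
    by (simp_all add: U_def)
  have Um: "U k \<in> borel_measurable lebesgue" for k
    by (induction k) (simp_all add: U_simps u0m Tm)
  have U_Suc: "U k x \<le> U (Suc k) x" for k x
  proof (induction k arbitrary: x)
    case 0
    then show ?case by (simp add: U_simps u0)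
  next
    case (Suc k)
    then show ?case
      using T_mono[OF Um Um, of k "Suc k" x] by (simp add: U_simps)
  qed
  then have inc: "incseq U"
    by (intro incseq_SucI) (simp add: le_fun_def)
  have U_le: "U k x \<le> ennreal K" for k x
  proof (induction k arbitrary: x)
    case 0
    have "u0 x \<le> ennreal \<epsilon>"
      by (auto simp: u0_def indicator_def)
    also have "\<dots> \<le> ennreal K"
      using \<epsilon> K by (intro ennreal_leI) simp
    finally show ?case by (simp add: U_simps)
  next
    case (Suc k)
    have "T (U k) x \<le> T (\<lambda>_. ennreal K) x"
      by (intro T_mono Um Suc) simp
    also have "\<dots> \<le> ennreal K"
      by (rule TK)
    finally show ?case by (simp add: U_simps)
  qed
  define u where "u x = (SUP k. U k x)" for x
  have um: "u \<in> borel_measurable lebesgue"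
    unfolding u_def using Um by measurable
  have "u x = T u x" for x
  proof -
    have "source M q S W u = (\<lambda>y. SUP k. source M q S W (U k) y)"
    proof
      fix y
      have "incseq (\<lambda>k. U k y)"
        using inc by (auto simp: incseq_def le_fun_def)
      then show "source M q S W u y = (SUP k. source M q S W (U k) y)"
        using source_SUP[of M "\<lambda>k. S" y "\<lambda>k. W" U q] q by (simp add: u_def[abs_def])
    qed
    moreover have "incseq (\<lambda>k. source M q S W (U k))"
      using inc q by (auto simp: incseq_def le_fun_def less_imp_le intro!: source_mono)
    ultimately have "T u x = (SUP k. T (U k) x)"
      unfolding T_def using potential_SUP[of "\<lambda>k. source M q S W (U k)" \<alpha> x] srcm[OF Um] by simp
    also have "\<dots> = (SUP k. U (Suc k) x)"
      by (simp add: U_simps)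
    also have "\<dots> = u x"
      unfolding u_def
      by (intro order_antisym SUP_least) (auto intro: SUP_upper SUP_upper2 U_Suc)
    finally show ?thesis ..
  qed
  moreover have "ennreal \<epsilon> \<le> u x" if "x \<in> ball 0 R" for x
    using SUP_upper[of 0 UNIV "\<lambda>k. U k x"] that by (simp add: u_def U_simps u0_def)
  moreover have "u x \<le> ennreal K" for x
    unfolding u_def by (intro SUP_least U_le)
  ultimately show ?thesis
    using um \<epsilon> unfolding T_def
    by (intro exI[of _ u] exI[of _ "ennreal K"] exI[of _ "ennreal \<epsilon>"]) auto
qed

text \<open>The data vanish off \<open>E\<close>, so an inequality on \<open>E\<close> alone yields,
  after one application of the potential, an inequality everywhere with the better factor t^Q. A
  first positive factor exists because \<open>u\<close> is bounded and \<open>v\<close> is bounded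
  below on \<open>E\<close>.\<close>

lemma bounded_solution_le_supersolution:
  fixes S :: "nat \<Rightarrow> 'a::euclidean_space \<Rightarrow> ennreal" and W :: "'a \<Rightarrow> ennreal"
  assumes Sm: "\<And>i. i \<in> {1..M} \<Longrightarrow> S i \<in> borel_measurable lebesgue" and Wm: "W \<in> borel_measurable lebesgue"
    and q: "\<And>i. i \<in> {1..M} \<Longrightarrow> 0 < q i \<and> q i \<le> Q" and Q: "0 < Q" "Q < 1"
    and S: "\<And>i y. i \<in> {1..M} \<Longrightarrow> y \<notin> E \<Longrightarrow> S i y = 0"
    and W: "\<And>y. y \<notin> E \<Longrightarrow> W y = 0"
    and u: "u \<in> borel_measurable lebesgue" "\<And>x. u x = potential \<alpha> (source M q S W u) x" "\<And>x. u x \<le> K" "K < top"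
    and v: "v \<in> borel_measurable lebesgue" "\<And>x. potential \<alpha> (source M q S W v) x \<le> v x"
    and c: "0 < c" "\<And>x. x \<in> E \<Longrightarrow> c \<le> v x"
  shows "u x \<le> v x"
proof -
  have srcm: "source M q S W u \<in> borel_measurable lebesgue" if "u \<in> borel_measurable lebesgue" for u
    using Sm Wm that by measurable
  have step: "ennreal (t powr Q) * u x \<le> v x"
    if t: "0 < t" "t \<le> 1" and le: "\<And>x. x \<in> E \<Longrightarrow> ennreal t * u x \<le> v x" for t x
  proof -
    have "ennreal (t powr Q) * source M q S W u y \<le> source M q S W v y" for y
    proof -
      have "ennreal (t powr Q) * source M q S W u y \<le> source M q S W (\<lambda>y. ennreal t * u y) y"
        using q Q t by (intro source_scale) auto
      also have "\<dots> \<le> source M q S W v y"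
      proof (cases "y \<in> E")
        case True
        then show ?thesis
          using le q by (intro source_mono) (auto simp: less_imp_le)
      next
        case False
        then show ?thesis
          using S W by (simp add: source_def)
      qed
      finally show ?thesis .
    qed
    then have "potential \<alpha> (\<lambda>y. ennreal (t powr Q) * source M q S W u y) x \<le> potential \<alpha> (source M q S W v) x"
      using srcm u v by (intro potential_mono) auto
    then have "ennreal (t powr Q) * potential \<alpha> (source M q S W u) x \<le> potential \<alpha> (source M q S W v) x"
      using srcm u by (simp add: potential_cmult)
    also note v(2)[of x]
    finally show ?thesis
      using u(2)[of x] by simp
  qed
  obtain k where k: "K = ennreal k" "0 \<le> k"
    using u(4) by (cases K) auto
  obtain c' where c': "0 < c'" "ennreal c' \<le> c"
  proof (cases c)
    case (real r)
    then show ?thesis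
      using that[of r] c by auto
  next
    case top
    then show ?thesis
      using that[of 1] by auto
  qed
  \<comment> \<open>Then t u \<le> c' k / (k + 1) \<le> c' on \<open>E\<close>; the added 1 covers
    \<open>k = 0\<close>.\<close>
  define t where "t = min 1 (c' / (k + 1))"
  have t: "0 < t" "t \<le> 1"
    using c' k by (auto simp: t_def)
  have base: "ennreal t * u x \<le> v x" if "x \<in> E" for x
  proof -
    have "ennreal t * u x \<le> ennreal (c' / (k + 1)) * ennreal k"
      using u(3)[of x] k by (intro mult_mono ennreal_leI) (auto simp: t_def)
    also have "\<dots> \<le> ennreal c'"
      using c' k by (auto simp: field_simps intro!: ennreal_leI simp flip: ennreal_mult)
    also have "\<dots> \<le> v x"
      using c'(2) c(2)[OF that] by (rule order_trans)
    finally show ?thesis .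
  qed
  have iter: "ennreal (t powr (Q ^ Suc j)) * u x \<le> v x" for j x
  proof (induction j arbitrary: x)
    case 0
    then show ?case
      using step[OF t base] by simp
  next
    case (Suc j)
    have "t powr (Q ^ Suc j) \<le> 1"
      using t Q by (intro powr_le1) auto
    then have "ennreal ((t powr (Q ^ Suc j)) powr Q) * u x \<le> v x"
      using t Suc by (intro step) auto
    then show ?case
      by (simp add: powr_powr mult.commute mult.left_commute)
  qed
  show ?thesis
  proof (cases "v x")
    case (real s)
    have "u x < top"
      using u(3)[of x] u(4) by (rule le_less_trans)
    then obtain r where r: "u x = ennreal r" "0 \<le> r"
      by (cases "u x") auto
    have le: "t powr (Q ^ Suc j) * r \<le> s" for j
      using iter[of j x] r real by (simp flip: ennreal_mult)
    \<comment> \<open>As the exponents tend to 0, the factors t^(Q^j) tend to 1.\<close>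
    have "(\<lambda>j. Q ^ Suc j) \<longlonglongrightarrow> 0"
      using LIMSEQ_Suc[OF LIMSEQ_realpow_zero[of Q]] Q by simp
    then have "(\<lambda>j. t powr (Q ^ Suc j) * r) \<longlonglongrightarrow> t powr 0 * r"
      using t by (intro tendsto_intros) auto
    then have "t powr 0 * r \<le> s"
      using le by (intro LIMSEQ_le_const2) auto
    then show ?thesis
      using r real t by (simp add: ennreal_leI)
  qed simp
qed

section \<open>The minimal solution\<close>

lemma integral_rhs_density:
  assumes S: "\<And>i. i \<in> {1..M} \<Longrightarrow> S i \<in> borel_measurable lebesgue"
    and W [measurable]: "W \<in> borel_measurable lebesgue" and u [measurable]: "u \<in> borel_measurable lebesgue"
  shows "integral_rhs \<alpha> M q (\<lambda>i. density lebesgue (S i)) (density lebesgue W) u x =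
    potential \<alpha> (source M q S W u) x"
proof -
  have "riesz_potential \<alpha> (density (density lebesgue (S i)) (\<lambda>y. enn_powr (u y) (q i))) x =
      potential \<alpha> (\<lambda>y. S i y * enn_powr (u y) (q i)) x" if "i \<in> {1..M}" for i
    using S[OF that] by (simp add: potential_def density_density_eq)
  then have "integral_rhs \<alpha> M q (\<lambda>i. density lebesgue (S i)) (density lebesgue W) u x =
      (\<Sum>i = 1..M. potential \<alpha> (\<lambda>y. S i y * enn_powr (u y) (q i)) x) + potential \<alpha> W x"
    by (simp add: integral_rhs_def potential_def)
  also have "\<dots> = potential \<alpha> (\<lambda>y. \<Sum>i = 1..M. S i y * enn_powr (u y) (q i)) x + potential \<alpha> W x"
    using S by (subst potential_sum) auto
  also have "\<dots> = potential \<alpha> (\<lambda>y. (\<Sum>i = 1..M. S i y * enn_powr (u y) (q i)) + W y) x"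
    using S by (intro potential_add[symmetric]) auto
  finally show ?thesis
    by (simp add: source_def[abs_def])
qed

text \<open>A positive lower limit would place the complement of a ball inside a superlevel set,
  which has finite measure.\<close>

lemma Liminf_at_infinity_eq_0_if_lorentz:
  fixes u :: "'a::euclidean_space \<Rightarrow> ennreal"
  assumes u: "u \<in> borel_measurable lebesgue" and fin: "lorentz_integral p \<rho> u < top" and p: "0 < p" "0 < \<rho>"
  shows "Liminf at_infinity u = 0"
proof (rule ccontr)
  assume "Liminf at_infinity u \<noteq> 0"
  then obtain c where c: "0 < c" "c < Liminf at_infinity u"
    using dense[of 0 "Liminf at_infinity u"] by (auto simp: zero_less_iff_neq_zero)
  then have "eventually (\<lambda>x. c < u x) at_infinity"
    by (intro less_LiminfD)
  then obtain b where b: "\<And>x. b \<le> norm x \<Longrightarrow> c < u x"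
    by (auto simp: eventually_at_infinity)
  have "UNIV \<subseteq> {x. c < u x} \<union> ball 0 b"
  proof
    fix x :: 'a
    show "x \<in> {x. c < u x} \<union> ball 0 b"
      using b[of x] by (cases "b \<le> norm x") auto
  qed
  then have "emeasure lebesgue (UNIV :: 'a set) \<le> emeasure lebesgue ({x. c < u x} \<union> ball 0 b)"
    using u by (intro emeasure_mono) auto
  also have "\<dots> \<le> emeasure lebesgue {x. c < u x} + emeasure lebesgue (ball 0 b :: 'a set)"
    using u by (intro emeasure_subadditive) auto
  also have "\<dots> < top"
    using superlevel_finite_if_lorentz[OF u fin p c(1)] emeasure_lborel_ball_finite[of "0 :: 'a" b]
    by (simp add: emeasure_completion)
  finally show False
    by (simp add: emeasure_completion)
qed

text \<open>Exponents appear through their reciprocals, which makes the relations between them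
  affine. The conditions \<open>0 < p\<close> and \<open>P < 1\<close> are those for convergence in
  the Schur test, and \<open>P = p * q i + e i\<close> balances the weights in the nonlinear
  terms.\<close>

theorem minimal_solution_exists:
  fixes S :: "nat \<Rightarrow> 'a::euclidean_space \<Rightarrow> ennreal" and W :: "'a \<Rightarrow> ennreal"
  assumes \<alpha>: "0 < \<alpha>" "\<alpha> < real DIM('a)"
    and p: "0 < p" "P = p + \<alpha> / real DIM('a)" "P < 1" and \<rho>: "1 < \<rho>"
    and Sm: "\<And>i. i \<in> {1..M} \<Longrightarrow> S i \<in> borel_measurable lebesgue"
    and Wm: "W \<in> borel_measurable lebesgue"
    and q: "\<And>i. i \<in> {1..M} \<Longrightarrow> 0 < q i \<and> q i < 1"
    and e: "\<And>i. i \<in> {1..M} \<Longrightarrow> P = p * q i + e i"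
    and fin: "\<And>i. i \<in> {1..M} \<Longrightarrow> lorentz_integral (e i) (\<rho> / (1 - q i)) (S i) < top"
      "lorentz_integral P \<rho> W < top"
    and nz: "(\<exists>i\<in>{1..M}. \<not> (AE x in lebesgue. S i x = 0)) \<or> \<not> (AE x in lebesgue. W x = 0)"
  shows "\<exists>u. is_minimal_solution \<alpha> M q (\<lambda>i. density lebesgue (S i)) (density lebesgue W) u \<and>
    (\<forall>x. 0 < u x) \<and> u \<in> borel_measurable lebesgue \<and> lorentz_integral p \<rho> u < top"
proof -
  \<comment> \<open>The inserted 1/2 keeps the maximum over a nonempty set and \<open>Q\<close>
    positive.\<close>
  define Q where "Q = Max (insert (1 / 2) (q ` {1..M}))"
  have "Q \<in> insert (1 / 2) (q ` {1..M})"
    unfolding Q_def by (intro Max_in) auto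
  then have Q1: "Q < 1"
    using q by auto
  have "1 / 2 \<le> Q"
    unfolding Q_def by (intro Max_ge) auto
  then have Q: "0 < Q" "Q < 1"
    using Q1 by auto
  have qQ: "0 < q i \<and> q i \<le> Q" if "i \<in> {1..M}" for i
    using q[OF that] that unfolding Q_def by (intro conjI Max_ge) auto
  have srcm: "source M q S W u \<in> borel_measurable lebesgue" if "u \<in> borel_measurable lebesgue" for u
    using Sm Wm that by measurable
  define St where "St m i = truncate_fun m (S i)" for m i
  define Wt where "Wt m = truncate_fun m W" for m
  define src where "src m = source M q (St m) (Wt m)" for m
  have Stm: "St m i \<in> borel_measurable lebesgue" if "i \<in> {1..M}" for m i
    unfolding St_def using Sm[OF that] by (rule truncate_fun_measurable)
  have Wtm: "Wt m \<in> borel_measurable lebesgue" for m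
    unfolding Wt_def using Wm by (rule truncate_fun_measurable)
  have srctm: "src m u \<in> borel_measurable lebesgue" if "u \<in> borel_measurable lebesgue" for u m
    unfolding src_def using Stm Wtm that by (intro source_measurable) auto
  have src_le: "src m u y \<le> source M q S W u y" for m u y
    unfolding src_def using q by (intro source_mono) (auto simp: St_def Wt_def truncate_fun_le less_imp_le)
  have src_mono: "src m u y \<le> src k v y" if "m \<le> k" "u y \<le> v y" for m k u v y
    unfolding src_def using q that by (intro source_mono) (auto simp: St_def Wt_def truncate_fun_mono less_imp_le)
  have src_SUP: "source M q S W (\<lambda>y. SUP k. u k y) y = (SUP k. src (m0 + k) (u k) y)"
    if "incseq (\<lambda>k. u k y)" for u y m0
    using source_SUP[of M "\<lambda>k. St (m0 + k)" y "\<lambda>k. Wt (m0 + k)" u q] that q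
    by (simp add: src_def St_def Wt_def incseq_truncate_fun SUP_truncate_fun)
  have "(\<integral>\<^sup>+ y. source M q S W (\<lambda>_. 1) y \<partial>lebesgue) \<noteq> 0"
  proof
    assume "(\<integral>\<^sup>+ y. source M q S W (\<lambda>_. 1) y \<partial>lebesgue) = 0"
    then have ae: "AE y in lebesgue. source M q S W (\<lambda>_. 1) y = 0"
      using srcm[of "\<lambda>_. 1"] by (simp add: nn_integral_0_iff_AE)
    have "AE y in lebesgue. W y = 0"
      using ae by eventually_elim (simp add: source_def)
    moreover have "AE y in lebesgue. S i y = 0" if "i \<in> {1..M}" for i
      using ae by eventually_elim (use that in \<open>auto simp: source_def\<close>)
    ultimately show False
      using nz by blast
  qed
  moreover have "(\<integral>\<^sup>+ y. source M q S W (\<lambda>_. 1) y \<partial>lebesgue) = (SUP m. \<integral>\<^sup>+ y. src m (\<lambda>_. 1) y \<partial>lebesgue)"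
  proof -
    have "source M q S W (\<lambda>_. 1) = (\<lambda>y. SUP m. src m (\<lambda>_. 1) y)"
      using src_SUP[of "\<lambda>_ _. 1" _ 0] by (simp add: fun_eq_iff)
    moreover have "incseq (\<lambda>m. src m (\<lambda>_. 1))"
      by (auto simp: incseq_def le_fun_def intro: src_mono)
    ultimately show ?thesis
      using nn_integral_monotone_convergence_SUP[of "\<lambda>m. src m (\<lambda>_. 1)" lebesgue] srctm by simp
  qed
  ultimately have "0 < (SUP m. \<integral>\<^sup>+ y. src m (\<lambda>_. 1) y \<partial>lebesgue)"
    by (simp add: zero_less_iff_neq_zero)
  \<comment> \<open>The source at \<open>u = 1\<close> has positive integral by nontriviality of the
    data; monotone convergence hands this to some truncation, and to all later ones.\<close>
  then obtain m0 where m0: "0 < (\<integral>\<^sup>+ y. src m0 (\<lambda>_. 1) y \<partial>lebesgue)"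
    by (auto simp: less_SUP_iff)
  have pos: "(\<integral>\<^sup>+ y. src (m0 + k) (\<lambda>_. 1) y \<partial>lebesgue) \<noteq> 0" for k
  proof -
    have "(\<integral>\<^sup>+ y. src m0 (\<lambda>_. 1) y \<partial>lebesgue) \<le> (\<integral>\<^sup>+ y. src (m0 + k) (\<lambda>_. 1) y \<partial>lebesgue)"
      by (intro nn_integral_mono src_mono) auto
    with m0 show ?thesis
      by auto
  qed
  have St_le: "St m i y \<le> of_nat m * indicator (ball 0 (real m)) y" for m i y
    unfolding St_def by (rule truncate_fun_le_indicator)
  have Wt_le: "Wt m y \<le> of_nat m * indicator (ball 0 (real m)) y" for m y
    unfolding Wt_def by (rule truncate_fun_le_indicator)
  have "\<forall>k. \<exists>u K c. u \<in> borel_measurable lebesgue \<and> (\<forall>x. u x = potential \<alpha> (src (m0 + k) u) x) \<and>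
    K < top \<and> (\<forall>x. u x \<le> K) \<and> 0 < c \<and> (\<forall>x\<in>ball 0 (real (m0 + k)). c \<le> u x)"
    unfolding src_def
  proof (rule allI, rule bounded_solution_exists)
    fix k
    show "(\<integral>\<^sup>+ y. source M q (St (m0 + k)) (Wt (m0 + k)) (\<lambda>_. 1) y \<partial>lebesgue) \<noteq> 0"
      using pos[of k] by (simp add: src_def)
    show "St (m0 + k) i y \<le> of_nat (m0 + k) * indicator (ball 0 (real (m0 + k))) y" for i y
      by (rule St_le)
    show "Wt (m0 + k) y \<le> of_nat (m0 + k) * indicator (ball 0 (real (m0 + k))) y" for y
      by (rule Wt_le)
    show "of_nat (m0 + k) < (top :: ennreal)"
      by (rule of_nat_less_top)
  qed (use \<alpha> Stm Wtm qQ Q in auto)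
  then obtain U K c where U: "\<And>k. U k \<in> borel_measurable lebesgue" "\<And>k x. U k x = potential \<alpha> (src (m0 + k) (U k)) x"
    and K: "\<And>k. K k < top" "\<And>k x. U k x \<le> K k" and c: "\<And>k. 0 < c k" "\<And>k x. x \<in> ball 0 (real (m0 + k)) \<Longrightarrow> c k \<le> U k x"
    by metis
  \<comment> \<open>Used twice: with \<open>U (Suc k)\<close> for monotonicity in \<open>k\<close>,
    and with a supersolution \<open>v\<close> of the full problem for minimality.\<close>
  have compare: "U k x \<le> v x" if v: "v \<in> borel_measurable lebesgue" "\<And>x. potential \<alpha> (src (m0 + k) v) x \<le> v x"
      and d: "0 < d" "\<And>x. x \<in> ball 0 (real (m0 + k)) \<Longrightarrow> d \<le> v x" for k v d x
  proof (rule bounded_solution_le_supersolution[where E = "ball 0 (real (m0 + k))" and c = d and K = "K k" and u = "U k"])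
    show "U k x = potential \<alpha> (source M q (St (m0 + k)) (Wt (m0 + k)) (U k)) x" for x
      using U(2)[of k x] by (simp add: src_def)
    show "potential \<alpha> (source M q (St (m0 + k)) (Wt (m0 + k)) v) x \<le> v x" for x
      using v(2)[of x] by (simp add: src_def)
  qed (use Stm Wtm qQ Q St_def Wt_def U K v d in \<open>auto simp: truncate_fun_def\<close>)
  have U_Suc: "U k x \<le> U (Suc k) x" for k x
  proof (rule compare[OF U(1) _ c(1)])
    show "potential \<alpha> (src (m0 + k) (U (Suc k))) x \<le> U (Suc k) x" for x
      unfolding U(2)[of "Suc k" x] by (intro potential_mono srctm U(1) src_mono) auto
    show "c (Suc k) \<le> U (Suc k) x" if "x \<in> ball 0 (real (m0 + k))" for x
      using that by (intro c(2)) auto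
  qed
  then have inc: "incseq U"
    by (intro incseq_SucI) (simp add: le_fun_def)

  \<comment> \<open>The limit of the truncated solutions\<close>
  define u where "u x = (SUP k. U k x)" for x
  have um: "u \<in> borel_measurable lebesgue"
    unfolding u_def using U(1) by measurable
  have u_eq: "u x = potential \<alpha> (source M q S W u) x" for x
  proof -
    have incx: "incseq (\<lambda>k. U k y)" for y
      using inc by (auto simp: incseq_def le_fun_def)
    have "source M q S W u = (\<lambda>y. SUP k. src (m0 + k) (U k) y)"
      unfolding u_def[abs_def] using src_SUP[OF incx] by (rule ext)
    moreover have "incseq (\<lambda>k. src (m0 + k) (U k))"
      using incx by (auto simp: incseq_def le_fun_def intro!: src_mono)
    ultimately have "potential \<alpha> (source M q S W u) x = (SUP k. potential \<alpha> (src (m0 + k) (U k)) x)"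
      using potential_SUP[of "\<lambda>k. src (m0 + k) (U k)" \<alpha> x] srctm[OF U(1)] by simp
    then show ?thesis
      using U(2) by (simp add: u_def)
  qed

  \<comment> \<open>The uniform Lorentz bound\<close>
  have "\<exists>B<top. \<forall>u\<in>borel_measurable lebesgue. \<forall>F\<in>borel_measurable lebesgue.
    (\<forall>y. F y \<le> source M q S W u y) \<longrightarrow> lorentz_integral p \<rho> u < top \<longrightarrow> u = potential \<alpha> F \<longrightarrow>
    lorentz_integral p \<rho> u \<le> B"
    by (rule lorentz_a_priori_bound[of \<alpha> p P \<rho> M S W q e]) (use \<alpha> p \<rho> Sm Wm q e fin in auto)
  then obtain B where B: "B < top" and bound: "\<And>u F. u \<in> borel_measurable lebesgue \<Longrightarrow> F \<in> borel_measurable lebesgue \<Longrightarrow>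
      (\<And>y. F y \<le> source M q S W u y) \<Longrightarrow> lorentz_integral p \<rho> u < top \<Longrightarrow> u = potential \<alpha> F \<Longrightarrow>
      lorentz_integral p \<rho> u \<le> B"
    by blast
  \<comment> \<open>Qualitative only, with no uniformity in \<open>k\<close>: \<open>U k\<close> is
    bounded, so its truncated source is bounded with bounded support. This is the finiteness that
    the absorption presupposes.\<close>
  have U_fin: "lorentz_integral p \<rho> (U k) < top" for k
  proof -
    obtain C where pot: "\<And>f. f \<in> borel_measurable (lebesgue :: 'a measure) \<Longrightarrow>
        lorentz_integral p \<rho> (potential \<alpha> f) \<le> ennreal C * lorentz_integral P \<rho> f"
      using lorentz_integral_potential_le[OF \<alpha> p(1) _ \<rho>] p by auto
    define m where "m = m0 + k"
    obtain l where l: "emeasure lebesgue (ball 0 (real m) :: 'a set) = ennreal l" "0 \<le> l"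
      using emeasure_lborel_ball_finite[of "0 :: 'a" "real m"]
      by (cases "emeasure lebesgue (ball 0 (real m) :: 'a set)") (auto simp: emeasure_completion)
    have "lorentz_integral P \<rho> (src m (U k)) < top"
    proof (rule lorentz_integral_bounded_support[OF srctm[OF U(1)]])
      show "src m (U k) y \<le> ((\<Sum>i = 1..M. of_nat m * enn_powr (K k) (q i)) + of_nat m) * indicator (ball 0 (real m)) y" for y
        unfolding src_def by (rule source_bounded_support) (use St_le Wt_le K q in auto)
      show "(\<Sum>i = 1..M. of_nat m * enn_powr (K k) (q i)) + of_nat m < top"
        using K(1)[of k] by (simp add: ennreal_mult_less_top of_nat_less_top)
      show "0 < P"
        using p \<alpha> by (auto intro: add_pos_pos)
    qed (use l \<rho> in auto)
    moreover have "U k = potential \<alpha> (src m (U k))"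
      using U(2)[of k] by (auto simp: fun_eq_iff m_def)
    then have "lorentz_integral p \<rho> (U k) \<le> ennreal C * lorentz_integral P \<rho> (src m (U k))"
      using pot[OF srctm[OF U(1)], of m k] by simp
    ultimately show ?thesis
      by (auto simp: ennreal_mult_less_top intro: le_less_trans)
  qed
  have "lorentz_integral p \<rho> (U k) \<le> B" for k
  proof (rule bound[OF U(1) srctm[OF U(1)] src_le U_fin])
    show "U k = potential \<alpha> (src (m0 + k) (U k))"
      using U(2)[of k] by (auto simp: fun_eq_iff)
  qed
  then have "lorentz_integral p \<rho> u \<le> B"
    unfolding u_def[abs_def] using U(1) inc \<rho> by (simp add: lorentz_integral_SUP SUP_le_iff)
  then have u_fin: "lorentz_integral p \<rho> u < top"
    using B by (rule le_less_trans)
  \<comment> \<open>Here nothing is absorbed, so \<epsilon> = 1 will do: the source of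
    \<open>u\<close> inherits a finite Lorentz integral.\<close>
  have "\<exists>Y<top. \<forall>u\<in>borel_measurable lebesgue.
      lorentz_integral P \<rho> (source M q S W u) \<le> ennreal 1 * lorentz_integral p \<rho> u + Y"
    by (rule lorentz_integral_source_le[of M S W q P p e]) (use Sm Wm q e \<rho> fin in auto)
  then obtain Y where Y: "Y < top" "lorentz_integral P \<rho> (source M q S W u) \<le> lorentz_integral p \<rho> u + Y"
    using um by auto
  have "lorentz_integral p \<rho> u + Y < top"
    using Y(1) u_fin by simp
  with Y(2) have src_fin: "lorentz_integral P \<rho> (source M q S W u) < top"
    by (rule le_less_trans)
  have rhs: "integral_rhs \<alpha> M q (\<lambda>i. density lebesgue (S i)) (density lebesgue W) v x = potential \<alpha> (source M q S W v) x"
    if "v \<in> borel_measurable lebesgue" for v x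
    using Sm Wm that by (rule integral_rhs_density)
  \<comment> \<open>A potential that is nonzero at one point has a source that is not zero almost
    everywhere, hence a positive lower bound on every ball. This yields the positivity of
    \<open>u\<close>, and it is how the nontriviality of a supersolution enters.\<close>
  have pos_if: "\<exists>d>0. \<forall>x\<in>ball 0 R. d \<le> potential \<alpha> (source M q S W v) x"
    if "v \<in> borel_measurable lebesgue" "potential \<alpha> (source M q S W v) x0 \<noteq> 0" for v x0 R
  proof (rule potential_pos_on_ball[OF srcm[OF that(1)] _ \<alpha>], rule notI)
    assume "(\<integral>\<^sup>+ y. source M q S W v y \<partial>lebesgue) = 0"
    then have "AE y in lebesgue. source M q S W v y = 0"
      using srcm[OF that(1)] by (simp add: nn_integral_0_iff_AE)
    then have "(\<integral>\<^sup>+ y. source M q S W v y * riesz_kernel DIM('a) \<alpha> (dist x0 y) \<partial>lebesgue) = (\<integral>\<^sup>+ y. 0 \<partial>(lebesgue :: 'a measure))"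
      by (intro nn_integral_cong_AE) (auto elim: eventually_mono)
    then show False
      using that srcm by (simp add: potential_eq_kernel)
  qed
  \<comment> \<open>The ball of radius 0 is empty, so the truncation at 0 has no data. Knowing
    \<open>0 < m0\<close> places the origin in the first ball.\<close>
  have m0_pos: "0 < m0"
  proof (rule ccontr)
    assume "\<not> 0 < m0"
    then have "src m0 (\<lambda>_. 1) y = 0" for y
      by (simp add: src_def source_def St_def Wt_def truncate_fun_def)
    with m0 show False
      by simp
  qed
  have "0 < c 0"
    by (rule c)
  also have "c 0 \<le> U 0 0"
    using m0_pos by (intro c(2)) simp
  also have "\<dots> \<le> u 0"
    unfolding u_def by (rule SUP_upper) simp
  finally have u_nz: "potential \<alpha> (source M q S W u) 0 \<noteq> 0"
    using u_eq[of 0] by simp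
  have u_pos: "0 < u x" for x
  proof -
    obtain d where "0 < d" "\<forall>y\<in>ball 0 (norm x + 1). d \<le> potential \<alpha> (source M q S W u) y"
      using pos_if[OF um u_nz] by blast
    moreover have "x \<in> ball 0 (norm x + 1)"
      by simp
    ultimately show ?thesis
      using u_eq[of x] by (auto intro: less_le_trans)
  qed
  \<comment> \<open>Each term S_i u^(q_i) lies below the full source, which is integrable on sets of
    finite measure because \<open>P < 1\<close>.\<close>
  have u_loc: "u \<in> Lq_loc (q i) (density lebesgue (S i))" if i: "i \<in> {1..M}" for i
    unfolding Lq_loc_def
  proof (intro CollectI conjI allI impI)
    show "u \<in> borel_measurable (density lebesgue (S i))"
      using um by simp
    fix C :: "'a set" assume C: "compact C"
    then have Cm [measurable]: "C \<in> sets lebesgue"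
      by (simp add: borel_compact)
    note [measurable] = um Sm[OF i]
    have "(\<integral>\<^sup>+ x \<in> C. enn_powr (u x) (q i) \<partial>density lebesgue (S i)) =
        (\<integral>\<^sup>+ x. S i x * (enn_powr (u x) (q i) * indicator C x) \<partial>lebesgue)"
      by (intro nn_integral_density) measurable
    also have "\<dots> \<le> (\<integral>\<^sup>+ x \<in> C. source M q S W u x \<partial>lebesgue)"
    proof (intro nn_integral_mono)
      fix x
      have "S i x * enn_powr (u x) (q i) \<le> (\<Sum>i = 1..M. S i x * enn_powr (u x) (q i))"
        using i by (intro member_le_sum[of i _ "\<lambda>i. S i x * enn_powr (u x) (q i)"]) auto
      also have "\<dots> \<le> source M q S W u x"
        by (simp add: source_def)
      finally show "S i x * (enn_powr (u x) (q i) * indicator C x) \<le> source M q S W u x * indicator C x"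
        by (auto simp: indicator_def)
    qed
    also have "\<dots> < top"
    proof (rule nn_integral_finite_if_lorentz[OF srcm[OF um] src_fin p(3) _ Cm])
      show "emeasure lebesgue C < top"
        using emeasure_compact_finite[OF C] C by (simp add: emeasure_completion borel_compact)
    qed (use \<rho> in simp)
    finally show "(\<integral>\<^sup>+ x \<in> C. enn_powr (u x) (q i) \<partial>density lebesgue (S i)) < \<infinity>"
      by simp
  qed
  have "is_minimal_solution \<alpha> M q (\<lambda>i. density lebesgue (S i)) (density lebesgue W) u"
    unfolding is_minimal_solution_def
  proof (intro conjI allI impI)
    show "is_solution \<alpha> M q (\<lambda>i. density lebesgue (S i)) (density lebesgue W) u"
      unfolding is_solution_def using um u_loc u_eq rhs by auto
    show "nontrivial \<alpha> M q (\<lambda>i. density lebesgue (S i)) (density lebesgue W) u"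
      unfolding nontrivial_def using u_nz rhs[OF um] by auto
    fix v x
    assume "is_supersolution \<alpha> M q (\<lambda>i. density lebesgue (S i)) (density lebesgue W) v \<and>
      nontrivial \<alpha> M q (\<lambda>i. density lebesgue (S i)) (density lebesgue W) v"
    then have vm: "v \<in> borel_measurable lebesgue" and v: "\<And>x. potential \<alpha> (source M q S W v) x \<le> v x"
      and "\<exists>x. potential \<alpha> (source M q S W v) x \<noteq> 0"
      unfolding is_supersolution_def nontrivial_def using rhs by auto
    then obtain x0 where x0: "potential \<alpha> (source M q S W v) x0 \<noteq> 0"
      by blast
    \<comment> \<open>Truncation only lowers the source, so \<open>v\<close> is a supersolution of
      every truncated problem.\<close>
    have "U k x \<le> v x" for k
    proof -
      obtain d where d: "0 < d" "\<forall>x\<in>ball 0 (real (m0 + k)). d \<le> potential \<alpha> (source M q S W v) x"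
        using pos_if[OF vm x0] by blast
      show ?thesis
      proof (rule compare[OF vm _ d(1)])
        show "potential \<alpha> (src (m0 + k) v) x \<le> v x" for x
          using potential_mono[OF srctm[OF vm] srcm[OF vm] src_le, of \<alpha> "m0 + k" x] v[of x] by (rule order_trans)
        show "d \<le> v x" if "x \<in> ball 0 (real (m0 + k))" for x
          using d(2) that v[of x] by (auto intro: order_trans)
      qed
    qed
    then show "u x \<le> v x"
      unfolding u_def by (intro SUP_least)
  qed
  then show ?thesis
    using u_pos um u_fin by blast
qed

theorem corollary1p2:
  fixes \<alpha> \<gamma> :: real and n M :: nat and q :: "nat \<Rightarrow> real"
    and \<sigma> :: "nat \<Rightarrow> real ^ 'n \<Rightarrow> real" and \<omega> :: "real ^ 'n \<Rightarrow> real"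
  assumes "n = CARD('n)" and "n \<ge> 2" and "0 < \<alpha>" and "\<alpha> < real n" and "0 < \<gamma>" and "M \<ge> 1"
    and "\<forall>i\<in>{1..M}. 0 < q i \<and> q i < 1"
    and "\<forall>i\<in>{1..M}. \<forall>x. 0 \<le> \<sigma> i x" and "\<forall>x. 0 \<le> \<omega> x"
    and "(\<exists>i\<in>{1..M}. \<not> (AE x in lebesgue. \<sigma> i x = 0)) \<or> \<not> (AE x in lebesgue. \<omega> x = 0)"
    and "\<forall>i\<in>{1..M}. (\<lambda>x. ennreal (\<sigma> i x)) \<in>
           lorentz_space (real n * (\<gamma> + 1) / (real n * (1 - q i) + \<alpha> * (\<gamma> + q i))) ((\<gamma> + 1) / (1 - q i))"
    and "(\<lambda>x. ennreal (\<omega> x)) \<in> lorentz_space (real n * (\<gamma> + 1) / (real n + \<alpha> * \<gamma>)) (\<gamma> + 1)"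
  shows "\<exists>u :: real ^ 'n \<Rightarrow> ennreal.
           is_minimal_solution \<alpha> M q
             (\<lambda>i. density lebesgue (\<lambda>x. ennreal (\<sigma> i x))) (density lebesgue (\<lambda>x. ennreal (\<omega> x))) u \<and>
           (\<forall>x. 0 < u x) \<and>
           Liminf at_infinity u = 0 \<and>
           u \<in> lorentz_space (real n * (\<gamma> + 1) / (real n - \<alpha>)) (\<gamma> + 1)"
proof -
  \<comment> \<open>The reciprocals of r, of the first exponent of \<omega> and of the first
    exponents of the \<sigma>_i, over the common denominator n (\<gamma> + 1).\<close>
  define p where "p = (real n - \<alpha>) / (real n * (\<gamma> + 1))"
  define P where "P = (real n + \<alpha> * \<gamma>) / (real n * (\<gamma> + 1))"
  define e where "e i = (real n * (1 - q i) + \<alpha> * (\<gamma> + q i)) / (real n * (\<gamma> + 1))" for i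
  have n: "0 < real n"
    using assms by simp
  have p: "0 < p"
    using assms by (simp add: p_def)
  have P: "P = p + \<alpha> / real n"
  proof -
    have "\<alpha> / real n = \<alpha> * (\<gamma> + 1) / (real n * (\<gamma> + 1))"
      using \<open>0 < \<gamma>\<close> by simp
    then show ?thesis
      unfolding P_def p_def by (simp only: add_divide_distrib[symmetric]) (simp add: algebra_simps)
  qed
  \<comment> \<open>After clearing denominators, \<open>P < 1\<close> says exactly this.\<close>
  have "\<alpha> * \<gamma> < real n * \<gamma>"
    using assms by simp
  then have "real n + \<alpha> * \<gamma> < real n * (\<gamma> + 1)"
    by (simp add: algebra_simps)
  then have P1: "P < 1"
    using \<open>0 < \<gamma>\<close> n by (simp add: P_def)
  \<comment> \<open>On numerators: (n - \<alpha>) q_i + n (1 - q_i) + \<alpha> (\<gamma> + q_i) = n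
    + \<alpha> \<gamma>.\<close>
  have e: "P = p * q i + e i" for i
    unfolding P_def p_def e_def times_divide_eq_left add_divide_distrib[symmetric]
    by (simp add: algebra_simps)
  have "\<exists>u. is_minimal_solution \<alpha> M q (\<lambda>i. density lebesgue (\<lambda>x. ennreal (\<sigma> i x)))
      (density lebesgue (\<lambda>x. ennreal (\<omega> x))) u \<and>
    (\<forall>x. 0 < u x) \<and> u \<in> borel_measurable lebesgue \<and> lorentz_integral p (\<gamma> + 1) u < top"
  proof (rule minimal_solution_exists[where P = P and e = e])
    have "(ennreal (\<sigma> i x) = 0) = (\<sigma> i x = 0)" "(ennreal (\<omega> x) = 0) = (\<omega> x = 0)" if "i \<in> {1..M}" for i x
      using assms that by (auto simp: ennreal_eq_0_iff intro: order_antisym)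
    then show "(\<exists>i\<in>{1..M}. \<not> (AE x in lebesgue. ennreal (\<sigma> i x) = 0)) \<or> \<not> (AE x in lebesgue. ennreal (\<omega> x) = 0)"
      using assms(6,10) by fastforce
  qed (use assms p P P1 e in \<open>auto simp: lorentz_space_iff p_def P_def e_def\<close>)
  then obtain u where "is_minimal_solution \<alpha> M q (\<lambda>i. density lebesgue (\<lambda>x. ennreal (\<sigma> i x)))
      (density lebesgue (\<lambda>x. ennreal (\<omega> x))) u"
    "\<forall>x. 0 < u x" "u \<in> borel_measurable lebesgue" "lorentz_integral p (\<gamma> + 1) u < top"
    by blast
  moreover from this have "Liminf at_infinity u = 0"
    using p assms by (intro Liminf_at_infinity_eq_0_if_lorentz[of u p "\<gamma> + 1"]) auto
  ultimately show ?thesis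
    by (intro exI[of _ u]) (simp add: lorentz_space_iff p_def)
qed

end
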